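(* Let $G$ be a Lie group (in the sense of synthetic differential geometry) with Lie algebra $\mathfrak{g}$, and assume that the exponential mapping $\exp:\mathfrak{g}\to G$ exists. Then for all $X,Y\in\mathfrak{g}$ and all $d_{1},d_{2},d_{3},d_{4}\in D$, writing $s=d_{1}+d_{2}+d_{3}+d_{4}$, we have $$\exp(sX)\cdot\exp(sY)=\exp\Big(s\,(X+Y)+\tfrac{1}{2}s^{2}[X,Y]+\tfrac{1}{12}s^{3}\big[[X,Y],Y-X\big]+\tfrac{1}{96}s^{4}\Big(\big[X+Y,[[X,Y],X+Y]\big]+\big[[[X,Y],X-Y],X-Y\big]\Big)\Big).$$
   Context: We work within synthetic differential geometry (a model/axiomatic setting satisfying the general Kock-Lawvere axiom, with line object $\mathbb{R}$, a commutative ring containing the rationals). $D=\{d\in\mathbb{R}\mid d^{2}=0\}$. All maps are automatically smooth, and reasoning is intuitionistic. A Lie group $G$ is a group that is at the same time a microlinear space; its multiplication is denoted by $\cdot$ and its identity by $e$. Its Lie algebra $\mathfrak{g}$ is the tangent space $\mathbf{T}_{e}G$, i.e. the $\mathbb{R}$-module of maps $X:D\to G$, $d\mapsto X_{d}$, with $X_{0}=e$. It carries the standard Lie bracket $[\,,\,]$, which is bilinear and antisymmetric, satisfies the Jacobi identity, and is characterized by $[X,Y]_{d_{1}d_{2}}=X_{d_{1}}\cdot Y_{d_{2}}\cdot X_{-d_{1}}\cdot Y_{-d_{2}}$ for $d_{1},d_{2}\in D$. The exponential mapping $\exp:\mathfrak{g}\to G$, assumed to exist, is the usual one: for each $X\in\mathfrak{g}$,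 the map $t\in\mathbb{R}\mapsto\exp(tX)\in G$ is the unique one-parameter subgroup (group homomorphism from $(\mathbb{R},+)$ to $G$) with $\exp(dX)=X_{d}$ for all $d\in D$. *)

theory Defs
  imports Complex_Main "HOL-Algebra.Ring" "HOL-Algebra.Module"
begin

text \<open>
  The axioms of synthetic differential geometry have no nondegenerate model in classical sets, so
  they are read, as usual, in a category: a cartesian closed category with finite limits (for
  instance a topos) containing a line object. An ``element of \<open>A\<close>'' is a generalized element, that
  is, an arrow \<open>J \<rightarrow> A\<close> from an arbitrary object \<open>J\<close> (the stage of definition), and a universally
  quantified assertion is required at all stages (Kripke-Joyal semantics). Restriction of an
  element \<open>a\<close> at stage \<open>J\<close> along \<open>f : K \<rightarrow> J\<close> is the composite \<open>a \<cdot> f\<close>.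
\<close>

section \<open>Cartesian closed categories with finite limits\<close>

record ('o, 'm) cccat =
  Ob :: "'o set"
  Arr :: "'m set"
  Dom :: "'m \<Rightarrow> 'o"
  Cod :: "'m \<Rightarrow> 'o"
  Idt :: "'o \<Rightarrow> 'm"
  Cmp :: "'m \<Rightarrow> 'm \<Rightarrow> 'm"  (infixr \<open>\<cdot>\<index>\<close> 75)
  One :: "'o"
  Bang :: "'o \<Rightarrow> 'm"
  Prd :: "'o \<Rightarrow> 'o \<Rightarrow> 'o"
  Pr1 :: "'o \<Rightarrow> 'o \<Rightarrow> 'm"
  Pr2 :: "'o \<Rightarrow> 'o \<Rightarrow> 'm"
  Tup :: "'m \<Rightarrow> 'm \<Rightarrow> 'm"  (\<open>\<langle>_, _\<rangle>\<index>\<close>)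
  Eqz :: "'m \<Rightarrow> 'm \<Rightarrow> 'm" \<comment> \<open>the equalizing arrow; its domain is the equalizer\<close>
  Xpn :: "'o \<Rightarrow> 'o \<Rightarrow> 'o" \<comment> \<open>\<open>Xpn E A B\<close> is the exponential of \<open>B\<close> by \<open>A\<close>\<close>
  Evl :: "'o \<Rightarrow> 'o \<Rightarrow> 'm"

definition Hom :: "('o, 'm) cccat \<Rightarrow> 'o \<Rightarrow> 'o \<Rightarrow> 'm set" where
  "Hom E A B = {f \<in> Arr E. Dom E f = A \<and> Cod E f = B}"

locale finite_limit_ccc =
  fixes E :: "('o, 'm) cccat" (structure)
  assumes dom_ob: "f \<in> Arr E \<Longrightarrow> Dom E f \<in> Ob E"
    and cod_ob: "f \<in> Arr E \<Longrightarrow> Cod E f \<in> Ob E"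
    and idt_hom: "A \<in> Ob E \<Longrightarrow> Idt E A \<in> Hom E A A"
    and cmp_hom: "\<lbrakk>f \<in> Hom E A B; g \<in> Hom E B C\<rbrakk> \<Longrightarrow> g \<cdot> f \<in> Hom E A C"
    and cmp_assoc: "\<lbrakk>f \<in> Hom E A B; g \<in> Hom E B C; h \<in> Hom E C F\<rbrakk> \<Longrightarrow> (h \<cdot> g) \<cdot> f = h \<cdot> (g \<cdot> f)"
    and idt_left: "f \<in> Hom E A B \<Longrightarrow> Idt E B \<cdot> f = f"
    and idt_right: "f \<in> Hom E A B \<Longrightarrow> f \<cdot> Idt E A = f"
    and one_ob: "One E \<in> Ob E"
    and bang_hom: "A \<in> Ob E \<Longrightarrow> Bang E A \<in> Hom E A (One E)"
    and bang_unique: "f \<in> Hom E A (One E) \<Longrightarrow> f = Bang E A"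
    and prd_ob: "\<lbrakk>A \<in> Ob E; B \<in> Ob E\<rbrakk> \<Longrightarrow> Prd E A B \<in> Ob E"
    and pr1_hom: "\<lbrakk>A \<in> Ob E; B \<in> Ob E\<rbrakk> \<Longrightarrow> Pr1 E A B \<in> Hom E (Prd E A B) A"
    and pr2_hom: "\<lbrakk>A \<in> Ob E; B \<in> Ob E\<rbrakk> \<Longrightarrow> Pr2 E A B \<in> Hom E (Prd E A B) B"
    and tup_hom: "\<lbrakk>f \<in> Hom E J A; g \<in> Hom E J B\<rbrakk> \<Longrightarrow> \<langle>f, g\<rangle> \<in> Hom E J (Prd E A B)"
    and pr1_tup: "\<lbrakk>f \<in> Hom E J A; g \<in> Hom E J B\<rbrakk> \<Longrightarrow> Pr1 E A B \<cdot> \<langle>f, g\<rangle> = f"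
    and pr2_tup: "\<lbrakk>f \<in> Hom E J A; g \<in> Hom E J B\<rbrakk> \<Longrightarrow> Pr2 E A B \<cdot> \<langle>f, g\<rangle> = g"
    and tup_unique:
      "\<lbrakk>A \<in> Ob E; B \<in> Ob E; h \<in> Hom E J (Prd E A B)\<rbrakk> \<Longrightarrow> \<langle>Pr1 E A B \<cdot> h, Pr2 E A B \<cdot> h\<rangle> = h"
    and eqz_hom:
      "\<lbrakk>f \<in> Hom E A B; g \<in> Hom E A B\<rbrakk> \<Longrightarrow> Eqz E f g \<in> Hom E (Dom E (Eqz E f g)) A"
    and eqz_eq: "\<lbrakk>f \<in> Hom E A B; g \<in> Hom E A B\<rbrakk> \<Longrightarrow> f \<cdot> Eqz E f g = g \<cdot> Eqz E f g"
    and eqz_universal: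
      "\<lbrakk>f \<in> Hom E A B; g \<in> Hom E A B; h \<in> Hom E J A; f \<cdot> h = g \<cdot> h\<rbrakk>
       \<Longrightarrow> \<exists>!u. u \<in> Hom E J (Dom E (Eqz E f g)) \<and> Eqz E f g \<cdot> u = h"
    and xpn_ob: "\<lbrakk>A \<in> Ob E; B \<in> Ob E\<rbrakk> \<Longrightarrow> Xpn E A B \<in> Ob E"
    and evl_hom: "\<lbrakk>A \<in> Ob E; B \<in> Ob E\<rbrakk> \<Longrightarrow> Evl E A B \<in> Hom E (Prd E (Xpn E A B) A) B"
    and evl_universal:
      "\<lbrakk>J \<in> Ob E; A \<in> Ob E; B \<in> Ob E; f \<in> Hom E (Prd E J A) B\<rbrakk>
       \<Longrightarrow> \<exists>!u. u \<in> Hom E J (Xpn E A B) \<and> Evl E A B \<cdot> \<langle>u \<cdot> Pr1 E J A, Pr2 E J A\<rangle> = f"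


section \<open>Ring and group objects\<close>

record ('o, 'm) ring_object =
  robj :: "'o"
  radd :: "'m"
  rmul :: "'m"
  rrat :: "rat \<Rightarrow> 'm" \<comment> \<open>the rationals as global elements\<close>

definition rat_at :: "('o, 'm) cccat \<Rightarrow> ('o, 'm) ring_object \<Rightarrow> 'o \<Rightarrow> rat \<Rightarrow> 'm" where
  "rat_at E R J q = rrat R q \<cdot>\<^bsub>E\<^esub> Bang E J"

definition ring_at :: "('o, 'm) cccat \<Rightarrow> ('o, 'm) ring_object \<Rightarrow> 'o \<Rightarrow> 'm ring" where
  "ring_at E R J =
    \<lparr>carrier = Hom E J (robj R),
     mult = (\<lambda>a b. rmul R \<cdot>\<^bsub>E\<^esub> \<langle>a, b\<rangle>\<^bsub>E\<^esub>),
     one = rat_at E R J 1,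
     zero = rat_at E R J 0,
     add = (\<lambda>a b. radd R \<cdot>\<^bsub>E\<^esub> \<langle>a, b\<rangle>\<^bsub>E\<^esub>)\<rparr>"

text \<open>By the Yoneda lemma, the stagewise ring axioms (including additive inverses) express that the
  arrows make \<open>robj R\<close> a commutative ring object; likewise for group objects below.\<close>

definition rational_ring_object :: "('o, 'm) cccat \<Rightarrow> ('o, 'm) ring_object \<Rightarrow> bool" where
  "rational_ring_object E R \<longleftrightarrow>
     robj R \<in> Ob E \<and>
     radd R \<in> Hom E (Prd E (robj R) (robj R)) (robj R) \<and>
     rmul R \<in> Hom E (Prd E (robj R) (robj R)) (robj R) \<and>
     (\<forall>q. rrat R q \<in> Hom E (One E) (robj R)) \<and>
     inj (rrat R) \<and>
     (\<forall>J \<in> Ob E. cring (ring_at E R J)) \<and>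
     (\<forall>p q. rrat R (p + q) = rrat R p \<oplus>\<^bsub>ring_at E R (One E)\<^esub> rrat R q) \<and>
     (\<forall>p q. rrat R (p * q) = rrat R p \<otimes>\<^bsub>ring_at E R (One E)\<^esub> rrat R q)"

record ('o, 'm) group_object =
  gobj :: "'o"
  gmul :: "'m"
  gunit :: "'m"

definition group_at :: "('o, 'm) cccat \<Rightarrow> ('o, 'm) group_object \<Rightarrow> 'o \<Rightarrow> 'm monoid" where
  "group_at E G J =
    \<lparr>carrier = Hom E J (gobj G),
     mult = (\<lambda>a b. gmul G \<cdot>\<^bsub>E\<^esub> \<langle>a, b\<rangle>\<^bsub>E\<^esub>),
     one = gunit G \<cdot>\<^bsub>E\<^esub> Bang E J\<rparr>"

definition group_object :: "('o, 'm) cccat \<Rightarrow> ('o, 'm) group_object \<Rightarrow> bool" where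
  "group_object E G \<longleftrightarrow>
     gobj G \<in> Ob E \<and>
     gmul G \<in> Hom E (Prd E (gobj G) (gobj G)) (gobj G) \<and>
     gunit G \<in> Hom E (One E) (gobj G) \<and>
     (\<forall>J \<in> Ob E. group (group_at E G J))"


section \<open>Weil algebras and the Kock-Lawvere axiom\<close>

text \<open>A Weil algebra of dimension \<open>n + 1\<close> over the rationals, given by its structure constants: the
  product of the basis vectors \<open>e\<^sub>i\<close> and \<open>e\<^sub>j\<close> has \<open>k\<close>-th coordinate \<open>c i j k\<close>. The vector \<open>e\<^sub>0\<close> is
  the unit, and \<open>e\<^sub>1, \<dots>, e\<^sub>n\<close> span a nilpotent ideal.\<close>

definition weil_mult ::
    "nat \<Rightarrow> (nat \<Rightarrow> nat \<Rightarrow> nat \<Rightarrow> rat) \<Rightarrow> (nat \<Rightarrow> rat) \<Rightarrow> (nat \<Rightarrow> rat) \<Rightarrow> nat \<Rightarrow> rat" where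
  "weil_mult n c v w = (\<lambda>k. \<Sum>i\<le>n. \<Sum>j\<le>n. v i * w j * c i j k)"

definition weil_algebra :: "nat \<Rightarrow> (nat \<Rightarrow> nat \<Rightarrow> nat \<Rightarrow> rat) \<Rightarrow> bool" where
  "weil_algebra n c \<longleftrightarrow>
     (\<forall>i\<le>n. \<forall>k\<le>n. c 0 i k = (if i = k then 1 else 0)) \<and>
     (\<forall>i\<le>n. \<forall>j\<le>n. \<forall>k\<le>n. c i j k = c j i k) \<and>
     (\<forall>i\<le>n. \<forall>j\<le>n. \<forall>k\<le>n. \<forall>m\<le>n. (\<Sum>l\<le>n. c i j l * c l k m) = (\<Sum>l\<le>n. c j k l * c i l m)) \<and>
     (\<forall>i\<in>{1..n}. \<forall>j\<le>n. c i j 0 = 0) \<and>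
     (\<exists>N. \<forall>vs. length vs = N \<and> (\<forall>v \<in> set vs. v 0 = 0) \<longrightarrow>
        (\<forall>k\<le>n. foldr (weil_mult n c) vs (\<lambda>i. if i = 0 then 1 else 0) k = 0))"

text \<open>\<open>represents E R n P S x\<close>: the object \<open>S\<close>, with coordinates \<open>x 0, \<dots>, x (n - 1)\<close>, is the
  subobject of the \<open>n\<close>-fold power of the line cut out by the condition \<open>P\<close>. A predicate on
  coordinates takes the stage as its first argument.\<close>

definition represents ::
    "('o, 'm) cccat \<Rightarrow> ('o, 'm) ring_object \<Rightarrow> nat \<Rightarrow> ('o \<Rightarrow> (nat \<Rightarrow> 'm) \<Rightarrow> bool) \<Rightarrow>
     'o \<Rightarrow> (nat \<Rightarrow> 'm) \<Rightarrow> bool" where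
  "represents E R n P S x \<longleftrightarrow>
     S \<in> Ob E \<and> (\<forall>i<n. x i \<in> Hom E S (robj R)) \<and> P S x \<and>
     (\<forall>J \<in> Ob E. \<forall>y. (\<forall>i<n. y i \<in> Hom E J (robj R)) \<and> P J y \<longrightarrow>
        (\<exists>!u. u \<in> Hom E J S \<and> (\<forall>i<n. x i \<cdot>\<^bsub>E\<^esub> u = y i)))"

text \<open>The points of the spectrum of a Weil algebra are its algebra homomorphisms to the line, given
  by the images of the basis vectors.\<close>

definition weil_point ::
    "('o, 'm) cccat \<Rightarrow> ('o, 'm) ring_object \<Rightarrow> nat \<Rightarrow> (nat \<Rightarrow> nat \<Rightarrow> nat \<Rightarrow> rat) \<Rightarrow>
     'o \<Rightarrow> (nat \<Rightarrow> 'm) \<Rightarrow> bool" where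
  "weil_point E R n c J y \<longleftrightarrow>
     y 0 = \<one>\<^bsub>ring_at E R J\<^esub> \<and>
     (\<forall>i\<le>n. \<forall>j\<le>n. y i \<otimes>\<^bsub>ring_at E R J\<^esub> y j =
        (\<Oplus>\<^bsub>ring_at E R J\<^esub>k\<in>{..n}. rat_at E R J (c i j k) \<otimes>\<^bsub>ring_at E R J\<^esub> y k))"

definition weil_spectrum ::
    "('o, 'm) cccat \<Rightarrow> ('o, 'm) ring_object \<Rightarrow> nat \<Rightarrow> (nat \<Rightarrow> nat \<Rightarrow> nat \<Rightarrow> rat) \<Rightarrow>
     'o \<Rightarrow> (nat \<Rightarrow> 'm) \<Rightarrow> bool" where
  "weil_spectrum E R n c S x \<longleftrightarrow>
     weil_algebra n c \<and> represents E R (Suc n) (weil_point E R n c) S x"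

text \<open>The general Kock-Lawvere axiom: for each Weil algebra \<open>W\<close> the canonical arrow from the
  \<open>n + 1\<close>-fold power of the line (that is, \<open>R \<otimes> W\<close>) to the exponential of \<open>R\<close> by the spectrum of
  \<open>W\<close> is invertible. Arrows \<open>J \<rightarrow> R\<^sup>S\<close> are given by their transposes \<open>J \<times> S \<rightarrow> R\<close>.\<close>

definition kock_lawvere :: "('o, 'm) cccat \<Rightarrow> ('o, 'm) ring_object \<Rightarrow> bool" where
  "kock_lawvere E R \<longleftrightarrow>
     (\<forall>n c S x. weil_spectrum E R n c S x \<longrightarrow>
       (\<forall>J \<in> Ob E. \<forall>f \<in> Hom E (Prd E J S) (robj R).
          \<exists>!a. a \<in> {..n} \<rightarrow>\<^sub>E Hom E J (robj R) \<and>
               f = (\<Oplus>\<^bsub>ring_at E R (Prd E J S)\<^esub>i\<in>{..n}.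
                      (a i \<cdot>\<^bsub>E\<^esub> Pr1 E J S) \<otimes>\<^bsub>ring_at E R (Prd E J S)\<^esub> (x i \<cdot>\<^bsub>E\<^esub> Pr2 E J S))))"

locale sdg_model = finite_limit_ccc E for E :: "('o, 'm) cccat" +
  fixes R :: "('o, 'm) ring_object"
  assumes line: "rational_ring_object E R"
    and kock_lawvere: "kock_lawvere E R"


section \<open>Microlinearity and Lie groups\<close>

text \<open>A finite diagram with vertices \<open>V\<close> and edges \<open>A\<close>, and a cocone \<open>c\<close> under it with vertex \<open>T\<close>.
  All objects involved are spectra of Weil algebras.\<close>

definition infinitesimal_cocone ::
    "('o, 'm) cccat \<Rightarrow> ('o, 'm) ring_object \<Rightarrow> nat set \<Rightarrow> (nat \<Rightarrow> 'o) \<Rightarrow> (nat \<times> 'm \<times> nat) set \<Rightarrow>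
     'o \<Rightarrow> (nat \<Rightarrow> 'm) \<Rightarrow> bool" where
  "infinitesimal_cocone E R V S A T c \<longleftrightarrow>
     finite V \<and> finite A \<and>
     (\<forall>i\<in>V. \<exists>n w x. weil_spectrum E R n w (S i) x) \<and>
     (\<exists>n w x. weil_spectrum E R n w T x) \<and>
     (\<forall>(i, u, j)\<in>A. i \<in> V \<and> j \<in> V \<and> u \<in> Hom E (S i) (S j)) \<and>
     (\<forall>i\<in>V. c i \<in> Hom E (S i) T) \<and>
     (\<forall>(i, u, j)\<in>A. c j \<cdot>\<^bsub>E\<^esub> u = c i)"

definition stage_times :: "('o, 'm) cccat \<Rightarrow> 'o \<Rightarrow> 'm \<Rightarrow> 'm" where
  "stage_times E J u = \<langle>Pr1 E J (Dom E u), u \<cdot>\<^bsub>E\<^esub> Pr2 E J (Dom E u)\<rangle>\<^bsub>E\<^esub>"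

text \<open>\<open>M\<close> perceives the cocone as a colimit: exponentiating \<open>M\<close> by it gives a limit cone.\<close>

definition perceives_colimit ::
    "('o, 'm) cccat \<Rightarrow> 'o \<Rightarrow> nat set \<Rightarrow> (nat \<Rightarrow> 'o) \<Rightarrow> (nat \<times> 'm \<times> nat) set \<Rightarrow>
     'o \<Rightarrow> (nat \<Rightarrow> 'm) \<Rightarrow> bool" where
  "perceives_colimit E M V S A T c \<longleftrightarrow>
     (\<forall>J \<in> Ob E. \<forall>\<phi>.
        (\<forall>i\<in>V. \<phi> i \<in> Hom E (Prd E J (S i)) M) \<and>
        (\<forall>(i, u, j)\<in>A. \<phi> j \<cdot>\<^bsub>E\<^esub> stage_times E J u = \<phi> i) \<longrightarrow>
        (\<exists>!\<psi>. \<psi> \<in> Hom E (Prd E J T) M \<and> (\<forall>i\<in>V. \<psi> \<cdot>\<^bsub>E\<^esub> stage_times E J (c i) = \<phi> i)))"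

text \<open>The cocones perceived as colimits by the line are the finite quasi-colimits.\<close>

definition microlinear :: "('o, 'm) cccat \<Rightarrow> ('o, 'm) ring_object \<Rightarrow> 'o \<Rightarrow> bool" where
  "microlinear E R M \<longleftrightarrow>
     (\<forall>V S A T c. infinitesimal_cocone E R V S A T c \<and> perceives_colimit E (robj R) V S A T c \<longrightarrow>
        perceives_colimit E M V S A T c)"

definition lie_group ::
    "('o, 'm) cccat \<Rightarrow> ('o, 'm) ring_object \<Rightarrow> ('o, 'm) group_object \<Rightarrow> bool" where
  "lie_group E R G \<longleftrightarrow> group_object E G \<and> microlinear E R (gobj G)"


section \<open>The Lie algebra\<close>

definition nilsq :: "('o, 'm) cccat \<Rightarrow> ('o, 'm) ring_object \<Rightarrow> 'o \<Rightarrow> 'm set" where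
  "nilsq E R J =
     {d \<in> carrier (ring_at E R J). d \<otimes>\<^bsub>ring_at E R J\<^esub> d = \<zero>\<^bsub>ring_at E R J\<^esub>}"

text \<open>The object \<open>D\<close> as a subobject of the line. Its elements at stage \<open>J\<close> correspond to
  \<open>nilsq E R J\<close> via \<open>D_elem\<close>.\<close>

definition D_incl :: "('o, 'm) cccat \<Rightarrow> ('o, 'm) ring_object \<Rightarrow> 'm" where
  "D_incl E R = (let K = ring_at E R (robj R); t = Idt E (robj R) in Eqz E (t \<otimes>\<^bsub>K\<^esub> t) \<zero>\<^bsub>K\<^esub>)"

definition D_ob :: "('o, 'm) cccat \<Rightarrow> ('o, 'm) ring_object \<Rightarrow> 'o" where
  "D_ob E R = Dom E (D_incl E R)"

definition D_elem :: "('o, 'm) cccat \<Rightarrow> ('o, 'm) ring_object \<Rightarrow> 'm \<Rightarrow> 'm" where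
  "D_elem E R d = (THE u. u \<in> Hom E (Dom E d) (D_ob E R) \<and> D_incl E R \<cdot>\<^bsub>E\<^esub> u = d)"

text \<open>The tangent space at the identity: the equalizer, inside the exponential of \<open>G\<close> by \<open>D\<close>, of
  evaluation at 0 and the constant \<open>e\<close>.\<close>

definition lie_incl ::
    "('o, 'm) cccat \<Rightarrow> ('o, 'm) ring_object \<Rightarrow> ('o, 'm) group_object \<Rightarrow> 'm" where
  "lie_incl E R G =
     (let T = Xpn E (D_ob E R) (gobj G) in
        Eqz E (Evl E (D_ob E R) (gobj G) \<cdot>\<^bsub>E\<^esub> \<langle>Idt E T, D_elem E R \<zero>\<^bsub>ring_at E R T\<^esub>\<rangle>\<^bsub>E\<^esub>)
              \<one>\<^bsub>group_at E G T\<^esub>)"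

definition lie_ob ::
    "('o, 'm) cccat \<Rightarrow> ('o, 'm) ring_object \<Rightarrow> ('o, 'm) group_object \<Rightarrow> 'o" where
  "lie_ob E R G = Dom E (lie_incl E R G)"

text \<open>\<open>tapp E R G X d\<close> is \<open>X\<^sub>d\<close>, for \<open>X\<close> in the Lie algebra and \<open>d\<close> in \<open>D\<close> at the same stage.\<close>

definition tapp ::
    "('o, 'm) cccat \<Rightarrow> ('o, 'm) ring_object \<Rightarrow> ('o, 'm) group_object \<Rightarrow> 'm \<Rightarrow> 'm \<Rightarrow> 'm" where
  "tapp E R G X d =
     Evl E (D_ob E R) (gobj G) \<cdot>\<^bsub>E\<^esub> \<langle>lie_incl E R G \<cdot>\<^bsub>E\<^esub> X, D_elem E R d\<rangle>\<^bsub>E\<^esub>"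

definition tzero ::
    "('o, 'm) cccat \<Rightarrow> ('o, 'm) ring_object \<Rightarrow> ('o, 'm) group_object \<Rightarrow> 'o \<Rightarrow> 'm" where
  "tzero E R G J =
     (THE Z. Z \<in> Hom E J (lie_ob E R G) \<and>
        (\<forall>K. \<forall>f \<in> Hom E K J. \<forall>d \<in> nilsq E R K.
           tapp E R G (Z \<cdot>\<^bsub>E\<^esub> f) d = \<one>\<^bsub>group_at E G K\<^esub>))"

definition tsmult ::
    "('o, 'm) cccat \<Rightarrow> ('o, 'm) ring_object \<Rightarrow> ('o, 'm) group_object \<Rightarrow> 'o \<Rightarrow> 'm \<Rightarrow> 'm \<Rightarrow> 'm" where
  "tsmult E R G J r X =
     (THE Z. Z \<in> Hom E J (lie_ob E R G) \<and>
        (\<forall>K. \<forall>f \<in> Hom E K J. \<forall>d \<in> nilsq E R K.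
           tapp E R G (Z \<cdot>\<^bsub>E\<^esub> f) d =
           tapp E R G (X \<cdot>\<^bsub>E\<^esub> f) ((r \<cdot>\<^bsub>E\<^esub> f) \<otimes>\<^bsub>ring_at E R K\<^esub> d)))"

text \<open>Addition of tangent vectors on a microlinear space: \<open>(X + Y)\<^sub>d = l (d, d)\<close>, where \<open>l\<close> is the map
  on \<open>D(2) = {(p, q). p\<^sup>2 = q\<^sup>2 = p q = 0}\<close> with \<open>l (d, 0) = X\<^sub>d\<close> and \<open>l (0, d) = Y\<^sub>d\<close>.\<close>

definition D2_point ::
    "('o, 'm) cccat \<Rightarrow> ('o, 'm) ring_object \<Rightarrow> 'o \<Rightarrow> (nat \<Rightarrow> 'm) \<Rightarrow> bool" where
  "D2_point E R J y \<longleftrightarrow>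
     (\<forall>i<2. \<forall>j<2. y i \<otimes>\<^bsub>ring_at E R J\<^esub> y j = \<zero>\<^bsub>ring_at E R J\<^esub>)"

definition tadd ::
    "('o, 'm) cccat \<Rightarrow> ('o, 'm) ring_object \<Rightarrow> ('o, 'm) group_object \<Rightarrow> 'o \<Rightarrow> 'm \<Rightarrow> 'm \<Rightarrow> 'm" where
  "tadd E R G J X Y =
     (THE Z. Z \<in> Hom E J (lie_ob E R G) \<and>
        (\<exists>S p l. represents E R 2 (D2_point E R) S p \<and> l \<in> Hom E (Prd E J S) (gobj G) \<and>
           (\<forall>K. \<forall>f \<in> Hom E K J. \<forall>u \<in> Hom E K S.
              (p 1 \<cdot>\<^bsub>E\<^esub> u = \<zero>\<^bsub>ring_at E R K\<^esub> \<longrightarrow>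
                 l \<cdot>\<^bsub>E\<^esub> \<langle>f, u\<rangle>\<^bsub>E\<^esub> = tapp E R G (X \<cdot>\<^bsub>E\<^esub> f) (p 0 \<cdot>\<^bsub>E\<^esub> u)) \<and>
              (p 0 \<cdot>\<^bsub>E\<^esub> u = \<zero>\<^bsub>ring_at E R K\<^esub> \<longrightarrow>
                 l \<cdot>\<^bsub>E\<^esub> \<langle>f, u\<rangle>\<^bsub>E\<^esub> = tapp E R G (Y \<cdot>\<^bsub>E\<^esub> f) (p 1 \<cdot>\<^bsub>E\<^esub> u)) \<and>
              (p 0 \<cdot>\<^bsub>E\<^esub> u = p 1 \<cdot>\<^bsub>E\<^esub> u \<longrightarrow>
                 l \<cdot>\<^bsub>E\<^esub> \<langle>f, u\<rangle>\<^bsub>E\<^esub> = tapp E R G (Z \<cdot>\<^bsub>E\<^esub> f) (p 0 \<cdot>\<^bsub>E\<^esub> u)))))"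

definition lie_bracket ::
    "('o, 'm) cccat \<Rightarrow> ('o, 'm) ring_object \<Rightarrow> ('o, 'm) group_object \<Rightarrow> 'o \<Rightarrow> 'm \<Rightarrow> 'm \<Rightarrow> 'm" where
  "lie_bracket E R G J X Y =
     (THE Z. Z \<in> Hom E J (lie_ob E R G) \<and>
        (\<forall>K. \<forall>f \<in> Hom E K J. \<forall>d\<^sub>1 \<in> nilsq E R K. \<forall>d\<^sub>2 \<in> nilsq E R K.
           tapp E R G (Z \<cdot>\<^bsub>E\<^esub> f) (d\<^sub>1 \<otimes>\<^bsub>ring_at E R K\<^esub> d\<^sub>2) =
             tapp E R G (X \<cdot>\<^bsub>E\<^esub> f) d\<^sub>1 \<otimes>\<^bsub>group_at E G K\<^esub>
             tapp E R G (Y \<cdot>\<^bsub>E\<^esub> f) d\<^sub>2 \<otimes>\<^bsub>group_at E G K\<^esub>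
             tapp E R G (X \<cdot>\<^bsub>E\<^esub> f) (\<ominus>\<^bsub>ring_at E R K\<^esub> d\<^sub>1) \<otimes>\<^bsub>group_at E G K\<^esub>
             tapp E R G (Y \<cdot>\<^bsub>E\<^esub> f) (\<ominus>\<^bsub>ring_at E R K\<^esub> d\<^sub>2)))"

text \<open>The module structure on the elements of the Lie algebra at stage \<open>J\<close>. The multiplicative
  part of the record, on which modules impose no condition, holds the bracket.\<close>

definition lie_algebra_at ::
    "('o, 'm) cccat \<Rightarrow> ('o, 'm) ring_object \<Rightarrow> ('o, 'm) group_object \<Rightarrow> 'o \<Rightarrow> ('m, 'm) module" where
  "lie_algebra_at E R G J =
    \<lparr>carrier = Hom E J (lie_ob E R G),
     mult = lie_bracket E R G J,
     one = undefined,
     zero = tzero E R G J,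
     add = tadd E R G J,
     smult = tsmult E R G J\<rparr>"


section \<open>The exponential map\<close>

text \<open>\<open>\<phi>\<close> is a map from \<open>R\<close> to \<open>G\<close> at stage \<open>J\<close>, that is, a transposed element of the exponential
  of \<open>G\<close> by \<open>R\<close>.\<close>

definition one_param_subgroup ::
    "('o, 'm) cccat \<Rightarrow> ('o, 'm) ring_object \<Rightarrow> ('o, 'm) group_object \<Rightarrow> 'o \<Rightarrow> 'm \<Rightarrow> bool" where
  "one_param_subgroup E R G J \<phi> \<longleftrightarrow>
     \<phi> \<in> Hom E (Prd E J (robj R)) (gobj G) \<and>
     (\<forall>K. \<forall>f \<in> Hom E K J. \<forall>t \<in> Hom E K (robj R). \<forall>t' \<in> Hom E K (robj R).
        \<phi> \<cdot>\<^bsub>E\<^esub> \<langle>f, t \<oplus>\<^bsub>ring_at E R K\<^esub> t'\<rangle>\<^bsub>E\<^esub> =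
        (\<phi> \<cdot>\<^bsub>E\<^esub> \<langle>f, t\<rangle>\<^bsub>E\<^esub>) \<otimes>\<^bsub>group_at E G K\<^esub> (\<phi> \<cdot>\<^bsub>E\<^esub> \<langle>f, t'\<rangle>\<^bsub>E\<^esub>))"

definition has_velocity ::
    "('o, 'm) cccat \<Rightarrow> ('o, 'm) ring_object \<Rightarrow> ('o, 'm) group_object \<Rightarrow> 'o \<Rightarrow> 'm \<Rightarrow> 'm \<Rightarrow> bool" where
  "has_velocity E R G J \<phi> X \<longleftrightarrow>
     (\<forall>K. \<forall>f \<in> Hom E K J. \<forall>d \<in> nilsq E R K.
        \<phi> \<cdot>\<^bsub>E\<^esub> \<langle>f, d\<rangle>\<^bsub>E\<^esub> = tapp E R G (X \<cdot>\<^bsub>E\<^esub> f) d)"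

text \<open>The map \<open>t \<mapsto> ex (t X)\<close>, where \<open>t\<close> is the generic element of the line over \<open>J\<close>.\<close>

definition exp_curve ::
    "('o, 'm) cccat \<Rightarrow> ('o, 'm) ring_object \<Rightarrow> ('o, 'm) group_object \<Rightarrow> 'm \<Rightarrow> 'o \<Rightarrow> 'm \<Rightarrow> 'm" where
  "exp_curve E R G ex J X =
     ex \<cdot>\<^bsub>E\<^esub> (Pr2 E J (robj R) \<odot>\<^bsub>lie_algebra_at E R G (Prd E J (robj R))\<^esub> (X \<cdot>\<^bsub>E\<^esub> Pr1 E J (robj R)))"

definition exponential_map ::
    "('o, 'm) cccat \<Rightarrow> ('o, 'm) ring_object \<Rightarrow> ('o, 'm) group_object \<Rightarrow> 'm \<Rightarrow> bool" where
  "exponential_map E R G ex \<longleftrightarrow>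
     ex \<in> Hom E (lie_ob E R G) (gobj G) \<and>
     (\<forall>J \<in> Ob E. \<forall>X \<in> Hom E J (lie_ob E R G).
        one_param_subgroup E R G J (exp_curve E R G ex J X) \<and>
        has_velocity E R G J (exp_curve E R G ex J X) X \<and>
        (\<forall>\<phi>. one_param_subgroup E R G J \<phi> \<and> has_velocity E R G J \<phi> X \<longrightarrow>
             \<phi> = exp_curve E R G ex J X))"

end

theory Submission
  imports Defs
begin

text \<open>
  Put \<open>L(s) = exp (s X) \<cdot> exp (s Y)\<close> and \<open>Q(s) = exp (Z(s))\<close>, where \<open>Z(s)\<close> is the polynomial on the
  right-hand side. As \<open>s\<close> is a sum of elements of \<open>D\<close>, it suffices to pass from \<open>L(s) = Q(s)\<close> to
  \<open>L(s + d) = Q(s + d)\<close> for \<open>d \<in> D\<close> and \<open>s\<close> a sum of three elements of \<open>D\<close>, so that \<open>s\<^sup>4 = 0\<close>. Here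
  \<open>L(s + d) = V\<^sub>d \<cdot> L(s)\<close> with \<open>V = X + exp (s ad X) Y\<close>, and \<open>Q(s + d) = U\<^sub>d \<cdot> Q(s)\<close> with
  \<open>U = Z' + [Z, Z'] / 2 + [Z, [Z, Z']] / 6 + \<dots>\<close>, by uniqueness of the one-parameter subgroup with
  velocity \<open>Z(s) + d Z'(s)\<close>. It remains to compare the coefficients of \<open>1, s, s\<^sup>2, s\<^sup>3\<close> in \<open>U\<close> and \<open>V\<close>.

  The Lie algebra axioms come from the identity \<open>X\<^sub>a \<cdot> W\<^sub>d \<cdot> X\<^sub>-\<^sub>a = (W + a [X, W])\<^sub>d\<close>: conjugation is
  linear and preserves brackets, and \<open>a\<close> can be cancelled. Microlinearity is used for two
  quasi-colimits only: \<open>D(2)\<close> as the union of its axes, and \<open>D\<close> as the quotient of \<open>D \<times> D\<close> that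
  collapses the axes, via multiplication.
\<close>

text \<open>The obstacle is that \<open>exp\<close> cannot be differentiated: for an arbitrary
  scalar \<open>t\<close> nothing is known about conjugation by \<open>exp (t z)\<close>. For
  \<open>exp (t s z)\<close> with \<open>s = a + b + c\<close> it is known: this is the product of
  the values of \<open>z\<close> at \<open>t a\<close>, \<open>t b\<close>, \<open>t c\<close>,
  which are nilsquare again, and each of them conjugates by an explicit formula. Hence the induction
  carries three separate summands and not just the equation \<open>s^4 = 0\<close>. The equation for
  \<open>U\<close> rests on a cocycle identity,
  \<open>U(t + t') = U(t) + exp (t s ad z) U(t')\<close>, which makes a guessed curve multiplicative
  in \<open>t\<close>. Its coefficients are divided powers of \<open>t\<close>. As \<open>s\<close>
  is one fixed scalar, a polynomial in \<open>s\<close> need not determine its coefficients; their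
  agreement serves only as a sufficient condition. Objects introduced by \<open>THE\<close> are
  treated uniformly: a natural family of group elements yields a tangent vector, and tangent vectors
  are compared at all later stages.\<close>

section \<open>Rational Lie algebras\<close>

text \<open>Jacobi appears as the Leibniz rule for \<open>br z\<close>, the form in which invariance
  of the bracket under infinitesimal conjugation delivers it. Linearity is required on the right
  only, since skew-symmetry carries it to the left.\<close>

locale lie_algebra = module R M for R :: "('a, 'c) ring_scheme" (structure) and M (structure) +
  fixes br
  assumes br_closed [simp, intro]: "\<lbrakk>x \<in> carrier M; y \<in> carrier M\<rbrakk> \<Longrightarrow> br x y \<in> carrier M"
    and br_add_right: "\<lbrakk>x \<in> carrier M; y \<in> carrier M; z \<in> carrier M\<rbrakk> \<Longrightarrow>
      br x (y \<oplus>\<^bsub>M\<^esub> z) = br x y \<oplus>\<^bsub>M\<^esub> br x z"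
    and br_smult_right: "\<lbrakk>a \<in> carrier R; x \<in> carrier M; y \<in> carrier M\<rbrakk> \<Longrightarrow>
      br x (a \<odot>\<^bsub>M\<^esub> y) = a \<odot>\<^bsub>M\<^esub> br x y"
    and br_self: "x \<in> carrier M \<Longrightarrow> br x x = \<zero>\<^bsub>M\<^esub>"
    and br_skew: "\<lbrakk>x \<in> carrier M; y \<in> carrier M\<rbrakk> \<Longrightarrow> br y x = \<ominus>\<^bsub>M\<^esub> br x y"
    and jacobi: "\<lbrakk>x \<in> carrier M; y \<in> carrier M; z \<in> carrier M\<rbrakk> \<Longrightarrow>
      br z (br x y) = br (br z x) y \<oplus>\<^bsub>M\<^esub> br x (br z y)"

lemma (in abelian_group) add_left_cancel:
  assumes "x \<in> carrier G" "y \<in> carrier G" "z \<in> carrier G"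
  shows "x \<oplus> y = x \<oplus> z \<longleftrightarrow> y = z"
  using assms by (metis r_neg1)

text \<open>Made for comparing two expressions of one conjugate of \<open>x + y\<close>: the
  correction \<open>u\<close> of the sum against the corrections \<open>v\<close> and
  \<open>w\<close> of the summands.\<close>

lemma (in abelian_group) add4_cancel:
  assumes "(x \<oplus> y) \<oplus> u = (x \<oplus> v) \<oplus> (y \<oplus> w)"
    and "x \<in> carrier G" "y \<in> carrier G" "u \<in> carrier G" "v \<in> carrier G" "w \<in> carrier G"
  shows "u = v \<oplus> w"
proof -
  have "(x \<oplus> v) \<oplus> (y \<oplus> w) = (x \<oplus> y) \<oplus> (v \<oplus> w)"
    using assms(2-) by (simp add: a_ac)
  with assms show ?thesis using add_left_cancel[of "x \<oplus> y" u "v \<oplus> w"] by simp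
qed

section \<open>Bilinearity of the bracket, and cubic polynomials with vector coefficients\<close>

context lie_algebra
begin

abbreviation module_add (infixl \<open>+\<^sub>M\<close> 65) where "x +\<^sub>M y \<equiv> x \<oplus>\<^bsub>M\<^esub> y"
abbreviation module_smult (infixl \<open>*\<^sub>M\<close> 70) where "a *\<^sub>M x \<equiv> a \<odot>\<^bsub>M\<^esub> x"
abbreviation module_zero (\<open>0\<^sub>M\<close>) where "0\<^sub>M \<equiv> \<zero>\<^bsub>M\<^esub>"
abbreviation module_minus (\<open>-\<^sub>M _\<close> [81] 80) where "-\<^sub>M x \<equiv> \<ominus>\<^bsub>M\<^esub> x"

lemma br_add_left: "\<lbrakk>x \<in> carrier M; y \<in> carrier M; z \<in> carrier M\<rbrakk> \<Longrightarrow>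
    br (x +\<^sub>M y) z = br x z +\<^sub>M br y z"
  using br_skew[of z "x +\<^sub>M y"] br_skew[of z x] br_skew[of z y] by (simp add: br_add_right M.minus_add)

lemma br_smult_left: "\<lbrakk>a \<in> carrier R; x \<in> carrier M; y \<in> carrier M\<rbrakk> \<Longrightarrow>
    br (a *\<^sub>M x) y = a *\<^sub>M br x y"
  using br_skew[of y "a *\<^sub>M x"] br_skew[of y x] by (simp add: br_smult_right smult_r_minus)

lemma br_minus_right: "\<lbrakk>x \<in> carrier M; y \<in> carrier M\<rbrakk> \<Longrightarrow> br x (-\<^sub>M y) = -\<^sub>M br x y"
  using br_smult_right[of "\<ominus> \<one>" x y] by (simp add: smult_l_minus)

lemma br_minus_left: "\<lbrakk>x \<in> carrier M; y \<in> carrier M\<rbrakk> \<Longrightarrow> br (-\<^sub>M x) y = -\<^sub>M br x y"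
  using br_smult_left[of "\<ominus> \<one>" x y] by (simp add: smult_l_minus)

lemma br_zero_right [simp]: "x \<in> carrier M \<Longrightarrow> br x 0\<^sub>M = 0\<^sub>M"
  using br_smult_right[of \<zero> x "0\<^sub>M"] by simp

lemma br_zero_left [simp]: "x \<in> carrier M \<Longrightarrow> br 0\<^sub>M x = 0\<^sub>M"
  using br_smult_left[of \<zero> "0\<^sub>M" x] by simp

lemma smult_commute: "\<lbrakk>a \<in> carrier R; b \<in> carrier R; x \<in> carrier M\<rbrakk> \<Longrightarrow>
    a *\<^sub>M (b *\<^sub>M x) = b *\<^sub>M (a *\<^sub>M x)"
  using smult_assoc1 R.m_comm by metis

text \<open>Nested so that multiplication by \<open>s\<close> becomes an index shift. Since
  \<open>s\<close> is a fixed scalar, coefficients cannot be read off from the value; the lemmas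
  below always pass from given coefficients to given coefficients.\<close>

definition horner :: "'a \<Rightarrow> 'b \<Rightarrow> 'b \<Rightarrow> 'b \<Rightarrow> 'b \<Rightarrow> 'b" where
  "horner s v0 v1 v2 v3 = v0 +\<^sub>M s *\<^sub>M (v1 +\<^sub>M s *\<^sub>M (v2 +\<^sub>M s *\<^sub>M v3))"

context
  fixes s :: 'a
  assumes s: "s \<in> carrier R"
begin

lemma horner_closed [simp]:
  "\<lbrakk>v0 \<in> carrier M; v1 \<in> carrier M; v2 \<in> carrier M; v3 \<in> carrier M\<rbrakk> \<Longrightarrow> horner s v0 v1 v2 v3 \<in> carrier M"
  using s by (simp add: horner_def)

lemma horner_add:
  assumes "v0 \<in> carrier M" "v1 \<in> carrier M" "v2 \<in> carrier M" "v3 \<in> carrier M"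
    and "w0 \<in> carrier M" "w1 \<in> carrier M" "w2 \<in> carrier M" "w3 \<in> carrier M"
  shows "horner s v0 v1 v2 v3 +\<^sub>M horner s w0 w1 w2 w3 =
    horner s (v0 +\<^sub>M w0) (v1 +\<^sub>M w1) (v2 +\<^sub>M w2) (v3 +\<^sub>M w3)"
  using assms s by (simp add: horner_def smult_r_distr M.a_ac)

lemma horner_smult:
  assumes "a \<in> carrier R" "v0 \<in> carrier M" "v1 \<in> carrier M" "v2 \<in> carrier M" "v3 \<in> carrier M"
  shows "a *\<^sub>M horner s v0 v1 v2 v3 =
    horner s (a *\<^sub>M v0) (a *\<^sub>M v1) (a *\<^sub>M v2) (a *\<^sub>M v3)"
  using assms s by (simp add: horner_def smult_r_distr smult_commute[of a s])

lemma br_horner: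
  assumes "x \<in> carrier M" "v0 \<in> carrier M" "v1 \<in> carrier M" "v2 \<in> carrier M" "v3 \<in> carrier M"
  shows "br x (horner s v0 v1 v2 v3) = horner s (br x v0) (br x v1) (br x v2) (br x v3)"
  using assms s by (simp add: horner_def br_add_right br_smult_right)

context
  assumes s4: "s \<otimes> (s \<otimes> (s \<otimes> s)) = \<zero>"
begin

text \<open>The coefficient \<open>v3\<close> would move to degree four, where \<open>s4\<close>
  kills it.\<close>

lemma horner_shift:
  assumes "v0 \<in> carrier M" "v1 \<in> carrier M" "v2 \<in> carrier M" "v3 \<in> carrier M"
  shows "s *\<^sub>M horner s v0 v1 v2 v3 = horner s 0\<^sub>M v0 v1 v2"
proof -
  have "s *\<^sub>M (s *\<^sub>M (s *\<^sub>M (s *\<^sub>M v3))) = 0\<^sub>M"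
    using assms(4) s s4 by (simp add: smult_assoc1[symmetric] R.m_assoc)
  then show ?thesis using assms s by (simp add: horner_def smult_r_distr)
qed

text \<open>The Cauchy product, cut off after degree three by \<open>s4\<close>.\<close>

lemma horner_br_horner:
  assumes "u0 \<in> carrier M" "u1 \<in> carrier M" "u2 \<in> carrier M" "u3 \<in> carrier M"
    and "v0 \<in> carrier M" "v1 \<in> carrier M" "v2 \<in> carrier M" "v3 \<in> carrier M"
  shows "br (horner s u0 u1 u2 u3) (horner s v0 v1 v2 v3) =
    horner s (br u0 v0) (br u0 v1 +\<^sub>M br u1 v0) (br u0 v2 +\<^sub>M (br u1 v1 +\<^sub>M br u2 v0))
      (br u0 v3 +\<^sub>M (br u1 v2 +\<^sub>M (br u2 v1 +\<^sub>M br u3 v0)))"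
proof -
  let ?v = "horner s v0 v1 v2 v3"
  have "br (horner s u0 u1 u2 u3) ?v =
      br u0 ?v +\<^sub>M s *\<^sub>M (br u1 ?v +\<^sub>M s *\<^sub>M (br u2 ?v +\<^sub>M s *\<^sub>M br u3 ?v))"
    \<comment> \<open>Only the left factor is unfolded. The right one stays a polynomial, so that
      each remaining \<open>s\<close> acts by shifting its coefficients.\<close>
    using assms s by (simp add: horner_def[of s u0] br_add_left br_smult_left)
  also have "\<dots> = horner s (br u0 v0) (br u0 v1 +\<^sub>M br u1 v0) (br u0 v2 +\<^sub>M (br u1 v1 +\<^sub>M br u2 v0))
      (br u0 v3 +\<^sub>M (br u1 v2 +\<^sub>M (br u2 v1 +\<^sub>M br u3 v0)))"
    using assms by (simp add: br_horner horner_shift horner_add)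
  finally show ?thesis .
qed

end

end

end

text \<open>The rationals enter through a ring homomorphism \<open>q\<close>, so identities between
  rational coefficients are computed in \<open>rat\<close> and transported.\<close>

locale rational_lie_algebra = lie_algebra R M br
  for R :: "('a, 'c) ring_scheme" (structure) and M :: "('a, 'b, 'd) module_scheme" (structure) and br +
  fixes q :: "rat \<Rightarrow> 'a"
  assumes q_closed [simp, intro]: "q a \<in> carrier R"
    and q_add: "q (a + b) = q a \<oplus> q b"
    and q_mult: "q (a * b) = q a \<otimes> q b"
    and q_one [simp]: "q 1 = \<one>"
begin

section \<open>Rational scalars and divided powers\<close>

lemma q_zero [simp]: "q 0 = \<zero>"
  using q_add[of 0 0] by (metis R.add_left_cancel R.r_zero R.zero_closed add_0 q_closed)

lemma q_minus: "q (- a) = \<ominus> q a"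
  using q_add[of "- a" a] R.minus_equality by (metis R.l_neg ab_left_minus q_closed q_zero R.sum_zero_eq_neg)

lemma q_half: "q (1/2) \<oplus> q (1/2) = \<one>"
  by (simp flip: q_add q_one)

text \<open>Fractions are split into equal copies of a smaller one. Over a common unit fraction,
  distributivity and AC rewriting can compare the two sides of a binomial identity.\<close>

lemma q_sixth: "q (1/2) = q (1/6) \<oplus> q (1/6) \<oplus> q (1/6)" "\<one> = q (1/6) \<oplus> q (1/6) \<oplus> q (1/6) \<oplus> q (1/6) \<oplus> q (1/6) \<oplus> q (1/6)"
  by (simp_all flip: q_add q_one)

lemma q_24: "q (1/6) = q (1/24) \<oplus> q (1/24) \<oplus> q (1/24) \<oplus> q (1/24)"
  "q (1/2) \<otimes> q (1/2) = q (1/24) \<oplus> q (1/24) \<oplus> q (1/24) \<oplus> q (1/24) \<oplus> q (1/24) \<oplus> q (1/24)"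
  by (simp_all flip: q_add q_mult)

lemma q_numeral: "q 2 = \<one> \<oplus> \<one>" "q 3 = \<one> \<oplus> \<one> \<oplus> \<one>" "q 4 = \<one> \<oplus> \<one> \<oplus> \<one> \<oplus> \<one>"
  by (simp_all flip: q_add q_one)

text \<open>When \<open>s\<^sup>4 = 0\<close>, \<open>exp_ad s z r w\<close> is \<open>exp (r s ad z) w\<close>, and \<open>int_exp_ad s z w t\<close> is its integral over
  \<open>0 \<le> r \<le> t\<close>.\<close>

definition exp_ad :: "'a \<Rightarrow> 'b \<Rightarrow> 'a \<Rightarrow> 'b \<Rightarrow> 'b" where
  "exp_ad s z r w = horner s w (r *\<^sub>M br z w) ((q (1/2) \<otimes> (r \<otimes> r)) *\<^sub>M br z (br z w))
    ((q (1/6) \<otimes> (r \<otimes> (r \<otimes> r))) *\<^sub>M br z (br z (br z w)))"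

definition int_exp_ad :: "'a \<Rightarrow> 'b \<Rightarrow> 'b \<Rightarrow> 'a \<Rightarrow> 'b" where
  "int_exp_ad s z w t = horner s (t *\<^sub>M w) ((q (1/2) \<otimes> (t \<otimes> t)) *\<^sub>M br z w)
    ((q (1/6) \<otimes> (t \<otimes> (t \<otimes> t))) *\<^sub>M br z (br z w))
    ((q (1/24) \<otimes> (t \<otimes> (t \<otimes> (t \<otimes> t)))) *\<^sub>M br z (br z (br z w)))"

text \<open>The binomial theorem for divided powers \<open>t^n / n!\<close>, in degrees 2 to 4. The
  summands are ordered as they arise in \<open>int_exp_ad_add\<close>: the pure power of
  \<open>t\<close>, the pure power of \<open>t'\<close>, then the mixed terms.\<close>

lemma int_exp_ad_coefficients:
  assumes t: "t \<in> carrier R" and t': "t' \<in> carrier R"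
  shows "q (1/2) \<otimes> ((t \<oplus> t') \<otimes> (t \<oplus> t')) =
      q (1/2) \<otimes> (t \<otimes> t) \<oplus> (q (1/2) \<otimes> (t' \<otimes> t') \<oplus> t \<otimes> t')"
    and "q (1/6) \<otimes> ((t \<oplus> t') \<otimes> ((t \<oplus> t') \<otimes> (t \<oplus> t'))) =
      q (1/6) \<otimes> (t \<otimes> (t \<otimes> t)) \<oplus> (q (1/6) \<otimes> (t' \<otimes> (t' \<otimes> t')) \<oplus>
        (t \<otimes> (q (1/2) \<otimes> (t' \<otimes> t')) \<oplus> q (1/2) \<otimes> (t \<otimes> t) \<otimes> t'))"
    and "q (1/24) \<otimes> ((t \<oplus> t') \<otimes> ((t \<oplus> t') \<otimes> ((t \<oplus> t') \<otimes> (t \<oplus> t')))) =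
      q (1/24) \<otimes> (t \<otimes> (t \<otimes> (t \<otimes> t))) \<oplus> (q (1/24) \<otimes> (t' \<otimes> (t' \<otimes> (t' \<otimes> t'))) \<oplus>
        (t \<otimes> (q (1/6) \<otimes> (t' \<otimes> (t' \<otimes> t'))) \<oplus> (q (1/2) \<otimes> (t \<otimes> t) \<otimes> (q (1/2) \<otimes> (t' \<otimes> t')) \<oplus>
          q (1/6) \<otimes> (t \<otimes> (t \<otimes> t)) \<otimes> t')))"
proof -
  \<comment> \<open>The mixed term carries no fraction on the right, but arises on the left as two
    halves.\<close>
  have 1: "t \<otimes> t' = (q (1/2) \<oplus> q (1/2)) \<otimes> (t \<otimes> t')" using t t' by (simp add: q_half)
  show "q (1/2) \<otimes> ((t \<oplus> t') \<otimes> (t \<oplus> t')) =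
      q (1/2) \<otimes> (t \<otimes> t) \<oplus> (q (1/2) \<otimes> (t' \<otimes> t') \<oplus> t \<otimes> t')"
    by (subst 1) (use t t' in \<open>simp add: R.l_distr R.r_distr R.a_ac R.m_ac\<close>)
  show "q (1/6) \<otimes> ((t \<oplus> t') \<otimes> ((t \<oplus> t') \<otimes> (t \<oplus> t'))) =
      q (1/6) \<otimes> (t \<otimes> (t \<otimes> t)) \<oplus> (q (1/6) \<otimes> (t' \<otimes> (t' \<otimes> t')) \<oplus>
        (t \<otimes> (q (1/2) \<otimes> (t' \<otimes> t')) \<oplus> q (1/2) \<otimes> (t \<otimes> t) \<otimes> t'))"
    unfolding q_sixth(1) using t t' by (simp add: R.l_distr R.r_distr R.a_ac R.m_ac)
  have 3: "q (1/2) \<otimes> (t \<otimes> t) \<otimes> (q (1/2) \<otimes> (t' \<otimes> t')) = (q (1/2) \<otimes> q (1/2)) \<otimes> (t \<otimes> t \<otimes> (t' \<otimes> t'))"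
    using t t' by (simp add: R.m_ac)
  show "q (1/24) \<otimes> ((t \<oplus> t') \<otimes> ((t \<oplus> t') \<otimes> ((t \<oplus> t') \<otimes> (t \<oplus> t')))) =
      q (1/24) \<otimes> (t \<otimes> (t \<otimes> (t \<otimes> t))) \<oplus> (q (1/24) \<otimes> (t' \<otimes> (t' \<otimes> (t' \<otimes> t'))) \<oplus>
        (t \<otimes> (q (1/6) \<otimes> (t' \<otimes> (t' \<otimes> t'))) \<oplus> (q (1/2) \<otimes> (t \<otimes> t) \<otimes> (q (1/2) \<otimes> (t' \<otimes> t')) \<oplus>
          q (1/6) \<otimes> (t \<otimes> (t \<otimes> t)) \<otimes> t')))"
    unfolding 3 q_24 using t t' by (simp add: R.l_distr R.r_distr R.a_ac R.m_ac)
qed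

context
  fixes s :: 'a
  assumes s: "s \<in> carrier R"
begin

lemma exp_ad_closed [simp]:
  "\<lbrakk>z \<in> carrier M; r \<in> carrier R; w \<in> carrier M\<rbrakk> \<Longrightarrow> exp_ad s z r w \<in> carrier M"
  using s by (simp add: exp_ad_def)

lemma int_exp_ad_closed [simp]:
  "\<lbrakk>z \<in> carrier M; t \<in> carrier R; w \<in> carrier M\<rbrakk> \<Longrightarrow> int_exp_ad s z w t \<in> carrier M"
  using s by (simp add: int_exp_ad_def)

text \<open>Splitting the integral of \<open>exp (r s ad z) w\<close> at \<open>r = t\<close>: the
  part from \<open>t\<close> to \<open>t + t'\<close> is \<open>exp (t s ad z)\<close> applied to
  the integral from 0 to \<open>t'\<close>. Formally this is the addition rule for divided powers,
  coefficient by coefficient.\<close>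

lemma int_exp_ad_add:
  assumes s4: "s \<otimes> (s \<otimes> (s \<otimes> s)) = \<zero>"
    and z: "z \<in> carrier M" and w: "w \<in> carrier M" and t: "t \<in> carrier R" and t': "t' \<in> carrier R"
  shows "int_exp_ad s z w (t \<oplus> t') = int_exp_ad s z w t +\<^sub>M exp_ad s z t (int_exp_ad s z w t')"
proof -
  define w1 w2 w3 where ws: "w1 = br z w" "w2 = br z w1" "w3 = br z w2"
  have wc: "w1 \<in> carrier M" "w2 \<in> carrier M" "w3 \<in> carrier M"
    using z w by (simp_all add: ws)
  define u1 u2 u3 where us: "u1 = (\<lambda>t. q (1/2) \<otimes> (t \<otimes> t))" "u2 = (\<lambda>t. q (1/6) \<otimes> (t \<otimes> (t \<otimes> t)))"
    "u3 = (\<lambda>t. q (1/24) \<otimes> (t \<otimes> (t \<otimes> (t \<otimes> t))))"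
  have uc: "u1 t \<in> carrier R" "u2 t \<in> carrier R" "u3 t \<in> carrier R"
    "u1 t' \<in> carrier R" "u2 t' \<in> carrier R" "u3 t' \<in> carrier R"
    using t t' by (simp_all add: us)
  have int: "int_exp_ad s z w r = horner s (r *\<^sub>M w) (u1 r *\<^sub>M w1) (u2 r *\<^sub>M w2) (u3 r *\<^sub>M w3)" for r
    by (simp add: int_exp_ad_def ws us)
  let ?U = "horner s (t' *\<^sub>M w) (u1 t' *\<^sub>M w1) (u2 t' *\<^sub>M w2) (u3 t' *\<^sub>M w3)"
  have b: "br z ?U = horner s (t' *\<^sub>M w1) (u1 t' *\<^sub>M w2) (u2 t' *\<^sub>M w3) (u3 t' *\<^sub>M br z w3)"
    "br z (br z ?U) = horner s (t' *\<^sub>M w2) (u1 t' *\<^sub>M w3) (u2 t' *\<^sub>M br z w3) (u3 t' *\<^sub>M br z (br z w3))"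
    "br z (br z (br z ?U)) = horner s (t' *\<^sub>M w3) (u1 t' *\<^sub>M br z w3) (u2 t' *\<^sub>M br z (br z w3))
      (u3 t' *\<^sub>M br z (br z (br z w3)))"
    using z w wc uc s t' by (simp_all add: br_horner br_smult_right ws(1)[symmetric] ws(2)[symmetric] ws(3)[symmetric])
  \<comment> \<open>Unfolded for a variable \<open>U\<close>, so that the polynomial
    \<open>?U\<close> put in its place keeps its \<open>horner\<close> form.\<close>
  have "exp_ad s z t U = U +\<^sub>M s *\<^sub>M (t *\<^sub>M br z U +\<^sub>M
      s *\<^sub>M (u1 t *\<^sub>M br z (br z U) +\<^sub>M s *\<^sub>M (u2 t *\<^sub>M br z (br z (br z U)))))" for U
    by (simp only: exp_ad_def us horner_def)
  then have "exp_ad s z t ?U = ?U +\<^sub>M s *\<^sub>M (t *\<^sub>M br z ?U +\<^sub>M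
      s *\<^sub>M (u1 t *\<^sub>M br z (br z ?U) +\<^sub>M s *\<^sub>M (u2 t *\<^sub>M br z (br z (br z ?U)))))" .
  also have "\<dots> = horner s (t' *\<^sub>M w) (u1 t' *\<^sub>M w1 +\<^sub>M (t \<otimes> t') *\<^sub>M w1)
      (u2 t' *\<^sub>M w2 +\<^sub>M ((t \<otimes> u1 t') *\<^sub>M w2 +\<^sub>M (u1 t \<otimes> t') *\<^sub>M w2))
      (u3 t' *\<^sub>M w3 +\<^sub>M ((t \<otimes> u2 t') *\<^sub>M w3 +\<^sub>M
        ((u1 t \<otimes> u1 t') *\<^sub>M w3 +\<^sub>M (u2 t \<otimes> t') *\<^sub>M w3)))"
    \<comment> \<open>The longest bracket goes first; rewriting \<open>br z ?U\<close> earlier would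
      destroy the other two patterns.\<close>
    unfolding b(3) unfolding b(2) unfolding b(1) using z w wc uc s t t' 
    by (simp add: horner_smult[of s t] horner_smult[of s "u1 t"] horner_smult[of s "u2 t"]
        horner_shift[OF s s4] horner_add smult_assoc1)
  finally have "exp_ad s z t ?U = \<dots>" .
  moreover have "u1 (t \<oplus> t') = u1 t \<oplus> (u1 t' \<oplus> t \<otimes> t')"
    "u2 (t \<oplus> t') = u2 t \<oplus> (u2 t' \<oplus> (t \<otimes> u1 t' \<oplus> u1 t \<otimes> t'))"
    "u3 (t \<oplus> t') = u3 t \<oplus> (u3 t' \<oplus> (t \<otimes> u2 t' \<oplus> (u1 t \<otimes> u1 t' \<oplus> u2 t \<otimes> t')))"
    unfolding us by (rule int_exp_ad_coefficients[OF t t'])+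
  ultimately show ?thesis
    unfolding int using z w wc uc s t t' by (simp add: horner_add smult_l_distr)
qed

text \<open>All coefficients after the first contain a square of \<open>d\<close>. This fixes the
  velocity of the curve built from \<open>int_exp_ad\<close>.\<close>

lemma int_exp_ad_square_zero:
  assumes "z \<in> carrier M" "w \<in> carrier M" "d \<in> carrier R" "d \<otimes> d = \<zero>"
  shows "int_exp_ad s z w d = d *\<^sub>M w"
  using assms s by (simp add: int_exp_ad_def horner_def)

end

text \<open>With all three squares zero, the divided powers of the sum are the elementary symmetric
  functions of its terms, and there is none in degree four.\<close>

lemma three_nilsquares:
  assumes e: "a \<in> carrier R" "b \<in> carrier R" "c \<in> carrier R"
    and z: "a \<otimes> a = \<zero>" "b \<otimes> b = \<zero>" "c \<otimes> c = \<zero>"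
  defines "s \<equiv> a \<oplus> b \<oplus> c"
  shows "s \<otimes> (s \<otimes> (s \<otimes> s)) = \<zero>"
    and "q (1/2) \<otimes> (s \<otimes> s) = b \<otimes> c \<oplus> (a \<otimes> c \<oplus> a \<otimes> b)"
    and "q (1/6) \<otimes> (s \<otimes> (s \<otimes> s)) = a \<otimes> (b \<otimes> c)"
proof -
  have n: "a \<otimes> (a \<otimes> x) = \<zero>" "b \<otimes> (b \<otimes> x) = \<zero>" "c \<otimes> (c \<otimes> x) = \<zero>" if "x \<in> carrier R" for x
    using that e z by (simp_all add: R.m_assoc[symmetric])
  note dist = R.l_distr R.r_distr R.a_ac R.m_ac
  have s2: "s \<otimes> s = (b \<otimes> c \<oplus> (a \<otimes> c \<oplus> a \<otimes> b)) \<oplus> (b \<otimes> c \<oplus> (a \<otimes> c \<oplus> a \<otimes> b))"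
    unfolding s_def using e z by (simp add: dist)
  have s3: "s \<otimes> (s \<otimes> s) = a \<otimes> (b \<otimes> c) \<oplus> a \<otimes> (b \<otimes> c) \<oplus> a \<otimes> (b \<otimes> c) \<oplus> a \<otimes> (b \<otimes> c) \<oplus> a \<otimes> (b \<otimes> c) \<oplus> a \<otimes> (b \<otimes> c)"
    unfolding s2 unfolding s_def using e z by (simp add: dist n)
  show "s \<otimes> (s \<otimes> (s \<otimes> s)) = \<zero>"
    unfolding s3 unfolding s_def using e z by (simp add: dist n)
  have "q (1/2) \<otimes> (x \<oplus> x) = x" if "x \<in> carrier R" for x
    using that q_half by (metis R.l_distr R.l_one R.r_distr q_closed)
  then show "q (1/2) \<otimes> (s \<otimes> s) = b \<otimes> c \<oplus> (a \<otimes> c \<oplus> a \<otimes> b)"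
    unfolding s2 using e by simp
  have "q (1/6) \<otimes> (x \<oplus> x \<oplus> x \<oplus> x \<oplus> x \<oplus> x) = x" if "x \<in> carrier R" for x
  proof -
    have "q (1/6) \<otimes> (x \<oplus> x \<oplus> x \<oplus> x \<oplus> x \<oplus> x) = (q (1/6) \<oplus> q (1/6) \<oplus> q (1/6) \<oplus> q (1/6) \<oplus> q (1/6) \<oplus> q (1/6)) \<otimes> x"
      using that by (simp add: R.l_distr R.r_distr)
    then show ?thesis using that by (simp flip: q_sixth(2))
  qed
  then show "q (1/6) \<otimes> (s \<otimes> (s \<otimes> s)) = a \<otimes> (b \<otimes> c)"
    unfolding s3 using e by simp
qed

text \<open>Each \<open>step e\<close> is the exact exponential of \<open>r e ad z\<close>, because
  \<open>e\<close> squares to zero. Composing three of them produces the elementary symmetric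
  functions of \<open>a\<close>, \<open>b\<close>, \<open>c\<close>, that is, the divided powers of
  their sum.\<close>

lemma exp_ad_three:
  assumes e: "a \<in> carrier R" "b \<in> carrier R" "c \<in> carrier R"
    and nz: "a \<otimes> a = \<zero>" "b \<otimes> b = \<zero>" "c \<otimes> c = \<zero>"
    and z: "z \<in> carrier M" and w: "w \<in> carrier M" and r: "r \<in> carrier R"
  defines "step \<equiv> \<lambda>e w. w +\<^sub>M (r \<otimes> e) *\<^sub>M br z w"
  shows "step a (step b (step c w)) = exp_ad (a \<oplus> b \<oplus> c) z r w"
proof -
  define w1 w2 w3 where ws: "w1 = br z w" "w2 = br z w1" "w3 = br z w2"
  have wc: "w1 \<in> carrier M" "w2 \<in> carrier M" "w3 \<in> carrier M"
    using z w by (simp_all add: ws)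
  let ?s = "a \<oplus> b \<oplus> c"
  have sc: "?s \<in> carrier R" using e by simp
  note n = three_nilsquares[OF e nz]
  have "step a (step b (step c w)) = w +\<^sub>M ((r \<otimes> a \<oplus> (r \<otimes> b \<oplus> r \<otimes> c)) *\<^sub>M w1 +\<^sub>M
      ((r \<otimes> r \<otimes> (b \<otimes> c \<oplus> (a \<otimes> c \<oplus> a \<otimes> b))) *\<^sub>M w2 +\<^sub>M (r \<otimes> (r \<otimes> r) \<otimes> (a \<otimes> (b \<otimes> c))) *\<^sub>M w3))"
    using e z w r wc
    by (simp add: step_def br_add_right br_smult_right ws(1)[symmetric] ws(2)[symmetric] ws(3)[symmetric]
        smult_r_distr smult_l_distr smult_assoc1[symmetric] R.r_distr M.a_ac R.m_ac)
  also have "r \<otimes> a \<oplus> (r \<otimes> b \<oplus> r \<otimes> c) = ?s \<otimes> r"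
    using e r by (simp add: R.l_distr R.r_distr R.m_ac R.a_ac)
  also have "r \<otimes> r \<otimes> (b \<otimes> c \<oplus> (a \<otimes> c \<oplus> a \<otimes> b)) = ?s \<otimes> (?s \<otimes> (q (1/2) \<otimes> (r \<otimes> r)))"
    unfolding n(2)[symmetric] using sc r by (simp add: R.m_ac)
  also have "r \<otimes> (r \<otimes> r) \<otimes> (a \<otimes> (b \<otimes> c)) = ?s \<otimes> (?s \<otimes> (?s \<otimes> (q (1/6) \<otimes> (r \<otimes> (r \<otimes> r)))))"
    unfolding n(3)[symmetric] using sc r by (simp add: R.m_ac)
  finally show ?thesis
    using sc r w wc
    by (simp add: exp_ad_def ws(1)[symmetric] ws(2)[symmetric] ws(3)[symmetric] horner_def smult_r_distr smult_assoc1)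
qed

text \<open>Both polynomials have the constant coefficient \<open>z0\<close>, since the second is
  meant to be the derivative of \<open>s z(s)\<close>. So their bracket starts in degree one, and
  together with the powers of \<open>s\<close> in \<open>int_exp_ad\<close> only the first two
  iterated brackets contribute below degree four.\<close>

lemma int_exp_ad_horner:
  assumes s: "s \<in> carrier R" and s4: "s \<otimes> (s \<otimes> (s \<otimes> s)) = \<zero>"
    and z: "z0 \<in> carrier M" "z1 \<in> carrier M" "z2 \<in> carrier M" "z3 \<in> carrier M"
    and w: "w1 \<in> carrier M" "w2 \<in> carrier M" "w3 \<in> carrier M"
  defines "b \<equiv> br z0 w1 +\<^sub>M br z1 z0"
  shows "int_exp_ad s (horner s z0 z1 z2 z3) (horner s z0 w1 w2 w3) \<one> =
    horner s z0 w1 (w2 +\<^sub>M q (1/2) *\<^sub>M b)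
      (w3 +\<^sub>M (q (1/2) *\<^sub>M (br z0 w2 +\<^sub>M (br z1 w1 +\<^sub>M br z2 z0)) +\<^sub>M q (1/6) *\<^sub>M br z0 b))"
proof -
  let ?z = "horner s z0 z1 z2 z3" and ?w = "horner s z0 w1 w2 w3"
  let ?c = "br z0 w2 +\<^sub>M (br z1 w1 +\<^sub>M br z2 z0)"
  have b: "b \<in> carrier M" using z w by (simp add: b_def)
  have c: "?c \<in> carrier M" using z w by simp
  \<comment> \<open>The coefficients \<open>d\<close> here and \<open>e\<close> to \<open>i\<close>
    below end up in degree four or higher; only their membership in the carrier matters.\<close>
  define d where "d = br z0 w3 +\<^sub>M (br z1 w2 +\<^sub>M (br z2 w1 +\<^sub>M br z3 z0))"
  then have d: "d \<in> carrier M" and 1: "br ?z ?w = horner s 0\<^sub>M b ?c d"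
    using z w by (simp_all add: horner_br_horner[OF s s4] br_self b_def)
  have step: "\<exists>e \<in> carrier M. \<exists>f \<in> carrier M. br ?z (horner s 0\<^sub>M v1 v2 v3) = horner s 0\<^sub>M (br z0 v1) e f"
    if v: "v1 \<in> carrier M" "v2 \<in> carrier M" "v3 \<in> carrier M" for v1 v2 v3
  proof (intro bexI)
    show "br ?z (horner s 0\<^sub>M v1 v2 v3) = horner s 0\<^sub>M (br z0 v1) (br z0 v2 +\<^sub>M br z1 v1)
        (br z0 v3 +\<^sub>M (br z1 v2 +\<^sub>M br z2 v1))"
      using z v by (simp add: horner_br_horner[OF s s4])
  qed (use z v in simp_all)
  obtain e f where ef: "e \<in> carrier M" "f \<in> carrier M" and 2: "br ?z (br ?z ?w) = horner s 0\<^sub>M (br z0 b) e f"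
    unfolding 1 using step[OF b c d] by blast
  obtain g h i where ghi: "g \<in> carrier M" "h \<in> carrier M" "i \<in> carrier M"
    and 3: "br ?z (br ?z (br ?z ?w)) = horner s 0\<^sub>M g h i"
    unfolding 2 using step[OF br_closed[OF z(1) b] ef] br_closed[OF z(1) br_closed[OF z(1) b]] by blast
  have "int_exp_ad s Z W \<one> = W +\<^sub>M s *\<^sub>M (q (1/2) *\<^sub>M br Z W +\<^sub>M
      s *\<^sub>M (q (1/6) *\<^sub>M br Z (br Z W) +\<^sub>M s *\<^sub>M (q (1/24) *\<^sub>M br Z (br Z (br Z W)))))"
    if "W \<in> carrier M" for Z W
    using that by (simp add: int_exp_ad_def horner_def)
  then have "int_exp_ad s ?z ?w \<one> = ?w +\<^sub>M s *\<^sub>M (q (1/2) *\<^sub>M horner s 0\<^sub>M b ?c d +\<^sub>M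
      s *\<^sub>M (q (1/6) *\<^sub>M horner s 0\<^sub>M (br z0 b) e f +\<^sub>M s *\<^sub>M (q (1/24) *\<^sub>M horner s 0\<^sub>M g h i)))"
    using z w s unfolding 3[symmetric] unfolding 2[symmetric] unfolding 1[symmetric] by simp
  then show ?thesis
    using z w b d ef ghi s
    by (simp add: horner_smult[OF s q_closed] horner_shift[OF s s4] horner_add[OF s])
qed

section \<open>The Baker-Campbell-Hausdorff coefficients up to degree four\<close>

lemma exp_ad_one:
  assumes "s \<in> carrier R" "x \<in> carrier M" "y \<in> carrier M"
  shows "x +\<^sub>M exp_ad s x \<one> y = horner s (x +\<^sub>M y) (br x y) (q (1/2) *\<^sub>M br x (br x y))
    (q (1/6) *\<^sub>M br x (br x (br x y)))"
  using assms by (simp add: exp_ad_def horner_def M.a_assoc)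

text \<open>Homogeneous parts of the Baker-Campbell-Hausdorff series, numbered by their degree in
  \<open>x\<close> and \<open>y\<close>. With one factor \<open>s\<close> taken out of the exponent,
  the part of degree \<open>n\<close> becomes the coefficient of \<open>s^(n - 1)\<close>.\<close>

definition bch\<^sub>2 :: "'b \<Rightarrow> 'b \<Rightarrow> 'b" where
  "bch\<^sub>2 x y = q (1/2) *\<^sub>M br x y"

definition bch\<^sub>3 :: "'b \<Rightarrow> 'b \<Rightarrow> 'b" where
  "bch\<^sub>3 x y = q (1/12) *\<^sub>M br (br x y) (y \<ominus>\<^bsub>M\<^esub> x)"

text \<open>The two summands add up to \<open>-4 [y, [x, [x, y]]]\<close>, so the factor 1/96 yields
  the classical coefficient -1/24.\<close>

definition bch\<^sub>4 :: "'b \<Rightarrow> 'b \<Rightarrow> 'b" where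
  "bch\<^sub>4 x y = q (1/96) *\<^sub>M (br (x +\<^sub>M y) (br (br x y) (x +\<^sub>M y)) +\<^sub>M
    br (br (br x y) (x \<ominus>\<^bsub>M\<^esub> y)) (x \<ominus>\<^bsub>M\<^esub> y))"

text \<open>Once every term is a rational combination of the same few brackets, an identity in the
  Lie algebra becomes arithmetic in \<open>rat\<close>.\<close>

definition lin2 :: "'b \<Rightarrow> 'b \<Rightarrow> rat \<Rightarrow> rat \<Rightarrow> 'b" where
  "lin2 u v a b = q a *\<^sub>M u +\<^sub>M q b *\<^sub>M v"

definition lin3 :: "'b \<Rightarrow> 'b \<Rightarrow> 'b \<Rightarrow> rat \<Rightarrow> rat \<Rightarrow> rat \<Rightarrow> 'b" where
  "lin3 u v w a b c = q a *\<^sub>M u +\<^sub>M (q b *\<^sub>M v +\<^sub>M q c *\<^sub>M w)"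

lemma lin2_simps:
  assumes "u \<in> carrier M" "v \<in> carrier M"
  shows "lin2 u v a b \<in> carrier M"
    and "lin2 u v a b +\<^sub>M lin2 u v a' b' = lin2 u v (a + a') (b + b')"
    and "q e *\<^sub>M lin2 u v a b = lin2 u v (e * a) (e * b)"
    and "-\<^sub>M lin2 u v a b = lin2 u v (- a) (- b)"
  using assms
  by (simp_all add: lin2_def q_add q_mult q_minus smult_r_distr smult_l_distr smult_assoc1 smult_l_minus
      M.minus_add M.a_ac)

lemma lin3_simps:
  assumes "u \<in> carrier M" "v \<in> carrier M" "w \<in> carrier M"
  shows "lin3 u v w a b c \<in> carrier M"
    and "lin3 u v w a b c +\<^sub>M lin3 u v w a' b' c' = lin3 u v w (a + a') (b + b') (c + c')"
    and "q e *\<^sub>M lin3 u v w a b c = lin3 u v w (e * a) (e * b) (e * c)"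
    and "-\<^sub>M lin3 u v w a b c = lin3 u v w (- a) (- b) (- c)"
  using assms
  by (simp_all add: lin3_def q_add q_mult q_minus smult_r_distr smult_l_distr smult_assoc1 smult_l_minus
      M.minus_add M.a_ac)

text \<open>Matching the velocities of the two sides degree by degree is the recursion behind the
  constants 1/2, 1/12 and -1/24. The factors 2, 3, 4 come from differentiating
  \<open>s z(s)\<close>. Brackets of degree three are expressed by \<open>u\<close>,
  \<open>v\<close>, those of degree four by \<open>k\<close>, \<open>l\<close>,
  \<open>m\<close>.\<close>

lemma bch_coefficients:
  assumes x: "x \<in> carrier M" and y: "y \<in> carrier M"
  shows bch\<^sub>2_closed: "bch\<^sub>2 x y \<in> carrier M" and bch\<^sub>3_closed: "bch\<^sub>3 x y \<in> carrier M" and bch\<^sub>4_closed: "bch\<^sub>4 x y \<in> carrier M"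
    and bch_velocity: "s \<in> carrier R \<Longrightarrow> s \<otimes> (s \<otimes> (s \<otimes> s)) = \<zero> \<Longrightarrow>
      int_exp_ad s (horner s (x +\<^sub>M y) (bch\<^sub>2 x y) (bch\<^sub>3 x y) (bch\<^sub>4 x y))
        (horner s (x +\<^sub>M y) (q 2 *\<^sub>M bch\<^sub>2 x y) (q 3 *\<^sub>M bch\<^sub>3 x y) (q 4 *\<^sub>M bch\<^sub>4 x y)) \<one> =
      x +\<^sub>M exp_ad s x \<one> y"
proof -
  define B where "B = br x y"
  define u v where uv: "u = br x B" "v = br y B"
  define k l m where klm: "k = br x u" "l = br y u" "m = br y v"
  have c: "B \<in> carrier M" "u \<in> carrier M" "v \<in> carrier M" "k \<in> carrier M" "l \<in> carrier M" "m \<in> carrier M"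
    using x y by (simp_all add: B_def uv klm)
  \<comment> \<open>Jacobi gives \<open>[x, [y, B]] = [[x, y], B] + [y, [x, B]]\<close> with
    \<open>[B, B] = 0\<close>, so three brackets suffice in degree four.\<close>
  have xv: "br x v = l"
    using jacobi[of y B x] x y c by (simp add: uv klm B_def br_self)
  let ?L2 = "lin2 u v" and ?L3 = "lin3 k l m"
  note L2 = lin2_simps[OF c(2,3)] and L3 = lin3_simps[OF c(4-6)]
  have xL: "br x (?L2 a b) = ?L3 a b 0" and yL: "br y (?L2 a b) = ?L3 0 a b" for a b
    using x y c xv by (simp_all add: lin2_def lin3_def br_add_right br_smult_right klm)
  have B: "br x B = ?L2 1 0" "br y B = ?L2 0 1" "br B x = ?L2 (-1) 0" "br B y = ?L2 0 (-1)"
    using x y c br_skew[of x B] br_skew[of y B] by (simp_all add: lin2_def q_minus smult_l_minus flip: uv)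
  have Lx: "br (?L2 a b) x = ?L3 (-a) (-b) 0" and Ly: "br (?L2 a b) y = ?L3 0 (-a) (-b)" for a b
    using br_skew[of x "?L2 a b"] br_skew[of y "?L2 a b"] x y L2(1) by (simp_all add: xL yL L3)
  note expand = br_add_right br_add_left br_smult_right br_smult_left br_minus_right br_minus_left
    a_minus_def xL yL Lx Ly B L2 L3
  have b2: "bch\<^sub>2 x y = q (1/2) *\<^sub>M B" by (simp add: bch\<^sub>2_def B_def)
  have b3: "bch\<^sub>3 x y = ?L2 (1/12) (-1/12)"
    using x y c by (simp add: bch\<^sub>3_def flip: B_def) (simp add: expand)
  have b4: "bch\<^sub>4 x y = ?L3 0 (-1/24) 0"
    using x y c by (simp add: bch\<^sub>4_def flip: B_def) (simp add: expand)
  show cl: "bch\<^sub>2 x y \<in> carrier M" "bch\<^sub>3 x y \<in> carrier M" "bch\<^sub>4 x y \<in> carrier M"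
    using c L2 L3 by (simp_all add: b2 b3 b4)
  assume s: "s \<in> carrier R" and s4: "s \<otimes> (s \<otimes> (s \<otimes> s)) = \<zero>"
  have two: "q 2 *\<^sub>M bch\<^sub>2 x y = B"
    using c by (simp add: b2 flip: smult_assoc1 q_mult)
  let ?b = "br (x +\<^sub>M y) B +\<^sub>M br (bch\<^sub>2 x y) (x +\<^sub>M y)"
  have b: "?b = ?L2 (1/2) (1/2)"
    using x y c by (simp add: b2 expand)
  \<comment> \<open>The coefficient of the square of \<open>s\<close>:
    \<open>(u - v)/4 + (u + v)/4 = u/2\<close>.\<close>
  have 1: "q 3 *\<^sub>M bch\<^sub>3 x y +\<^sub>M q (1/2) *\<^sub>M ?b = q (1/2) *\<^sub>M br x B"
    unfolding b by (simp add: b3 expand)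
  have "br (bch\<^sub>2 x y) B = 0\<^sub>M"
    using c by (simp add: b2 br_smult_left br_self)
  \<comment> \<open>The coefficient of the cube of \<open>s\<close>:
    \<open>-l/6 + (k - m)/12 + (k + 2 l + m)/12 = k/6\<close>.\<close>
  then have 2: "q 4 *\<^sub>M bch\<^sub>4 x y +\<^sub>M (q (1/2) *\<^sub>M (br (x +\<^sub>M y) (q 3 *\<^sub>M bch\<^sub>3 x y) +\<^sub>M
        (br (bch\<^sub>2 x y) B +\<^sub>M br (bch\<^sub>3 x y) (x +\<^sub>M y))) +\<^sub>M q (1/6) *\<^sub>M br (x +\<^sub>M y) ?b) =
      q (1/6) *\<^sub>M br x (br x B)"
    unfolding b using x y c by (simp add: b3 b4 expand)
  show "int_exp_ad s (horner s (x +\<^sub>M y) (bch\<^sub>2 x y) (bch\<^sub>3 x y) (bch\<^sub>4 x y))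
        (horner s (x +\<^sub>M y) (q 2 *\<^sub>M bch\<^sub>2 x y) (q 3 *\<^sub>M bch\<^sub>3 x y) (q 4 *\<^sub>M bch\<^sub>4 x y)) \<one> =
      x +\<^sub>M exp_ad s x \<one> y"
    unfolding two exp_ad_one[OF s x y] B_def[symmetric]
    using int_exp_ad_horner[OF s s4, of "x +\<^sub>M y" "bch\<^sub>2 x y" "bch\<^sub>3 x y" "bch\<^sub>4 x y" B
        "q 3 *\<^sub>M bch\<^sub>3 x y" "q 4 *\<^sub>M bch\<^sub>4 x y"] x y c cl
    unfolding 1 2 by simp
qed

text \<open>A first-order Taylor expansion, exact because \<open>d\<close> squares to zero; 2, 3, 4
  are exponents brought down. Through the term \<open>4 s^3 d\<close> the fourth-order coefficient
  takes part in the induction, although \<open>s^4\<close> vanishes there.\<close>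

lemma smult_horner_add:
  assumes s: "s \<in> carrier R" and d: "d \<in> carrier R" "d \<otimes> d = \<zero>"
    and v: "v0 \<in> carrier M" "v1 \<in> carrier M" "v2 \<in> carrier M" "v3 \<in> carrier M"
  shows "(s \<oplus> d) *\<^sub>M horner (s \<oplus> d) v0 v1 v2 v3 =
    s *\<^sub>M horner s v0 v1 v2 v3 +\<^sub>M d *\<^sub>M horner s v0 (q 2 *\<^sub>M v1) (q 3 *\<^sub>M v2) (q 4 *\<^sub>M v3)"
proof -
  have n: "d \<otimes> (d \<otimes> x) = \<zero>" if "x \<in> carrier R" for x
    using that d by (simp add: R.m_assoc[symmetric])
  note dist = R.l_distr R.r_distr R.a_ac R.m_ac n d(2) q_numeral
  have h: "r *\<^sub>M horner r v0 v1 v2 v3 = r *\<^sub>M v0 +\<^sub>M ((r \<otimes> r) *\<^sub>M v1 +\<^sub>M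
      ((r \<otimes> (r \<otimes> r)) *\<^sub>M v2 +\<^sub>M (r \<otimes> (r \<otimes> (r \<otimes> r))) *\<^sub>M v3))" if "r \<in> carrier R" for r
    using that v by (simp add: horner_def smult_r_distr smult_assoc1)
  have g: "d *\<^sub>M horner s v0 (q 2 *\<^sub>M v1) (q 3 *\<^sub>M v2) (q 4 *\<^sub>M v3) = d *\<^sub>M v0 +\<^sub>M
      ((d \<otimes> (s \<otimes> q 2)) *\<^sub>M v1 +\<^sub>M ((d \<otimes> (s \<otimes> (s \<otimes> q 3))) *\<^sub>M v2 +\<^sub>M (d \<otimes> (s \<otimes> (s \<otimes> (s \<otimes> q 4)))) *\<^sub>M v3))"
    using s d v by (simp add: horner_def smult_r_distr smult_assoc1)
  have "(s \<oplus> d) \<otimes> (s \<oplus> d) = s \<otimes> s \<oplus> d \<otimes> (s \<otimes> q 2)"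
    "(s \<oplus> d) \<otimes> ((s \<oplus> d) \<otimes> (s \<oplus> d)) = s \<otimes> (s \<otimes> s) \<oplus> d \<otimes> (s \<otimes> (s \<otimes> q 3))"
    "(s \<oplus> d) \<otimes> ((s \<oplus> d) \<otimes> ((s \<oplus> d) \<otimes> (s \<oplus> d))) = s \<otimes> (s \<otimes> (s \<otimes> s)) \<oplus> d \<otimes> (s \<otimes> (s \<otimes> (s \<otimes> q 4)))"
    using s d by (simp_all add: dist)
  then show ?thesis
    unfolding h[OF R.a_closed[OF s d(1)]] h[OF s] g using s d v by (simp add: smult_l_distr M.a_ac)
qed

lemma bch_powers:
  assumes s: "s \<in> carrier R" and x: "x \<in> carrier M" and y: "y \<in> carrier M"
  shows "s *\<^sub>M horner s (x +\<^sub>M y) (bch\<^sub>2 x y) (bch\<^sub>3 x y) (bch\<^sub>4 x y) =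
    s *\<^sub>M (x +\<^sub>M y)
      +\<^sub>M (q (1/2) \<otimes> s [^] (2::nat)) *\<^sub>M br x y
      +\<^sub>M (q (1/12) \<otimes> s [^] (3::nat)) *\<^sub>M br (br x y) (y \<ominus>\<^bsub>M\<^esub> x)
      +\<^sub>M (q (1/96) \<otimes> s [^] (4::nat)) *\<^sub>M
        (br (x +\<^sub>M y) (br (br x y) (x +\<^sub>M y)) +\<^sub>M br (br (br x y) (x \<ominus>\<^bsub>M\<^esub> y)) (x \<ominus>\<^bsub>M\<^esub> y))"
proof -
  define B C F where BCF: "B = br x y" "C = br (br x y) (y \<ominus>\<^bsub>M\<^esub> x)"
    "F = br (x +\<^sub>M y) (br (br x y) (x +\<^sub>M y)) +\<^sub>M br (br (br x y) (x \<ominus>\<^bsub>M\<^esub> y)) (x \<ominus>\<^bsub>M\<^esub> y)"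
  have c: "B \<in> carrier M" "C \<in> carrier M" "F \<in> carrier M"
    using x y by (simp_all add: BCF)
  have p: "s [^] (2::nat) = s \<otimes> s" "s [^] (3::nat) = s \<otimes> (s \<otimes> s)" "s [^] (4::nat) = s \<otimes> (s \<otimes> (s \<otimes> s))"
    using s by (simp_all add: eval_nat_numeral R.m_ac)
  show ?thesis
    unfolding bch\<^sub>2_def bch\<^sub>3_def bch\<^sub>4_def BCF[symmetric] p
    using s x y c by (simp add: horner_def smult_r_distr smult_assoc1[symmetric] R.m_ac M.a_ac)
qed

end

section \<open>Weil algebras with a monomial basis\<close>

text \<open>For algebras in which a product of basis vectors is a basis vector or zero
  (\<open>None\<close>). The axioms of a Weil algebra become conditions on a multiplication
  table.\<close>

definition monomial_weil :: "(nat \<Rightarrow> nat \<Rightarrow> nat option) \<Rightarrow> nat \<Rightarrow> nat \<Rightarrow> nat \<Rightarrow> rat" where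
  "monomial_weil m i j k = (if m i j = Some k then 1 else 0)"

definition square_zero_mult :: "nat \<Rightarrow> nat \<Rightarrow> nat option" where
  "square_zero_mult i j = (if i = 0 then Some j else if j = 0 then Some i else None)"

text \<open>The monomials \<open>1, x, y, x y\<close> with \<open>x\<^sup>2 = y\<^sup>2 = 0\<close>, numbered from 0 to 3.\<close>

definition bidual_mult :: "nat \<Rightarrow> nat \<Rightarrow> nat option" where
  "bidual_mult i j = (if i = 0 then Some j else if j = 0 then Some i
     else if i = 1 \<and> j = 2 \<or> i = 2 \<and> j = 1 then Some 3 else None)"

text \<open>Every sum over structure constants has at most one nonzero term, so associativity
  reduces to associativity of the partial product, written with \<open>Option.bind\<close>.\<close>

lemma weil_algebra_monomial:
  assumes unit: "\<And>i. m 0 i = Some i" and comm: "\<And>i j. m i j = m j i"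
    and assoc: "\<And>i j k. Option.bind (m i j) (\<lambda>l. m l k) = Option.bind (m j k) (m i)"
    and closed: "\<And>i j k. i \<le> n \<Longrightarrow> j \<le> n \<Longrightarrow> m i j = Some k \<Longrightarrow> k \<le> n"
    and ideal: "\<And>i j. i \<noteq> 0 \<Longrightarrow> m i j \<noteq> Some 0"
    and nilp: "\<And>vs k. length vs = N \<Longrightarrow> (\<forall>v \<in> set vs. v 0 = 0) \<Longrightarrow> k \<le> n \<Longrightarrow>
        foldr (weil_mult n (monomial_weil m)) vs (\<lambda>i. if i = 0 then 1 else 0) k = 0"
  shows "weil_algebra n (monomial_weil m)"
proof -
  have left: "(\<Sum>l\<le>n. monomial_weil m i j l * monomial_weil m l k p) =
      (if Option.bind (m i j) (\<lambda>l. m l k) = Some p then 1 else 0)" if "i \<le> n" "j \<le> n" for i j k p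
  proof (cases "m i j")
    case (Some x)
    then have "(\<Sum>l\<le>n. monomial_weil m i j l * monomial_weil m l k p) = (\<Sum>l\<le>n. if l = x then  monomial_weil m x k p else 0)"
      by (intro sum.cong) (auto simp: monomial_weil_def)
    then show ?thesis using closed[OF that Some] Some by (simp add: monomial_weil_def)
  qed (simp add: monomial_weil_def)
  have right: "(\<Sum>l\<le>n. monomial_weil m j k l * monomial_weil m i l p) =
      (if Option.bind (m j k) (m i) = Some p then 1 else 0)" if "j \<le> n" "k \<le> n" for i j k p
  proof (cases "m j k")
    case (Some x)
    then have "(\<Sum>l\<le>n. monomial_weil m j k l * monomial_weil m i l p) = (\<Sum>l\<le>n. if l = x then  monomial_weil m i x p else 0)"
      by (intro sum.cong) (auto simp: monomial_weil_def)
    then show ?thesis using closed[OF that Some] Some by (simp add: monomial_weil_def)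
  qed (simp add: monomial_weil_def)
  show ?thesis
    unfolding weil_algebra_def
  proof (intro conjI)
    show "\<forall>i\<le>n. \<forall>k\<le>n. monomial_weil m 0 i k = (if i = k then 1 else 0)"
      by (simp add: monomial_weil_def unit)
    show "\<forall>i\<le>n. \<forall>j\<le>n. \<forall>k\<le>n. monomial_weil m i j k = monomial_weil m j i k"
      using comm by (simp add: monomial_weil_def)
    show "\<forall>i\<le>n. \<forall>j\<le>n. \<forall>k\<le>n. \<forall>p\<le>n.
      (\<Sum>l\<le>n. monomial_weil m i j l * monomial_weil m l k p) =
      (\<Sum>l\<le>n. monomial_weil m j k l * monomial_weil m i l p)"
      by (simp add: left right assoc)
    show "\<forall>i\<in>{1..n}. \<forall>j\<le>n. monomial_weil m i j 0 = 0"
      using ideal by (simp add: monomial_weil_def)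
    show "\<exists>N. \<forall>vs. length vs = N \<and> (\<forall>v\<in>set vs. v 0 = 0) \<longrightarrow>
        (\<forall>k\<le>n. foldr (weil_mult n (monomial_weil m)) vs (\<lambda>i. if i = 0 then 1 else 0) k = 0)"
      using nilp by (intro exI[of _ N]) blast
  qed
qed

lemma weil_mult_square_zero:
  assumes "v 0 = 0" "w 0 = 0"
  shows "weil_mult n (monomial_weil square_zero_mult) v w = (\<lambda>k. 0)"
  unfolding weil_mult_def
  by (intro ext sum.neutral ballI) (auto simp: monomial_weil_def square_zero_mult_def assms)

lemma weil_mult_zero_coordinate:
  assumes "v 0 = 0" "\<And>i j. i \<noteq> 0 \<Longrightarrow> m i j \<noteq> Some 0"
  shows "weil_mult n (monomial_weil m) v w 0 = 0"
  unfolding weil_mult_def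
proof (intro sum.neutral ballI)
  fix i j show "v i * w j * monomial_weil m i j 0 = 0"
    using assms by (cases "i = 0") (auto simp: monomial_weil_def)
qed

text \<open>Serves the dual numbers with \<open>n = 1\<close> and the algebra of \<open>D(2)\<close>
  with \<open>n = 2\<close>. Two factors suffice for nilpotency, as the ideal has square
  zero.\<close>

lemma weil_algebra_square_zero: "weil_algebra n (monomial_weil square_zero_mult)"
proof (rule weil_algebra_monomial[where N = 2])
  fix vs :: "(nat \<Rightarrow> rat) list" and k :: nat
  assume "length vs = 2" "\<forall>v \<in> set vs. v 0 = (0::rat)"
  then obtain v w where vs: "vs = [v, w]" "v 0 = 0" "w 0 = 0"
    by (auto simp: numeral_2_eq_2 length_Suc_conv)
  show "foldr (weil_mult n (monomial_weil square_zero_mult)) vs (\<lambda>i. if i = 0 then 1 else 0) k = 0"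
    \<comment> \<open>The fold ends in the unit, so the last factor arrives as \<open>w\<close>
      times the unit; its coordinate 0 is still zero.\<close>
    using vs weil_mult_zero_coordinate[of w square_zero_mult n "\<lambda>i. if i = 0 then 1 else 0"]
      weil_mult_square_zero by (simp add: square_zero_mult_def)
qed (auto simp: square_zero_mult_def split: if_splits)

text \<open>A product of two elements of the ideal is a multiple of \<open>x y\<close>, the basis
  vector 3, and a third factor kills it.\<close>

lemma weil_algebra_bidual: "weil_algebra 3 (monomial_weil bidual_mult)"
proof (rule weil_algebra_monomial[where N = 3])
  fix vs :: "(nat \<Rightarrow> rat) list" and k :: nat
  assume vs: "length vs = 3" "\<forall>v \<in> set vs. v 0 = (0::rat)"
  then obtain u v w where vs: "vs = [u, v, w]" "u 0 = 0" "v 0 = 0" "w 0 = 0"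
    by (auto simp: numeral_3_eq_3 length_Suc_conv)
  let ?c = "monomial_weil bidual_mult"
  have mult: "weil_mult 3 ?c a b = (\<lambda>k. if k = 3 then a 1 * b 2 + a 2 * b 1 else 0)"
    if "a 0 = 0" "b 0 = 0" for a b
    using that
    by (intro ext) (simp add: weil_mult_def monomial_weil_def bidual_mult_def eval_nat_numeral)
  have w0: "weil_mult 3 ?c w (\<lambda>i. if i = 0 then 1 else 0) 0 = 0"
    using weil_mult_zero_coordinate[of w bidual_mult] vs by (simp add: bidual_mult_def)
  show "foldr (weil_mult 3 ?c) vs (\<lambda>i. if i = 0 then 1 else 0) k = 0"
    using vs w0 by (simp add: mult)
qed (auto simp: bidual_mult_def split: if_splits)

section \<open>Generalized elements\<close>

context finite_limit_ccc
begin

lemma hom_ob: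
  assumes "f \<in> Hom E A B"
  shows "A \<in> Ob E" and "B \<in> Ob E"
  using assms dom_ob cod_ob by (auto simp: Hom_def)

lemma hom_dom: "f \<in> Hom E A B \<Longrightarrow> Dom E f = A"
  by (simp add: Hom_def)

lemma tup_cmp:
  assumes f: "f \<in> Hom E J A" and g: "g \<in> Hom E J B" and h: "h \<in> Hom E K J"
  shows "\<langle>f, g\<rangle> \<cdot> h = \<langle>f \<cdot> h, g \<cdot> h\<rangle>"
proof -
  have A: "A \<in> Ob E" and B: "B \<in> Ob E"
    using f g hom_ob by blast+
  have t: "\<langle>f, g\<rangle> \<in> Hom E J (Prd E A B)"
    using f g by (rule tup_hom)
  have "\<langle>Pr1 E A B \<cdot> (\<langle>f, g\<rangle> \<cdot> h), Pr2 E A B \<cdot> (\<langle>f, g\<rangle> \<cdot> h)\<rangle> = \<langle>f, g\<rangle> \<cdot> h"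
    by (rule tup_unique[OF A B cmp_hom[OF h t]])
  moreover have "Pr1 E A B \<cdot> (\<langle>f, g\<rangle> \<cdot> h) = f \<cdot> h"
    using cmp_assoc[OF h t pr1_hom[OF A B]] pr1_tup[OF f g] by simp
  moreover have "Pr2 E A B \<cdot> (\<langle>f, g\<rangle> \<cdot> h) = g \<cdot> h"
    using cmp_assoc[OF h t pr2_hom[OF A B]] pr2_tup[OF f g] by simp
  ultimately show ?thesis by simp
qed

lemma tup_projections:
  assumes "A \<in> Ob E" "B \<in> Ob E"
  shows "\<langle>Pr1 E A B, Pr2 E A B\<rangle> = Idt E (Prd E A B)"
proof -
  have "Idt E (Prd E A B) \<in> Hom E (Prd E A B) (Prd E A B)"
    using assms prd_ob idt_hom by blast
  from tup_unique[OF assms this] idt_right[OF pr1_hom[OF assms]] idt_right[OF pr2_hom[OF assms]]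
  show ?thesis by simp
qed

text \<open>The pair of projections is the generic element of the product and equals the identity,
  so agreement there is already equality of arrows.\<close>

lemma prd_hom_ext:
  assumes "J \<in> Ob E" "S \<in> Ob E" "\<phi> \<in> Hom E (Prd E J S) M" "\<psi> \<in> Hom E (Prd E J S) M"
    and "\<And>K h u. h \<in> Hom E K J \<Longrightarrow> u \<in> Hom E K S \<Longrightarrow> \<phi> \<cdot> \<langle>h, u\<rangle> = \<psi> \<cdot> \<langle>h, u\<rangle>"
  shows "\<phi> = \<psi>"
  using assms(5)[OF pr1_hom[OF assms(1,2)] pr2_hom[OF assms(1,2)]]
    tup_projections[OF assms(1,2)] idt_right[OF assms(3)] idt_right[OF assms(4)] by simp

lemma stage_times_hom:
  assumes "J \<in> Ob E" "u \<in> Hom E A B"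
  shows "stage_times E J u \<in> Hom E (Prd E J A) (Prd E J B)"
proof -
  have A: "A \<in> Ob E" using assms hom_ob by blast
  show ?thesis
    unfolding stage_times_def hom_dom[OF assms(2)]
    using tup_hom[OF pr1_hom[OF assms(1) A] cmp_hom[OF pr2_hom[OF assms(1) A] assms(2)]] .
qed

lemma stage_times_tup:
  assumes \<phi>: "\<phi> \<in> Hom E (Prd E J B) M" and u: "u \<in> Hom E A B"
    and h: "h \<in> Hom E K J" and v: "v \<in> Hom E K A"
  shows "(\<phi> \<cdot> stage_times E J u) \<cdot> \<langle>h, v\<rangle> = \<phi> \<cdot> \<langle>h, u \<cdot> v\<rangle>"
proof -
  have J: "J \<in> Ob E" and A: "A \<in> Ob E" using h u hom_ob by blast+
  have "stage_times E J u \<cdot> \<langle>h, v\<rangle> = \<langle>h, u \<cdot> v\<rangle>"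
    unfolding stage_times_def hom_dom[OF u]
    by (simp add: tup_cmp[OF pr1_hom[OF J A] cmp_hom[OF pr2_hom[OF J A] u] tup_hom[OF h v]]
        pr1_tup[OF h v] cmp_assoc[OF tup_hom[OF h v] pr2_hom[OF J A] u] pr2_tup[OF h v])
  then show ?thesis
    using cmp_assoc[OF tup_hom[OF h v] stage_times_hom[OF J u] \<phi>] by simp
qed

text \<open>Translates the arrow equations in \<open>perceives_colimit\<close> into equations
  between values at generalized elements.\<close>

lemma stage_times_eq_iff:
  assumes J: "J \<in> Ob E" and \<phi>: "\<phi> \<in> Hom E (Prd E J B) M" and u: "u \<in> Hom E A B"
    and \<psi>: "\<psi> \<in> Hom E (Prd E J A) M"
  shows "\<phi> \<cdot> stage_times E J u = \<psi> \<longleftrightarrow>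
    (\<forall>K. \<forall>h \<in> Hom E K J. \<forall>v \<in> Hom E K A. \<phi> \<cdot> \<langle>h, u \<cdot> v\<rangle> = \<psi> \<cdot> \<langle>h, v\<rangle>)"
proof
  assume "\<phi> \<cdot> stage_times E J u = \<psi>"
  then show "\<forall>K. \<forall>h \<in> Hom E K J. \<forall>v \<in> Hom E K A. \<phi> \<cdot> \<langle>h, u \<cdot> v\<rangle> = \<psi> \<cdot> \<langle>h, v\<rangle>"
    using stage_times_tup[OF \<phi> u] by simp
next
  assume *: "\<forall>K. \<forall>h \<in> Hom E K J. \<forall>v \<in> Hom E K A. \<phi> \<cdot> \<langle>h, u \<cdot> v\<rangle> = \<psi> \<cdot> \<langle>h, v\<rangle>"
  have A: "A \<in> Ob E" using u hom_ob by blast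
  show "\<phi> \<cdot> stage_times E J u = \<psi>"
    using * stage_times_tup[OF \<phi> u]
    by (intro prd_hom_ext[OF J A cmp_hom[OF stage_times_hom[OF J u] \<phi>] \<psi>]) simp
qed

lemma stage_times_stage_times:
  assumes J: "J \<in> Ob E" and \<phi>: "\<phi> \<in> Hom E (Prd E J C) M" and c: "c \<in> Hom E B C" and u: "u \<in> Hom E A B"
  shows "(\<phi> \<cdot> stage_times E J c) \<cdot> stage_times E J u = \<phi> \<cdot> stage_times E J (c \<cdot> u)"
proof -
  note \<phi>c = cmp_hom[OF stage_times_hom[OF J c] \<phi>]
    and \<phi>cu = cmp_hom[OF stage_times_hom[OF J cmp_hom[OF u c]] \<phi>]
  show ?thesis
    unfolding stage_times_eq_iff[OF J \<phi>c u \<phi>cu]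
    using stage_times_tup[OF \<phi> c _ cmp_hom[OF _ u]] stage_times_tup[OF \<phi> cmp_hom[OF u c]]
      cmp_assoc[OF _ u c] by simp
qed

end

section \<open>Ring and group elements at varying stages\<close>

locale exp_lie_group = finite_limit_ccc E for E :: "('o, 'm) cccat" (structure) +
  fixes R :: "('o, 'm) ring_object" and G :: "('o, 'm) group_object" and ex :: 'm
  assumes model: "sdg_model E R"
    and lie_group: "lie_group E R G"
    and exponential: "exponential_map E R G ex"
begin

abbreviation "RR \<equiv> ring_at E R"
abbreviation "GG \<equiv> group_at E G"
abbreviation "gg \<equiv> lie_algebra_at E R G"
abbreviation "D \<equiv> D_ob E R"
abbreviation "\<iota> \<equiv> D_incl E R"
abbreviation "Nsq \<equiv> nilsq E R"
abbreviation "el \<equiv> D_elem E R"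
abbreviation "\<g> \<equiv> lie_ob E R G"
abbreviation "app \<equiv> tapp E R G"
abbreviation "Rb \<equiv> robj R"
abbreviation "Gb \<equiv> gobj G"
abbreviation "smul \<equiv> tsmult E R G"
abbreviation "vadd \<equiv> tadd E R G"
abbreviation "brac \<equiv> lie_bracket E R G"

abbreviation ring_add_at (\<open>_ +[_] _\<close> [65, 0, 66] 65) where "a +[K] b \<equiv> a \<oplus>\<^bsub>RR K\<^esub> b"
abbreviation ring_mult_at (\<open>_ *[_] _\<close> [70, 0, 71] 70) where "a *[K] b \<equiv> a \<otimes>\<^bsub>RR K\<^esub> b"
abbreviation ring_minus_at (\<open>\<ominus>[_] _\<close> [0, 81] 80) where "\<ominus>[K] a \<equiv> \<ominus>\<^bsub>RR K\<^esub> a"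
abbreviation ring_zero_at (\<open>\<zero>[_]\<close>) where "\<zero>[K] \<equiv> \<zero>\<^bsub>RR K\<^esub>"
abbreviation ring_one_at (\<open>\<one>\<^sub>R[_]\<close>) where "\<one>\<^sub>R[K] \<equiv> \<one>\<^bsub>RR K\<^esub>"
abbreviation group_mult_at (\<open>_ \<otimes>[_] _\<close> [70, 0, 71] 70) where "x \<otimes>[K] y \<equiv> x \<otimes>\<^bsub>GG K\<^esub> y"
abbreviation group_inv_at (\<open>inv[_] _\<close> [0, 81] 80) where "inv[K] x \<equiv> inv\<^bsub>GG K\<^esub> x"
abbreviation group_one_at (\<open>\<one>[_]\<close>) where "\<one>[K] \<equiv> \<one>\<^bsub>GG K\<^esub>"

lemma line: "rational_ring_object E R"
  using model by (simp add: sdg_model_def sdg_model_axioms_def)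

lemma kock_lawvere: "kock_lawvere E R"
  using model by (simp add: sdg_model_def sdg_model_axioms_def)

lemma line_ob [simp]: "Rb \<in> Ob E"
  using line by (simp add: rational_ring_object_def)

lemma group_ob [simp]: "Gb \<in> Ob E"
  using lie_group by (simp add: lie_group_def group_object_def)

lemma ring_at_cring: "J \<in> Ob E \<Longrightarrow> cring (RR J)"
  using line by (simp add: rational_ring_object_def)

lemma group_at_group: "J \<in> Ob E \<Longrightarrow> group (GG J)"
  using lie_group by (simp add: lie_group_def group_object_def)

lemma carrier_ring_at [simp]: "carrier (RR J) = Hom E J Rb"
  by (simp add: ring_at_def)

lemma carrier_group_at [simp]: "carrier (GG J) = Hom E J Gb"
  by (simp add: group_at_def)

lemma rrat_hom: "rrat R p \<in> Hom E (One E) Rb"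
  using line by (simp add: rational_ring_object_def)

lemma rat_at_hom: "J \<in> Ob E \<Longrightarrow> rat_at E R J p \<in> Hom E J Rb"
  unfolding rat_at_def using rrat_hom bang_hom cmp_hom by blast

lemma bang_cmp: "f \<in> Hom E K J \<Longrightarrow> Bang E J \<cdot> f = Bang E K"
  using bang_hom bang_unique cmp_hom hom_ob by metis

lemma rat_at_cmp: "f \<in> Hom E K J \<Longrightarrow> rat_at E R J p \<cdot> f = rat_at E R K p"
  using cmp_assoc[OF _ bang_hom[OF hom_ob(2)] rrat_hom] bang_cmp by (simp add: rat_at_def)

lemma radd_hom: "radd R \<in> Hom E (Prd E Rb Rb) Rb"
  and rmul_hom: "rmul R \<in> Hom E (Prd E Rb Rb) Rb"
  using line by (simp_all add: rational_ring_object_def)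

lemma gmul_hom: "gmul G \<in> Hom E (Prd E Gb Gb) Gb"
  and gunit_hom: "gunit G \<in> Hom E (One E) Gb"
  using lie_group by (simp_all add: lie_group_def group_object_def)

lemma ring_add_cmp:
  assumes "a \<in> Hom E J Rb" "b \<in> Hom E J Rb" "f \<in> Hom E K J"
  shows "(a +[J] b) \<cdot> f = (a \<cdot> f) +[K] (b \<cdot> f)"
  by (simp add: ring_at_def cmp_assoc[OF assms(3) tup_hom[OF assms(1,2)] radd_hom] tup_cmp[OF assms])

lemma ring_mult_cmp:
  assumes "a \<in> Hom E J Rb" "b \<in> Hom E J Rb" "f \<in> Hom E K J"
  shows "(a *[J] b) \<cdot> f = (a \<cdot> f) *[K] (b \<cdot> f)"
  by (simp add: ring_at_def cmp_assoc[OF assms(3) tup_hom[OF assms(1,2)] rmul_hom] tup_cmp[OF assms])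

lemma group_mult_cmp:
  assumes "a \<in> Hom E J Gb" "b \<in> Hom E J Gb" "f \<in> Hom E K J"
  shows "(a \<otimes>[J] b) \<cdot> f = (a \<cdot> f) \<otimes>[K] (b \<cdot> f)"
  by (simp add: group_at_def cmp_assoc[OF assms(3) tup_hom[OF assms(1,2)] gmul_hom] tup_cmp[OF assms])

lemma ring_one_cmp: "f \<in> Hom E K J \<Longrightarrow> \<one>\<^sub>R[J] \<cdot> f = \<one>\<^sub>R[K]"
  and ring_zero_cmp: "f \<in> Hom E K J \<Longrightarrow> \<zero>[J] \<cdot> f = \<zero>[K]"
  by (simp_all add: ring_at_def rat_at_cmp)

lemma group_one_cmp: "f \<in> Hom E K J \<Longrightarrow> \<one>[J] \<cdot> f = \<one>[K]"
  using cmp_assoc[OF _ bang_hom[OF hom_ob(2)] gunit_hom] bang_cmp by (simp add: group_at_def)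

text \<open>Negation and finite sums are not given by arrows of the ring object; that they commute
  with restriction follows from the general theory of ring homomorphisms.\<close>

lemma restrict_ring_hom:
  assumes "f \<in> Hom E K J"
  shows "ring_hom_cring (RR J) (RR K) (\<lambda>a. a \<cdot> f)"
proof -
  have "(\<lambda>a. a \<cdot> f) \<in> ring_hom (RR J) (RR K)"
    using assms cmp_hom by (auto intro!: ring_hom_memI simp: ring_mult_cmp ring_add_cmp ring_one_cmp)
  then show ?thesis
    using assms ring_at_cring hom_ob by (auto simp: ring_hom_cring_def ring_hom_cring_axioms_def)
qed

lemma ring_minus_cmp:
  assumes "f \<in> Hom E K J" "a \<in> Hom E J Rb"
  shows "(\<ominus>[J] a) \<cdot> f = \<ominus>[K] (a \<cdot> f)"
  using ring_hom_cring.hom_a_inv[OF restrict_ring_hom[OF assms(1)]] assms by simp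

lemma restrict_finsum:
  assumes "f \<in> Hom E K J" "a \<in> I \<rightarrow> Hom E J Rb"
  shows "(\<Oplus>\<^bsub>RR J\<^esub>i\<in>I. a i) \<cdot> f = (\<Oplus>\<^bsub>RR K\<^esub>i\<in>I. a i \<cdot> f)"
  using ring_hom_cring.hom_finsum[OF restrict_ring_hom[OF assms(1)]] assms by (simp add: comp_def)

lemma rat_at_one: "rat_at E R J 1 = \<one>\<^sub>R[J]" and rat_at_zero: "rat_at E R J 0 = \<zero>[J]"
  by (simp_all add: ring_at_def)

lemma rat_at_add:
  assumes "J \<in> Ob E" shows "rat_at E R J (p + p') = rat_at E R J p +[J] rat_at E R J p'"
  using ring_add_cmp[OF rrat_hom rrat_hom bang_hom[OF assms]] line
  by (simp add: rat_at_def rational_ring_object_def)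

lemma rat_at_mult:
  assumes "J \<in> Ob E" shows "rat_at E R J (p * p') = rat_at E R J p *[J] rat_at E R J p'"
  using ring_mult_cmp[OF rrat_hom rrat_hom bang_hom[OF assms]] line
  by (simp add: rat_at_def rational_ring_object_def)

lemma ring_closed [simp]:
  assumes "J \<in> Ob E"
  shows "\<zero>[J] \<in> Hom E J Rb" "\<one>\<^sub>R[J] \<in> Hom E J Rb"
    and "a \<in> Hom E J Rb \<Longrightarrow> b \<in> Hom E J Rb \<Longrightarrow> a +[J] b \<in> Hom E J Rb"
    and "a \<in> Hom E J Rb \<Longrightarrow> b \<in> Hom E J Rb \<Longrightarrow> a *[J] b \<in> Hom E J Rb"
    and "a \<in> Hom E J Rb \<Longrightarrow> \<ominus>[J] a \<in> Hom E J Rb"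
proof -
  interpret cring "RR J" using assms by (rule ring_at_cring)
  show "\<zero>[J] \<in> Hom E J Rb" "\<one>\<^sub>R[J] \<in> Hom E J Rb"
    and "a \<in> Hom E J Rb \<Longrightarrow> b \<in> Hom E J Rb \<Longrightarrow> a +[J] b \<in> Hom E J Rb"
    and "a \<in> Hom E J Rb \<Longrightarrow> b \<in> Hom E J Rb \<Longrightarrow> a *[J] b \<in> Hom E J Rb"
    and "a \<in> Hom E J Rb \<Longrightarrow> \<ominus>[J] a \<in> Hom E J Rb"
    using zero_closed one_closed add.m_closed m_closed add.inv_closed by simp_all
qed

lemma group_closed [simp]:
  assumes "J \<in> Ob E"
  shows "\<one>[J] \<in> Hom E J Gb"
    and "a \<in> Hom E J Gb \<Longrightarrow> b \<in> Hom E J Gb \<Longrightarrow> a \<otimes>[J] b \<in> Hom E J Gb"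
    and "a \<in> Hom E J Gb \<Longrightarrow> inv[J] a \<in> Hom E J Gb"
proof -
  interpret group "GG J" using assms by (rule group_at_group)
  show "\<one>[J] \<in> Hom E J Gb"
    and "a \<in> Hom E J Gb \<Longrightarrow> b \<in> Hom E J Gb \<Longrightarrow> a \<otimes>[J] b \<in> Hom E J Gb"
    and "a \<in> Hom E J Gb \<Longrightarrow> inv[J] a \<in> Hom E J Gb"
    using one_closed m_closed inv_closed by simp_all
qed

lemma ring_units [simp]:
  assumes "a \<in> Hom E J Rb"
  shows "a *[J] \<one>\<^sub>R[J] = a" "\<one>\<^sub>R[J] *[J] a = a"
    "a +[J] \<zero>[J] = a" "\<zero>[J] +[J] a = a"
    "a *[J] \<zero>[J] = \<zero>[J]" "\<zero>[J] *[J] a = \<zero>[J]"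
proof -
  interpret cring "RR J" using assms hom_ob ring_at_cring by blast
  have "a \<in> carrier (RR J)" using assms by simp
  from r_one[OF this] l_one[OF this] r_zero[OF this] l_zero[OF this] r_null[OF this] l_null[OF this]
  show "a *[J] \<one>\<^sub>R[J] = a" "\<one>\<^sub>R[J] *[J] a = a"
    "a +[J] \<zero>[J] = a" "\<zero>[J] +[J] a = a"
    "a *[J] \<zero>[J] = \<zero>[J]" "\<zero>[J] *[J] a = \<zero>[J]"
    by blast+
qed

lemma group_units [simp]:
  assumes "a \<in> Hom E J Gb"
  shows "a \<otimes>[J] \<one>[J] = a" "\<one>[J] \<otimes>[J] a = a"
proof -
  interpret group "GG J" using assms hom_ob group_at_group by blast
  have "a \<in> carrier (GG J)" using assms by simp
  from r_one[OF this] l_one[OF this]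
  show "a \<otimes>[J] \<one>[J] = a" "\<one>[J] \<otimes>[J] a = a" by blast+
qed

section \<open>The infinitesimal object and tangent vectors\<close>

lemma nilsq_hom: "d \<in> Nsq K \<Longrightarrow> d \<in> Hom E K Rb"
  by (simp add: nilsq_def)

lemma nilsq_ob: "d \<in> Nsq K \<Longrightarrow> K \<in> Ob E"
  using nilsq_hom hom_ob by blast

lemma nilsq_square: "d \<in> Nsq K \<Longrightarrow> d *[K] d = \<zero>[K]"
  by (simp add: nilsq_def)

lemma nilsq_cmp: "d \<in> Nsq J \<Longrightarrow> f \<in> Hom E K J \<Longrightarrow> d \<cdot> f \<in> Nsq K"
  using cmp_hom[of f K J d Rb] ring_mult_cmp[of d J d f K]
  by (simp add: nilsq_def ring_zero_cmp)

lemma zero_nilsq: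
  assumes "K \<in> Ob E"
  shows "\<zero>[K] \<in> Nsq K"
proof -
  interpret cring "RR K" using assms by (rule ring_at_cring)
  show ?thesis using l_null[of "\<zero>[K]"] assms by (simp add: nilsq_def)
qed

lemma nilsq_smult: "d \<in> Nsq K \<Longrightarrow> r \<in> Hom E K Rb \<Longrightarrow> r *[K] d \<in> Nsq K"
proof -
  assume d: "d \<in> Nsq K" and r: "r \<in> Hom E K Rb"
  interpret cring "RR K" using d nilsq_ob ring_at_cring by blast
  have "d \<in> carrier (RR K)" "r \<in> carrier (RR K)" using d r nilsq_hom by simp_all
  moreover from this have "(r *[K] d) *[K] (r *[K] d) = r *[K] r *[K] (d *[K] d)"
    by algebra
  ultimately show ?thesis
    using nilsq_square[OF d] by (simp add: nilsq_def r_null del: carrier_ring_at)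
qed

lemma nilsq_mult: "d \<in> Nsq K \<Longrightarrow> r \<in> Hom E K Rb \<Longrightarrow> d *[K] r \<in> Nsq K"
  using nilsq_smult[of d K r] comm_monoid.m_comm[OF cring.axioms(2)[OF ring_at_cring[OF nilsq_ob[of d K]]], of d r] nilsq_hom[of d K]
  by simp

lemma nilsq_minus: "d \<in> Nsq K \<Longrightarrow> \<ominus>[K] d \<in> Nsq K"
proof -
  assume d: "d \<in> Nsq K"
  interpret cring "RR K" using d nilsq_ob ring_at_cring by blast
  have dc: "d \<in> carrier (RR K)" using d nilsq_hom by simp
  have "(\<ominus>[K] d) *[K] (\<ominus>[K] d) = d *[K] d" using dc by algebra
  then show ?thesis using dc nilsq_square[OF d] nilsq_ob[OF d] by (simp add: nilsq_def)
qed

lemma D_incl_equalizer: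
  defines "S \<equiv> RR Rb"
  shows "\<iota> = Eqz E (Idt E Rb \<otimes>\<^bsub>S\<^esub> Idt E Rb) \<zero>\<^bsub>S\<^esub>"
    and "Idt E Rb \<otimes>\<^bsub>S\<^esub> Idt E Rb \<in> Hom E Rb Rb"
    and "\<zero>\<^bsub>S\<^esub> \<in> Hom E Rb Rb"
  using idt_hom[OF line_ob] by (simp_all add: S_def D_incl_def Let_def)

lemma D_incl_hom: "\<iota> \<in> Hom E D Rb"
  using eqz_hom[OF D_incl_equalizer(2,3)] by (simp add: D_ob_def D_incl_equalizer(1))

lemma D_ob [simp]: "D \<in> Ob E"
  using D_incl_hom hom_ob by blast

lemma square_cmp: "d \<in> Hom E K Rb \<Longrightarrow> (Idt E Rb *[Rb] Idt E Rb) \<cdot> d = d *[K] d"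
  using ring_mult_cmp[OF idt_hom[OF line_ob] idt_hom[OF line_ob]] idt_left by simp

lemma D_incl_nilsq: "\<iota> \<in> Nsq D"
  using eqz_eq[OF D_incl_equalizer(2,3)] D_incl_hom square_cmp[OF D_incl_hom] ring_zero_cmp[OF D_incl_hom]
  by (simp add: nilsq_def D_incl_equalizer(1)[symmetric])

lemma D_elem_unique:
  assumes "d \<in> Nsq K"
  shows "\<exists>!u. u \<in> Hom E K D \<and> \<iota> \<cdot> u = d"
  using eqz_universal[OF D_incl_equalizer(2,3) nilsq_hom[OF assms]]
    square_cmp[OF nilsq_hom[OF assms]] ring_zero_cmp[OF nilsq_hom[OF assms]] nilsq_square[OF assms]
  by (simp add: D_incl_equalizer(1)[symmetric] D_ob_def)

lemma D_elem:
  assumes "d \<in> Nsq K"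
  shows D_elem_hom: "el d \<in> Hom E K D" and D_incl_elem: "\<iota> \<cdot> el d = d"
  using theI'[OF D_elem_unique[OF assms]] hom_dom[OF nilsq_hom[OF assms]]
  by (simp_all add: D_elem_def)

lemma D_elem_eqI:
  assumes "u \<in> Hom E K D" "\<iota> \<cdot> u = d"
  shows "el d = u"
proof -
  have "d \<in> Nsq K" using nilsq_cmp[OF D_incl_nilsq assms(1)] assms(2) by simp
  with D_elem_unique[OF this] D_elem[OF this] assms show ?thesis by auto
qed

lemma D_elem_cmp:
  assumes "d \<in> Nsq J" "f \<in> Hom E K J"
  shows "el d \<cdot> f = el (d \<cdot> f)"
  using D_elem_eqI[OF cmp_hom[OF assms(2) D_elem_hom[OF assms(1)]]]
    cmp_assoc[OF assms(2) D_elem_hom[OF assms(1)] D_incl_hom] D_incl_elem[OF assms(1)] by simp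

lemma lie_incl_equalizer:
  defines "T \<equiv> Xpn E D Gb"
  defines "\<alpha> \<equiv> Evl E D Gb \<cdot> \<langle>Idt E T, el \<zero>[T]\<rangle>"
  shows "lie_incl E R G = Eqz E \<alpha> \<one>[T]"
    and "\<alpha> \<in> Hom E T Gb" and "\<one>[T] \<in> Hom E T Gb"
    and "lie_incl E R G \<in> Hom E \<g> T"
proof -
  have T: "T \<in> Ob E" by (simp add: T_def xpn_ob)
  show eq: "lie_incl E R G = Eqz E \<alpha> \<one>[T]"
    by (simp add: lie_incl_def Let_def T_def \<alpha>_def)
  show \<alpha>: "\<alpha> \<in> Hom E T Gb"
    unfolding \<alpha>_def
    by (rule cmp_hom[OF tup_hom[OF idt_hom[OF T] D_elem_hom[OF zero_nilsq[OF T]]]])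
      (simp add: T_def evl_hom)
  show one: "\<one>[T] \<in> Hom E T Gb" using T by simp
  show "lie_incl E R G \<in> Hom E \<g> T"
    using eqz_hom[OF \<alpha> one] by (simp add: lie_ob_def eq)
qed

lemma lie_ob_ob [simp]: "\<g> \<in> Ob E"
  using lie_incl_equalizer(4) hom_ob by blast

lemma eval_at_zero:
  assumes "u \<in> Hom E J (Xpn E D Gb)"
  shows "(Evl E D Gb \<cdot> \<langle>Idt E (Xpn E D Gb), el \<zero>[Xpn E D Gb]\<rangle>) \<cdot> u
    = Evl E D Gb \<cdot> \<langle>u, el \<zero>[J]\<rangle>"
proof -
  let ?T = "Xpn E D Gb"
  have T: "?T \<in> Ob E" by (simp add: xpn_ob)
  have z: "el \<zero>[?T] \<in> Hom E ?T D" using D_elem_hom zero_nilsq T by blast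
  have "\<langle>Idt E ?T, el \<zero>[?T]\<rangle> \<cdot> u = \<langle>u, el \<zero>[J]\<rangle>"
    using tup_cmp[OF idt_hom[OF T] z assms] idt_left[OF assms]
      D_elem_cmp[OF zero_nilsq[OF T] assms] ring_zero_cmp[OF assms] by simp
  then show ?thesis
    using cmp_assoc[OF assms tup_hom[OF idt_hom[OF T] z] evl_hom] by simp
qed

lemma tapp_hom:
  assumes "X \<in> Hom E K \<g>" "d \<in> Nsq K"
  shows "app X d \<in> Hom E K Gb"
  unfolding tapp_def
  by (rule cmp_hom[OF tup_hom[OF cmp_hom[OF assms(1) lie_incl_equalizer(4)] D_elem_hom[OF assms(2)]]])
    (simp add: evl_hom)

lemma tapp_cmp:
  assumes X: "X \<in> Hom E J \<g>" and d: "d \<in> Nsq J" and f: "f \<in> Hom E K J"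
  shows "app X d \<cdot> f = app (X \<cdot> f) (d \<cdot> f)"
  unfolding tapp_def
  using cmp_assoc[OF f tup_hom[OF cmp_hom[OF X lie_incl_equalizer(4)] D_elem_hom[OF d]] evl_hom]
    tup_cmp[OF cmp_hom[OF X lie_incl_equalizer(4)] D_elem_hom[OF d] f]
    cmp_assoc[OF f X lie_incl_equalizer(4)] D_elem_cmp[OF d f]
  by simp

lemma tapp_zero:
  assumes X: "X \<in> Hom E K \<g>"
  shows "app X \<zero>[K] = \<one>[K]"
proof -
  note l = lie_incl_equalizer
  have u: "lie_incl E R G \<cdot> X \<in> Hom E K (Xpn E D Gb)"
    using cmp_hom[OF X l(4)] .
  have "Eqz E (Evl E D Gb \<cdot> \<langle>Idt E (Xpn E D Gb), el \<zero>[Xpn E D Gb]\<rangle>) \<one>[Xpn E D Gb]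
      \<in> Hom E \<g> (Xpn E D Gb)"
    using l(1,4) by simp
  then have "(Evl E D Gb \<cdot> \<langle>Idt E (Xpn E D Gb), el \<zero>[Xpn E D Gb]\<rangle>) \<cdot> (lie_incl E R G \<cdot> X) =
      \<one>[Xpn E D Gb] \<cdot> (lie_incl E R G \<cdot> X)"
    using eqz_eq[OF l(2,3)] cmp_assoc[OF X l(4) l(2)] cmp_assoc[OF X l(4) l(3)] l(1) by simp
  then show ?thesis
    using eval_at_zero[OF u] group_one_cmp[OF u] by (simp add: tapp_def)
qed

text \<open>The hypothesis is applied at the generic stage \<open>Prd E J D\<close> with the generic
  nilsquare element. Uniqueness of transposes, then uniqueness of factorizations through the
  equalizer, give the claim.\<close>

lemma tangent_ext:
  assumes X: "X \<in> Hom E J \<g>" and Y: "Y \<in> Hom E J \<g>"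
    and eq: "\<And>K f d. f \<in> Hom E K J \<Longrightarrow> d \<in> Nsq K \<Longrightarrow> app (X \<cdot> f) d = app (Y \<cdot> f) d"
  shows "X = Y"
proof -
  note l = lie_incl_equalizer
  have J: "J \<in> Ob E" using X hom_ob by blast
  have ev: "Evl E D Gb \<cdot> \<langle>(lie_incl E R G \<cdot> Z) \<cdot> Pr1 E J D, Pr2 E J D\<rangle> =
      app (Z \<cdot> Pr1 E J D) (\<iota> \<cdot> Pr2 E J D)" if "Z \<in> Hom E J \<g>" for Z
    using cmp_assoc[OF pr1_hom[OF J D_ob] that l(4)] D_elem_eqI[OF pr2_hom[OF J D_ob] refl]
    by (simp add: tapp_def)
  let ?u = "lie_incl E R G \<cdot> X" and ?v = "lie_incl E R G \<cdot> Y"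
  have u: "?u \<in> Hom E J (Xpn E D Gb)" and v: "?v \<in> Hom E J (Xpn E D Gb)"
    using cmp_hom[OF X l(4)] cmp_hom[OF Y l(4)] by blast+
  have e: "Evl E D Gb \<cdot> \<langle>?u \<cdot> Pr1 E J D, Pr2 E J D\<rangle> = Evl E D Gb \<cdot> \<langle>?v \<cdot> Pr1 E J D, Pr2 E J D\<rangle>"
    using ev[OF X] ev[OF Y] eq[OF pr1_hom[OF J D_ob] nilsq_cmp[OF D_incl_nilsq pr2_hom[OF J D_ob]]]
    by simp
  have "Evl E D Gb \<cdot> \<langle>?u \<cdot> Pr1 E J D, Pr2 E J D\<rangle> \<in> Hom E (Prd E J D) Gb"
    using cmp_hom[OF tup_hom[OF cmp_hom[OF pr1_hom[OF J D_ob] u] pr2_hom[OF J D_ob]] evl_hom] by simp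
  from evl_universal[OF J D_ob group_ob this] u v e have uv: "?u = ?v" by metis
  have "(Evl E D Gb \<cdot> \<langle>Idt E (Xpn E D Gb), el \<zero>[Xpn E D Gb]\<rangle>) \<cdot> ?u =
      \<one>[Xpn E D Gb] \<cdot> ?u"
    using eqz_eq[OF l(2,3)] cmp_assoc[OF X l(4) l(2)] cmp_assoc[OF X l(4) l(3)] l(1) by simp
  from eqz_universal[OF l(2,3) u this] X Y uv show ?thesis
    unfolding l(1)[symmetric] lie_ob_def[symmetric] by auto
qed

text \<open>The Yoneda argument: naturality makes the whole family a restriction of its value at the
  generic pair. That value is transposed, and \<open>zero\<close> lets the transpose factor through
  the equalizer that defines the Lie algebra.\<close>

lemma tangent_comprehension:
  assumes J: "J \<in> Ob E"
    and hom: "\<And>K f d. f \<in> Hom E K J \<Longrightarrow> d \<in> Nsq K \<Longrightarrow> \<Phi> f d \<in> Hom E K Gb"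
    and nat: "\<And>K L f d h. f \<in> Hom E K J \<Longrightarrow> d \<in> Nsq K \<Longrightarrow> h \<in> Hom E L K \<Longrightarrow>
      \<Phi> f d \<cdot> h = \<Phi> (f \<cdot> h) (d \<cdot> h)"
    and zero: "\<And>K f. f \<in> Hom E K J \<Longrightarrow> \<Phi> f \<zero>[K] = \<one>[K]"
  shows "\<exists>Z \<in> Hom E J \<g>. \<forall>K. \<forall>f \<in> Hom E K J. \<forall>d \<in> Nsq K. app (Z \<cdot> f) d = \<Phi> f d"
proof -
  note l = lie_incl_equalizer
  let ?P = "Prd E J D" and ?p = "Pr1 E J D" and ?d = "\<iota> \<cdot> Pr2 E J D"
  have p: "?p \<in> Hom E ?P J" and p2: "Pr2 E J D \<in> Hom E ?P D"
    using pr1_hom[OF J D_ob] pr2_hom[OF J D_ob] by blast+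
  have d: "?d \<in> Nsq ?P" using nilsq_cmp[OF D_incl_nilsq p2] .
  from evl_universal[OF J D_ob group_ob hom[OF p d]]
  obtain u where u: "u \<in> Hom E J (Xpn E D Gb)" and ue: "Evl E D Gb \<cdot> \<langle>u \<cdot> ?p, Pr2 E J D\<rangle> = \<Phi> ?p ?d"
    by blast
  have ev: "Evl E D Gb \<cdot> \<langle>u \<cdot> f, el e\<rangle> = \<Phi> f e" if f: "f \<in> Hom E K J" and e: "e \<in> Nsq K" for K f e
  proof -
    have t: "\<langle>f, el e\<rangle> \<in> Hom E K ?P" using tup_hom[OF f D_elem_hom[OF e]] .
    have "\<Phi> ?p ?d \<cdot> \<langle>f, el e\<rangle> = \<Phi> f e"
      using nat[OF p d t] pr1_tup[OF f D_elem_hom[OF e]] pr2_tup[OF f D_elem_hom[OF e]]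
        cmp_assoc[OF t p2 D_incl_hom] D_incl_elem[OF e] by simp
    moreover have "\<langle>u \<cdot> ?p, Pr2 E J D\<rangle> \<cdot> \<langle>f, el e\<rangle> = \<langle>u \<cdot> f, el e\<rangle>"
      using tup_cmp[OF cmp_hom[OF p u] p2 t] pr1_tup[OF f D_elem_hom[OF e]]
        pr2_tup[OF f D_elem_hom[OF e]] cmp_assoc[OF t p u] by simp
    ultimately show ?thesis
      using cmp_assoc[OF t tup_hom[OF cmp_hom[OF p u] p2] evl_hom] ue by simp
  qed
  have "(Evl E D Gb \<cdot> \<langle>Idt E (Xpn E D Gb), el \<zero>[Xpn E D Gb]\<rangle>) \<cdot> u = \<one>[Xpn E D Gb] \<cdot> u"
    using eval_at_zero[OF u] group_one_cmp[OF u] ev[OF idt_hom[OF J] zero_nilsq[OF J]]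
      zero[OF idt_hom[OF J]] idt_right[OF u] by simp
  from eqz_universal[OF l(2,3) u this]
  obtain Z where Z: "Z \<in> Hom E J \<g>" and Ze: "lie_incl E R G \<cdot> Z = u"
    unfolding l(1)[symmetric] lie_ob_def[symmetric] by blast
  have "app (Z \<cdot> f) d = \<Phi> f d" if "f \<in> Hom E K J" "d \<in> Nsq K" for K f d
    using ev[OF that] cmp_assoc[OF that(1) Z l(4)] Ze by (simp add: tapp_def)
  with Z show ?thesis by blast
qed

section \<open>The Kock-Lawvere axiom on \<open>D\<close>, \<open>D(2)\<close> and
  \<open>D x D\<close>\<close>

lemma weil_point_monomial:
  assumes y: "\<And>i. i \<le> n \<Longrightarrow> y i \<in> Hom E J Rb" and J: "J \<in> Ob E"
    and closed: "\<And>i j k. i \<le> n \<Longrightarrow> j \<le> n \<Longrightarrow> m i j = Some k \<Longrightarrow> k \<le> n"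
  shows "weil_point E R n (monomial_weil m) J y \<longleftrightarrow> y 0 = \<one>\<^sub>R[J] \<and>
    (\<forall>i\<le>n. \<forall>j\<le>n. y i *[J] y j = (case m i j of None \<Rightarrow> \<zero>[J] | Some k \<Rightarrow> y k))"
proof -
  interpret cring "RR J" using J by (rule ring_at_cring)
  have "(\<Oplus>\<^bsub>RR J\<^esub>k\<in>{..n}. rat_at E R J (monomial_weil m i j k) *[J] y k) =
      (case m i j of None \<Rightarrow> \<zero>[J] | Some k \<Rightarrow> y k)" if ij: "i \<le> n" "j \<le> n" for i j
  proof -
    have t: "rat_at E R J (monomial_weil m i j k) *[J] y k = (if m i j = Some k then y k else \<zero>[J])"
      if "k \<in> {..n}" for k
      using y[of k] that by (simp add: monomial_weil_def rat_at_one rat_at_zero)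
    have "(\<Oplus>\<^bsub>RR J\<^esub>k\<in>{..n}. rat_at E R J (monomial_weil m i j k) *[J] y k) =
        (\<Oplus>\<^bsub>RR J\<^esub>k\<in>{..n}. if m i j = Some k then y k else \<zero>[J])"
      by (rule finsum_cong') (use t y J in auto)
    also have "\<dots> = (case m i j of None \<Rightarrow> \<zero>[J] | Some k \<Rightarrow> y k)"
    proof (cases "m i j")
      case (Some k)
      then show ?thesis
        using finsum_singleton[of k "{..n}" y] closed[OF ij Some] y by (simp add: Pi_def)
    qed simp
    finally show ?thesis .
  qed
  then show ?thesis by (simp add: weil_point_def)
qed

lemma kl_eval:
  assumes J: "J \<in> Ob E" and S: "S \<in> Ob E" and x: "\<And>i. i \<le> n \<Longrightarrow> x i \<in> Hom E S Rb"
    and a: "\<And>i. i \<le> n \<Longrightarrow> a i \<in> Hom E J Rb" and h: "h \<in> Hom E K J" and u: "u \<in> Hom E K S"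
  shows "(\<Oplus>\<^bsub>RR (Prd E J S)\<^esub>i\<in>{..n::nat}. (a i \<cdot> Pr1 E J S) *[Prd E J S] (x i \<cdot> Pr2 E J S)) \<cdot> \<langle>h, u\<rangle> =
    (\<Oplus>\<^bsub>RR K\<^esub>i\<in>{..n}. (a i \<cdot> h) *[K] (x i \<cdot> u))"
proof -
  have P: "Prd E J S \<in> Ob E" and K: "K \<in> Ob E" using J S prd_ob h hom_ob by blast+
  note p1 = pr1_hom[OF J S] and p2 = pr2_hom[OF J S] and t = tup_hom[OF h u]
  interpret cring "RR K" using K by (rule ring_at_cring)
  have ax: "a i \<cdot> Pr1 E J S \<in> Hom E (Prd E J S) Rb" "x i \<cdot> Pr2 E J S \<in> Hom E (Prd E J S) Rb"
    if "i \<le> n" for i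
    using a[OF that] x[OF that] p1 p2 cmp_hom by blast+
  have "((a i \<cdot> Pr1 E J S) *[Prd E J S] (x i \<cdot> Pr2 E J S)) \<cdot> \<langle>h, u\<rangle> =
      (a i \<cdot> h) *[K] (x i \<cdot> u)" if "i \<le> n" for i
    using ring_mult_cmp[OF ax[OF that] t] cmp_assoc[OF t p1 a[OF that]] cmp_assoc[OF t p2 x[OF that]]
      pr1_tup[OF h u] pr2_tup[OF h u] by simp
  moreover have "(a i \<cdot> h) *[K] (x i \<cdot> u) \<in> Hom E K Rb" if "i \<le> n" for i
    using K a[OF that] x[OF that] h u cmp_hom by simp
  ultimately show ?thesis
    using ax P by (subst restrict_finsum[OF t]) (auto intro!: finsum_cong')
qed

lemma kock_lawvere_elements:
  assumes W: "weil_spectrum E R n c S x" and J: "J \<in> Ob E" and f: "f \<in> Hom E (Prd E J S) Rb"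
  shows "\<exists>a. (\<forall>i\<le>n. a i \<in> Hom E J Rb) \<and> (\<forall>K. \<forall>h \<in> Hom E K J. \<forall>u \<in> Hom E K S.
      f \<cdot> \<langle>h, u\<rangle> = (\<Oplus>\<^bsub>RR K\<^esub>i\<in>{..n}. (a i \<cdot> h) *[K] (x i \<cdot> u)))"
proof -
  have S: "S \<in> Ob E" and x: "\<And>i. i \<le> n \<Longrightarrow> x i \<in> Hom E S Rb"
    using W by (auto simp: weil_spectrum_def represents_def)
  from kock_lawvere[unfolded kock_lawvere_def, rule_format, OF W J f]
  obtain a where a: "a \<in> {..n} \<rightarrow>\<^sub>E Hom E J Rb" and
    fe: "f = (\<Oplus>\<^bsub>RR (Prd E J S)\<^esub>i\<in>{..n}. (a i \<cdot> Pr1 E J S) *[Prd E J S] (x i \<cdot> Pr2 E J S))"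
    by blast
  have ah: "a i \<in> Hom E J Rb" if "i \<le> n" for i
    using a that by auto
  show ?thesis
    by (rule exI[of _ a]) (use ah fe kl_eval[OF J S x ah] in auto)
qed

text \<open>Equality of the values at all elements contains the case of the generic element, where
  it becomes the equation of arrows to which the axiom refers.\<close>

lemma kock_lawvere_unique:
  assumes W: "weil_spectrum E R n c S x" and J: "J \<in> Ob E"
    and a: "\<And>i. i \<le> n \<Longrightarrow> a i \<in> Hom E J Rb" and b: "\<And>i. i \<le> n \<Longrightarrow> b i \<in> Hom E J Rb"
    and eq: "\<And>K h u. h \<in> Hom E K J \<Longrightarrow> u \<in> Hom E K S \<Longrightarrow>
      (\<Oplus>\<^bsub>RR K\<^esub>i\<in>{..n}. (a i \<cdot> h) *[K] (x i \<cdot> u)) = (\<Oplus>\<^bsub>RR K\<^esub>i\<in>{..n}. (b i \<cdot> h) *[K] (x i \<cdot> u))"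
    and i: "i \<le> n"
  shows "a i = b i"
proof -
  let ?P = "Prd E J S"
  have S: "S \<in> Ob E" and x: "\<And>i. i \<le> n \<Longrightarrow> x i \<in> Hom E S Rb"
    using W by (auto simp: weil_spectrum_def represents_def)
  have P: "?P \<in> Ob E" using J S prd_ob by blast
  note p1 = pr1_hom[OF J S] and p2 = pr2_hom[OF J S]
  interpret cring "RR ?P" using P by (rule ring_at_cring)
  let ?f = "\<lambda>a. \<Oplus>\<^bsub>RR ?P\<^esub>i\<in>{..n}. (a i \<cdot> Pr1 E J S) *[?P] (x i \<cdot> Pr2 E J S)"
  have f_hom: "?f a \<in> Hom E ?P Rb"
  proof -
    have "?f a \<in> carrier (RR ?P)"
      using a x P p1 p2 cmp_hom by (intro finsum_closed) (auto simp: Pi_def)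
    then show ?thesis by simp
  qed
  \<comment> \<open>The axiom asserts uniqueness among functions that are \<open>undefined\<close>
    outside \<open>{..n}\<close>, so both coefficient families are restricted first.\<close>
  have r: "?f (restrict a {..n}) = ?f a" if "\<And>i. i \<le> n \<Longrightarrow> a i \<in> Hom E J Rb" for a
    using that x P p1 p2 cmp_hom by (intro finsum_cong') (auto simp: Pi_def)
  have "?f a = ?f b" using eq[OF p1 p2] .
  then have e: "?f a = ?f (restrict a {..n})" "?f a = ?f (restrict b {..n})"
    using r[OF a] r[OF b] by simp_all
  have ab: "restrict a {..n} \<in> {..n} \<rightarrow>\<^sub>E Hom E J Rb" "restrict b {..n} \<in> {..n} \<rightarrow>\<^sub>E Hom E J Rb"
    using a b by auto
  have "restrict a {..n} = restrict b {..n}"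
    using kock_lawvere[unfolded kock_lawvere_def, rule_format, OF W J f_hom] ab e by blast
  then show ?thesis using i by (metis atMost_iff restrict_apply)
qed

lemma weil_point_square_zero:
  assumes y: "\<And>i. i \<le> n \<Longrightarrow> y i \<in> Hom E J Rb" and J: "J \<in> Ob E"
  shows "weil_point E R n (monomial_weil square_zero_mult) J y \<longleftrightarrow>
    y 0 = \<one>\<^sub>R[J] \<and> (\<forall>i\<in>{1..n}. \<forall>j\<in>{1..n}. y i *[J] y j = \<zero>[J])"
proof -
  interpret cring "RR J" using J by (rule ring_at_cring)
  show ?thesis
    by (subst weil_point_monomial[OF y J]) (use y J in \<open>auto simp: square_zero_mult_def split: if_splits\<close>)
qed

lemma weil_point_bidual:
  assumes y: "\<And>i. i \<le> 3 \<Longrightarrow> y i \<in> Hom E J Rb" and J: "J \<in> Ob E"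
  shows "weil_point E R 3 (monomial_weil bidual_mult) J y \<longleftrightarrow>
    y 0 = \<one>\<^sub>R[J] \<and> y 1 \<in> Nsq J \<and> y 2 \<in> Nsq J \<and> y 3 = y 1 *[J] y 2"
    (is "_ \<longleftrightarrow> ?r")
proof -
  interpret cring "RR J" using J by (rule ring_at_cring)
  have yc: "y 0 \<in> carrier (RR J)" "y 1 \<in> carrier (RR J)" "y 2 \<in> carrier (RR J)" "y 3 \<in> carrier (RR J)"
    using y by simp_all
  have le3: "(\<forall>i\<le>3. Q i) \<longleftrightarrow> Q 0 \<and> Q 1 \<and> Q 2 \<and> Q (3::nat)" for Q
    by (auto simp: eval_nat_numeral le_Suc_eq)
  have z: "a *[J] b *[J] c = \<zero>[J]"
    if "a \<in> carrier (RR J)" "b \<in> carrier (RR J)" "c \<in> carrier (RR J)"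
      "a *[J] c = \<zero>[J] \<or> b *[J] c = \<zero>[J]" for a b c
    using that by (metis m_assoc m_comm r_null)
  have "weil_point E R 3 (monomial_weil bidual_mult) J y \<longleftrightarrow> y 0 = \<one>\<^sub>R[J] \<and>
    (\<forall>i\<le>3. \<forall>j\<le>3. y i *[J] y j = (case bidual_mult i j of None \<Rightarrow> \<zero>[J] | Some k \<Rightarrow> y k))"
    by (rule weil_point_monomial[OF y J]) (auto simp: bidual_mult_def split: if_splits)
  also have "\<dots> \<longleftrightarrow> ?r"
  proof
    assume *: "y 0 = \<one>\<^sub>R[J] \<and>
      (\<forall>i\<le>3. \<forall>j\<le>3. y i *[J] y j = (case bidual_mult i j of None \<Rightarrow> \<zero>[J] | Some k \<Rightarrow> y k))"
    then have h: "y i *[J] y j = (case bidual_mult i j of None \<Rightarrow> \<zero>[J] | Some k \<Rightarrow> y k)"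
      if "i \<le> 3" "j \<le> 3" for i j using that by blast
    show ?r
      using h[of 1 1] h[of 2 2] h[of 1 2] * yc by (simp add: bidual_mult_def nilsq_def)
  next
    assume r: ?r
    then have q: "y 1 *[J] y 1 = \<zero>[J]" "y 2 *[J] y 2 = \<zero>[J]"
      using nilsq_square by blast+
    have c: "y 2 *[J] y 1 = y 1 *[J] y 2" using yc m_comm by blast
    have z3: "y 3 *[J] y 1 = \<zero>[J]" "y 3 *[J] y 2 = \<zero>[J]"
      using r q yc z[of "y 1" "y 2"] by auto
    then have z3': "y 1 *[J] y 3 = \<zero>[J]" "y 2 *[J] y 3 = \<zero>[J]"
      using yc m_comm by metis+
    have "y 3 *[J] y 3 = \<zero>[J]"
      using r z[of "y 1" "y 2" "y 3"] yc z3' by auto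
    then show "y 0 = \<one>\<^sub>R[J] \<and>
      (\<forall>i\<le>3. \<forall>j\<le>3. y i *[J] y j = (case bidual_mult i j of None \<Rightarrow> \<zero>[J] | Some k \<Rightarrow> y k))"
      using r q c z3 z3' yc by (simp add: le3 bidual_mult_def)
  qed
  finally show ?thesis .
qed

lemma finsum_atMost:
  fixes f :: "nat \<Rightarrow> 'm"
  assumes K: "K \<in> Ob E"
  shows "f 0 \<in> Hom E K Rb \<Longrightarrow> f 1 \<in> Hom E K Rb \<Longrightarrow> (\<Oplus>\<^bsub>RR K\<^esub>i\<in>{..1}. f i) = f 0 +[K] f 1"
    and "f 0 \<in> Hom E K Rb \<Longrightarrow> f 1 \<in> Hom E K Rb \<Longrightarrow> f 2 \<in> Hom E K Rb \<Longrightarrow>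
      (\<Oplus>\<^bsub>RR K\<^esub>i\<in>{..2}. f i) = f 0 +[K] f 1 +[K] f 2"
    and "f 0 \<in> Hom E K Rb \<Longrightarrow> f 1 \<in> Hom E K Rb \<Longrightarrow> f 2 \<in> Hom E K Rb \<Longrightarrow> f 3 \<in> Hom E K Rb \<Longrightarrow>
      (\<Oplus>\<^bsub>RR K\<^esub>i\<in>{..3}. f i) = f 0 +[K] f 1 +[K] f 2 +[K] f 3"
proof -
  interpret cring "RR K" using K by (rule ring_at_cring)
  show 1: "(\<Oplus>\<^bsub>RR K\<^esub>i\<in>{..1}. f i) = f 0 +[K] f 1"
    if f: "f 0 \<in> Hom E K Rb" "f 1 \<in> Hom E K Rb"
  proof -
    have "f \<in> {..Suc 0} \<rightarrow> carrier (RR K)" using f by (auto simp: le_Suc_eq)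
    from finsum_Suc[OF this] show ?thesis using f a_comm by simp
  qed
  show 2: "(\<Oplus>\<^bsub>RR K\<^esub>i\<in>{..2}. f i) = f 0 +[K] f 1 +[K] f 2"
    if f: "f 0 \<in> Hom E K Rb" "f 1 \<in> Hom E K Rb" "f 2 \<in> Hom E K Rb"
  proof -
    have "f \<in> {..Suc 1} \<rightarrow> carrier (RR K)" using f by (auto simp: le_Suc_eq numeral_2_eq_2)
    from finsum_Suc[OF this] show ?thesis using f a_comm 1 K by (simp add: numeral_2_eq_2)
  qed
  show "(\<Oplus>\<^bsub>RR K\<^esub>i\<in>{..3}. f i) = f 0 +[K] f 1 +[K] f 2 +[K] f 3"
    if f: "f 0 \<in> Hom E K Rb" "f 1 \<in> Hom E K Rb" "f 2 \<in> Hom E K Rb" "f 3 \<in> Hom E K Rb"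
  proof -
    have "f \<in> {..Suc 2} \<rightarrow> carrier (RR K)" using f by (auto simp: le_Suc_eq eval_nat_numeral)
    from finsum_Suc[OF this] show ?thesis using f a_comm 2 K by (simp add: numeral_3_eq_3 numeral_2_eq_2)
  qed
qed

lemma spectrum_D:
  "weil_spectrum E R 1 (monomial_weil square_zero_mult) D (\<lambda>i. if i = 0 then \<one>\<^sub>R[D] else \<iota>)"
  (is "weil_spectrum E R 1 ?c D ?x")
  unfolding weil_spectrum_def represents_def
proof (intro conjI ballI allI impI)
  have x: "?x i \<in> Hom E D Rb" for i using D_incl_hom by simp
  show "weil_algebra 1 ?c" by (rule weil_algebra_square_zero)
  show "D \<in> Ob E" by simp
  show "?x i \<in> Hom E D Rb" for i by (rule x)
  show "weil_point E R 1 ?c D ?x"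
    using weil_point_square_zero[of 1 ?x, OF x D_ob] nilsq_square[OF D_incl_nilsq] by simp
  fix J y assume J: "J \<in> Ob E" and "(\<forall>i<Suc 1. y i \<in> Hom E J Rb) \<and> weil_point E R 1 ?c J y"
  then have y: "\<And>i. i \<le> 1 \<Longrightarrow> y i \<in> Hom E J Rb" and w: "weil_point E R 1 ?c J y" by auto
  have y0: "y 0 = \<one>\<^sub>R[J]" and y1: "y 1 \<in> Nsq J"
    using weil_point_square_zero[OF y J] w y[of 1] by (simp_all add: nilsq_def)
  have "(u \<in> Hom E J D \<and> (\<forall>i<Suc 1. ?x i \<cdot> u = y i)) \<longleftrightarrow> (u \<in> Hom E J D \<and> \<iota> \<cdot> u = y 1)" for u
    using ring_one_cmp[of u J D] y0 by (auto simp: less_Suc_eq)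
  then show "\<exists>!u. u \<in> Hom E J D \<and> (\<forall>i<Suc 1. ?x i \<cdot> u = y i)"
    using D_elem_unique[OF y1] by simp
qed

lemma kock_lawvere_D:
  assumes J: "J \<in> Ob E" and f: "f \<in> Hom E (Prd E J D) Rb"
  obtains a b where "a \<in> Hom E J Rb" "b \<in> Hom E J Rb"
    and "\<And>K h d. h \<in> Hom E K J \<Longrightarrow> d \<in> Nsq K \<Longrightarrow> f \<cdot> \<langle>h, el d\<rangle> = a \<cdot> h +[K] (b \<cdot> h) *[K] d"
proof -
  obtain a :: "nat \<Rightarrow> 'm" where a: "\<forall>i\<le>1. a i \<in> Hom E J Rb" and
    e: "\<forall>K. \<forall>h \<in> Hom E K J. \<forall>u \<in> Hom E K D. f \<cdot> \<langle>h, u\<rangle> =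
      (\<Oplus>\<^bsub>RR K\<^esub>i\<in>{..1}. (a i \<cdot> h) *[K] ((if i = 0 then \<one>\<^sub>R[D] else \<iota>) \<cdot> u))"
    using kock_lawvere_elements[OF spectrum_D J f] by blast
  show thesis
  proof (rule that[of "a 0" "a 1"])
    show "a 0 \<in> Hom E J Rb" "a 1 \<in> Hom E J Rb" using a by simp_all
    fix K h d assume h: "h \<in> Hom E K J" and d: "d \<in> Nsq K"
    have K: "K \<in> Ob E" using h hom_ob by blast
    interpret cring "RR K" using K by (rule ring_at_cring)
    have ah: "a 0 \<cdot> h \<in> Hom E K Rb" "a 1 \<cdot> h \<in> Hom E K Rb" using a h cmp_hom by auto
    show "f \<cdot> \<langle>h, el d\<rangle> = a 0 \<cdot> h +[K] (a 1 \<cdot> h) *[K] d"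
      unfolding e[rule_format, OF h D_elem_hom[OF d]]
      using K ah nilsq_hom[OF d] ring_one_cmp[OF D_elem_hom[OF d]] D_incl_elem[OF d]
      by (subst finsum_atMost(1)) simp_all
  qed
qed

lemma kock_lawvere_D_unique:
  assumes J: "J \<in> Ob E" and a: "a \<in> Hom E J Rb" "b \<in> Hom E J Rb" and b: "a' \<in> Hom E J Rb" "b' \<in> Hom E J Rb"
    and eq: "\<And>K h d. h \<in> Hom E K J \<Longrightarrow> d \<in> Nsq K \<Longrightarrow>
      a \<cdot> h +[K] (b \<cdot> h) *[K] d = a' \<cdot> h +[K] (b' \<cdot> h) *[K] d"
  shows "a = a'" "b = b'"
proof -
  have t: "(\<Oplus>\<^bsub>RR K\<^esub>i\<in>{..1::nat}. ((if i = 0 then p else q) \<cdot> h) *[K] ((if i = 0 then \<one>\<^sub>R[D] else \<iota>) \<cdot> u)) =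
      p \<cdot> h +[K] (q \<cdot> h) *[K] (\<iota> \<cdot> u)"
    if p: "p \<in> Hom E J Rb" and q: "q \<in> Hom E J Rb" and h: "h \<in> Hom E K J" and u: "u \<in> Hom E K D"
    for p q K h u
  proof -
    have K: "K \<in> Ob E" using h hom_ob by blast
    interpret cring "RR K" using K by (rule ring_at_cring)
    have "p \<cdot> h \<in> Hom E K Rb" "q \<cdot> h \<in> Hom E K Rb" "\<iota> \<cdot> u \<in> Hom E K Rb"
      using p q h u D_incl_hom cmp_hom by auto
    then show ?thesis
      using K ring_one_cmp[OF u]
      by (subst finsum_atMost(1)) simp_all
  qed
  have "(if i = 0 then a else b) = (if i = 0 then a' else b')" if "i \<le> 1" for i :: nat
    by (rule kock_lawvere_unique[OF spectrum_D J, where a = "\<lambda>i. if i = 0 then a else b"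
          and b = "\<lambda>i. if i = 0 then a' else b'"])
      (use a b t that eq nilsq_cmp[OF D_incl_nilsq] in auto)
  from this[of 0] this[of 1] show "a = a'" "b = b'" by simp_all
qed

text \<open>Index shift: \<open>D(2)\<close> has its two coordinates at 0 and 1, whereas in a Weil
  spectrum position 0 is taken by the unit and they move to 1 and 2.\<close>

lemma spectrum_D2:
  assumes S: "represents E R 2 (D2_point E R) S p"
  shows "weil_spectrum E R 2 (monomial_weil square_zero_mult) S
    (\<lambda>i. if i = 0 then \<one>\<^sub>R[S] else p (i - 1))"
  (is "weil_spectrum E R 2 ?c S ?x")
  unfolding weil_spectrum_def represents_def
proof (intro conjI ballI allI impI)
  have So: "S \<in> Ob E" and p: "p 0 \<in> Hom E S Rb" "p 1 \<in> Hom E S Rb" and pp: "D2_point E R S p"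
    using S by (simp_all add: represents_def)
  have less2: "(\<forall>i<2. Q i) \<longleftrightarrow> Q 0 \<and> Q (1::nat)"
    and less3: "(\<forall>i<Suc 2. Q i) \<longleftrightarrow> Q 0 \<and> Q 1 \<and> Q (2::nat)" for Q
    by (auto simp: eval_nat_numeral less_Suc_eq)
  have x: "?x i \<in> Hom E S Rb" if "i \<le> 2" for i
    using that So p by (auto simp: numeral_2_eq_2 le_Suc_eq)
  show "weil_algebra 2 ?c" by (rule weil_algebra_square_zero)
  show "S \<in> Ob E" by (rule So)
  show "?x i \<in> Hom E S Rb" if "i < Suc 2" for i using x that by simp
  show "weil_point E R 2 ?c S ?x"
    using pp by (subst weil_point_square_zero[OF x So]) (auto simp: D2_point_def)
  fix J y assume J: "J \<in> Ob E" and "(\<forall>i<Suc 2. y i \<in> Hom E J Rb) \<and> weil_point E R 2 ?c J y"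
  then have y: "\<And>i. i \<le> 2 \<Longrightarrow> y i \<in> Hom E J Rb" and w: "weil_point E R 2 ?c J y" by auto
  have y0: "y 0 = \<one>\<^sub>R[J]" and "D2_point E R J (\<lambda>i. y (Suc i))"
    using weil_point_square_zero[OF y J] w by (simp_all add: D2_point_def)
  then have "\<exists>!u. u \<in> Hom E J S \<and> (\<forall>i<2. p i \<cdot> u = y (Suc i))"
    using S J y by (auto simp: represents_def)
  moreover have "(u \<in> Hom E J S \<and> (\<forall>i<Suc 2. ?x i \<cdot> u = y i)) \<longleftrightarrow>
      (u \<in> Hom E J S \<and> (\<forall>i<2. p i \<cdot> u = y (Suc i)))" for u
    unfolding less2 less3 using ring_one_cmp[of u J S] y0 by (auto simp: numeral_2_eq_2)
  ultimately show "\<exists>!u. u \<in> Hom E J S \<and> (\<forall>i<Suc 2. ?x i \<cdot> u = y i)"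
    by simp
qed

definition bidual_coords :: "nat \<Rightarrow> 'm" where
  "bidual_coords i = (let S = Prd E D D; x = \<iota> \<cdot> Pr1 E D D; y = \<iota> \<cdot> Pr2 E D D in
     if i = 0 then \<one>\<^sub>R[S] else if i = 1 then x else if i = 2 then y else x *[S] y)"

lemma DD_elem_unique:
  assumes "a \<in> Nsq K" "b \<in> Nsq K"
  shows "u \<in> Hom E K (Prd E D D) \<and> (\<iota> \<cdot> Pr1 E D D) \<cdot> u = a \<and> (\<iota> \<cdot> Pr2 E D D) \<cdot> u = b \<longleftrightarrow>
    u = \<langle>el a, el b\<rangle>"
proof
  note p = pr1_hom[OF D_ob D_ob] pr2_hom[OF D_ob D_ob]
  assume u: "u \<in> Hom E K (Prd E D D) \<and> (\<iota> \<cdot> Pr1 E D D) \<cdot> u = a \<and> (\<iota> \<cdot> Pr2 E D D) \<cdot> u = b"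
  then have uh: "u \<in> Hom E K (Prd E D D)" by blast
  have "el a = Pr1 E D D \<cdot> u" "el b = Pr2 E D D \<cdot> u"
    using u cmp_assoc[OF uh p(1) D_incl_hom] cmp_assoc[OF uh p(2) D_incl_hom]
    by (auto intro: D_elem_eqI[OF cmp_hom[OF uh p(1)]] D_elem_eqI[OF cmp_hom[OF uh p(2)]])
  then show "u = \<langle>el a, el b\<rangle>" using tup_unique[OF D_ob D_ob uh] by simp
next
  note p = pr1_hom[OF D_ob D_ob] pr2_hom[OF D_ob D_ob]
  assume "u = \<langle>el a, el b\<rangle>"
  moreover have t: "\<langle>el a, el b\<rangle> \<in> Hom E K (Prd E D D)"
    using assms D_elem_hom tup_hom by blast
  ultimately show "u \<in> Hom E K (Prd E D D) \<and> (\<iota> \<cdot> Pr1 E D D) \<cdot> u = a \<and> (\<iota> \<cdot> Pr2 E D D) \<cdot> u = b"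
    using cmp_assoc[OF t p(1) D_incl_hom] cmp_assoc[OF t p(2) D_incl_hom]
      pr1_tup[OF D_elem_hom D_elem_hom] pr2_tup[OF D_elem_hom D_elem_hom] D_incl_elem assms by simp
qed

lemma bidual_coords_hom: "bidual_coords i \<in> Hom E (Prd E D D) Rb"
  using prd_ob[OF D_ob D_ob] cmp_hom[OF pr1_hom[OF D_ob D_ob] D_incl_hom]
    cmp_hom[OF pr2_hom[OF D_ob D_ob] D_incl_hom]
  by (simp add: bidual_coords_def Let_def)

lemma bidual_coords_tup:
  assumes a: "a \<in> Nsq K" and b: "b \<in> Nsq K"
  shows "bidual_coords 0 \<cdot> \<langle>el a, el b\<rangle> = \<one>\<^sub>R[K]" "bidual_coords 1 \<cdot> \<langle>el a, el b\<rangle> = a"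
    "bidual_coords 2 \<cdot> \<langle>el a, el b\<rangle> = b" "bidual_coords 3 \<cdot> \<langle>el a, el b\<rangle> = a *[K] b"
proof -
  note t = tup_hom[OF D_elem_hom[OF a] D_elem_hom[OF b]]
  note D = DD_elem_unique[OF assms, THEN iffD2, OF refl]
  show "bidual_coords 0 \<cdot> \<langle>el a, el b\<rangle> = \<one>\<^sub>R[K]"
    using ring_one_cmp[OF t] by (simp add: bidual_coords_def Let_def)
  show "bidual_coords 1 \<cdot> \<langle>el a, el b\<rangle> = a" "bidual_coords 2 \<cdot> \<langle>el a, el b\<rangle> = b"
    using D by (simp_all add: bidual_coords_def Let_def)
  show "bidual_coords 3 \<cdot> \<langle>el a, el b\<rangle> = a *[K] b"
    using D ring_mult_cmp[OF cmp_hom[OF pr1_hom[OF D_ob D_ob] D_incl_hom]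
        cmp_hom[OF pr2_hom[OF D_ob D_ob] D_incl_hom] t]
    by (simp add: bidual_coords_def Let_def)
qed

text \<open>Coordinate 3 of a point is forced to be the product of coordinates 1 and 2, so a point
  amounts to an arbitrary pair of nilsquare elements.\<close>

lemma spectrum_DD: "weil_spectrum E R 3 (monomial_weil bidual_mult) (Prd E D D) bidual_coords"
  (is "weil_spectrum E R 3 ?c ?S ?x")
  unfolding weil_spectrum_def represents_def
proof (intro conjI ballI allI impI)
  show "weil_algebra 3 ?c" by (rule weil_algebra_bidual)
  show S: "?S \<in> Ob E" by (simp add: prd_ob)
  show "?x i \<in> Hom E ?S Rb" for i by (rule bidual_coords_hom)
  show "weil_point E R 3 ?c ?S ?x"
    using nilsq_cmp[OF D_incl_nilsq pr1_hom[OF D_ob D_ob]] nilsq_cmp[OF D_incl_nilsq pr2_hom[OF D_ob D_ob]]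
    by (subst weil_point_bidual[OF bidual_coords_hom S]) (simp add: bidual_coords_def Let_def)
  fix J y assume J: "J \<in> Ob E" and "(\<forall>i<Suc 3. y i \<in> Hom E J Rb) \<and> weil_point E R 3 ?c J y"
  then have y: "\<And>i. i \<le> 3 \<Longrightarrow> y i \<in> Hom E J Rb" and w: "weil_point E R 3 ?c J y" by auto
  have w': "y 0 = \<one>\<^sub>R[J]" "y 1 \<in> Nsq J" "y 2 \<in> Nsq J" "y 3 = y 1 *[J] y 2"
    using w weil_point_bidual[OF y J] by simp_all
  have "(u \<in> Hom E J ?S \<and> (\<forall>i<Suc 3. ?x i \<cdot> u = y i)) \<longleftrightarrow> u = \<langle>el (y 1), el (y 2)\<rangle>" for u
  proof
    assume u: "u \<in> Hom E J ?S \<and> (\<forall>i<Suc 3. ?x i \<cdot> u = y i)"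
    then have "?x 1 \<cdot> u = y 1" "?x 2 \<cdot> u = y 2" by simp_all
    then have "(\<iota> \<cdot> Pr1 E D D) \<cdot> u = y 1" "(\<iota> \<cdot> Pr2 E D D) \<cdot> u = y 2"
      by (simp_all add: bidual_coords_def Let_def)
    then show "u = \<langle>el (y 1), el (y 2)\<rangle>"
      using DD_elem_unique[OF w'(2,3)] u by blast
  next
    assume u: "u = \<langle>el (y 1), el (y 2)\<rangle>"
    have less4: "(\<forall>i<Suc 3. Q i) \<longleftrightarrow> Q 0 \<and> Q 1 \<and> Q 2 \<and> Q (3::nat)" for Q
      by (auto simp: eval_nat_numeral less_Suc_eq)
    show "u \<in> Hom E J ?S \<and> (\<forall>i<Suc 3. ?x i \<cdot> u = y i)"
      unfolding less4 u using bidual_coords_tup[OF w'(2,3)] w'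
        tup_hom[OF D_elem_hom[OF w'(2)] D_elem_hom[OF w'(3)]] by simp
  qed
  then show "\<exists>!u. u \<in> Hom E J ?S \<and> (\<forall>i<Suc 3. ?x i \<cdot> u = y i)"
    by simp
qed

text \<open>Constructed as the equalizer of the product and zero inside \<open>D x D\<close>. The
  definition of \<open>tadd\<close> speaks of some representing object, so one has to be
  exhibited.\<close>

lemma D2_representable:
  obtains S p where "represents E R 2 (D2_point E R) S p"
proof -
  let ?P = "Prd E D D" and ?a = "\<iota> \<cdot> Pr1 E D D" and ?b = "\<iota> \<cdot> Pr2 E D D"
  have P: "?P \<in> Ob E" by (simp add: prd_ob)
  have ah: "?a \<in> Hom E ?P Rb" and bh: "?b \<in> Hom E ?P Rb"
    using cmp_hom[OF pr1_hom[OF D_ob D_ob] D_incl_hom] cmp_hom[OF pr2_hom[OF D_ob D_ob] D_incl_hom] by blast+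
  have an: "?a \<in> Nsq ?P" and bn: "?b \<in> Nsq ?P"
    using nilsq_cmp[OF D_incl_nilsq pr1_hom[OF D_ob D_ob]] nilsq_cmp[OF D_incl_nilsq pr2_hom[OF D_ob D_ob]]
    by blast+
  let ?ab = "?a *[?P] ?b" and ?z = "\<zero>[?P]"
  have abh: "?ab \<in> Hom E ?P Rb" and zh: "?z \<in> Hom E ?P Rb" using P ah bh by simp_all
  define e where "e = Eqz E ?ab ?z"
  define S where "S = Dom E e"
  have e: "e \<in> Hom E S ?P" unfolding S_def e_def by (rule eqz_hom[OF abh zh])
  have S: "S \<in> Ob E" using e hom_ob by blast
  interpret S: cring "RR S" using S by (rule ring_at_cring)
  have eq: "(?a \<cdot> e) *[S] (?b \<cdot> e) = \<zero>[S]"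
    using eqz_eq[OF abh zh] ring_mult_cmp[OF ah bh e] ring_zero_cmp[OF e] by (simp add: e_def)
  define p where "p i = (if i = 0 then ?a else ?b) \<cdot> e" for i :: nat
  have p: "p i \<in> Hom E S Rb" for i using e ah bh cmp_hom by (simp add: p_def)
  have less2: "(\<forall>i<2. Q i) \<longleftrightarrow> Q 0 \<and> Q (1::nat)" for Q
    by (auto simp: eval_nat_numeral less_Suc_eq)
  have "represents E R 2 (D2_point E R) S p"
    unfolding represents_def
  proof (intro conjI allI ballI impI)
    show "D2_point E R S p"
      using eq nilsq_square[OF nilsq_cmp[OF an e]] nilsq_square[OF nilsq_cmp[OF bn e]]
        S.m_comm[of "?a \<cdot> e" "?b \<cdot> e"] p[of 0] p[of 1]
      by (simp add: D2_point_def less2 p_def)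
    fix J y assume J: "J \<in> Ob E" and "(\<forall>i<2. y i \<in> Hom E J Rb) \<and> D2_point E R J y"
    then have y: "y 0 \<in> Nsq J" "y 1 \<in> Nsq J" and y01: "y 0 *[J] y 1 = \<zero>[J]"
      by (simp_all add: D2_point_def less2 nilsq_def)
    have h: "\<langle>el (y 0), el (y 1)\<rangle> \<in> Hom E J ?P"
      using y D_elem_hom tup_hom by blast
    have iff: "(u \<in> Hom E J S \<and> (\<forall>i<2. p i \<cdot> u = y i)) \<longleftrightarrow> (u \<in> Hom E J S \<and> e \<cdot> u = \<langle>el (y 0), el (y 1)\<rangle>)" for u
      using DD_elem_unique[OF y, of "e \<cdot> u"] cmp_hom[of u J S e ?P] e
        cmp_assoc[of u J S e ?P ?a Rb] cmp_assoc[of u J S e ?P ?b Rb] ah bh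
      by (auto simp: less2 p_def)
    have "?ab \<cdot> \<langle>el (y 0), el (y 1)\<rangle> = ?z \<cdot> \<langle>el (y 0), el (y 1)\<rangle>"
      using ring_mult_cmp[OF ah bh h] ring_zero_cmp[OF h] DD_elem_unique[OF y, THEN iffD2, OF refl] y01
      by simp
    from eqz_universal[OF abh zh h this]
    show "\<exists>!u. u \<in> Hom E J S \<and> (\<forall>i<2. p i \<cdot> u = y i)"
      unfolding iff by (simp add: e_def S_def)
  qed (rule S, rule p)
  then show thesis by (rule that)
qed

lemma D2_elem:
  assumes S: "represents E R 2 (D2_point E R) S p"
    and "a \<in> Nsq K" "b \<in> Nsq K" "a *[K] b = \<zero>[K]"
  shows "\<exists>!u. u \<in> Hom E K S \<and> p 0 \<cdot> u = a \<and> p 1 \<cdot> u = b"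
proof -
  have K: "K \<in> Ob E" using assms nilsq_ob by blast
  interpret cring "RR K" using K by (rule ring_at_cring)
  have less2: "(\<forall>i<2. Q i) \<longleftrightarrow> Q 0 \<and> Q (1::nat)" for Q
    by (auto simp: eval_nat_numeral less_Suc_eq)
  let ?y = "\<lambda>i::nat. if i = 0 then a else b"
  have "D2_point E R K ?y"
    using assms nilsq_square m_comm[of a b] nilsq_hom by (simp add: D2_point_def less2)
  moreover have "\<forall>i<2. ?y i \<in> Hom E K Rb" using assms nilsq_hom by simp
  ultimately have "\<exists>!u. u \<in> Hom E K S \<and> (\<forall>i<2. p i \<cdot> u = ?y i)"
    using S K by (simp add: represents_def)
  then show ?thesis by (simp add: less2)
qed

section \<open>Quasi-colimits perceived by the group\<close>

text \<open>The constant map of \<open>D\<close> to itself at zero. It does the work of a base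
  point: gluing two copies of \<open>D\<close> along it identifies their origins, with
  \<open>D\<close> as the gluing object.\<close>

abbreviation "zD \<equiv> el \<zero>[D]"

lemma zD_hom: "zD \<in> Hom E D D"
  using D_elem_hom[OF zero_nilsq[OF D_ob]] .

lemma zD_cmp: "v \<in> Hom E K D \<Longrightarrow> zD \<cdot> v = el \<zero>[K]"
  using D_elem_cmp[OF zero_nilsq[OF D_ob]] ring_zero_cmp by simp

text \<open>Index 0 stands for the origin, 1 and 2 for the axes. The last two equations are the edge
  conditions of the cocone: both axes pass through the same origin.\<close>

lemma D2_axes:
  assumes S: "represents E R 2 (D2_point E R) S p"
  obtains c where "\<And>i. c i \<in> Hom E D S"
    and "p 0 \<cdot> c 0 = \<zero>[D]" "p 1 \<cdot> c 0 = \<zero>[D]"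
    and "p 0 \<cdot> c 1 = \<iota>" "p 1 \<cdot> c 1 = \<zero>[D]"
    and "p 0 \<cdot> c (2::nat) = \<zero>[D]" "p 1 \<cdot> c 2 = \<iota>"
    and "c 1 \<cdot> zD = c 0" "c 2 \<cdot> zD = c 0"
proof -
  have z: "\<zero>[D] \<in> Nsq D" and zh: "\<zero>[D] \<in> Hom E D Rb"
    using zero_nilsq by simp_all
  have p: "p 0 \<in> Hom E S Rb" "p 1 \<in> Hom E S Rb" using S by (simp_all add: represents_def)
  obtain c0 where c0: "c0 \<in> Hom E D S" "p 0 \<cdot> c0 = \<zero>[D]" "p 1 \<cdot> c0 = \<zero>[D]"
    using D2_elem[OF S z z] zh by auto
  have u0: "v = c0" if "v \<in> Hom E D S" "p 0 \<cdot> v = \<zero>[D]" "p 1 \<cdot> v = \<zero>[D]" for v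
    using D2_elem[OF S z z] zh c0 that by auto
  obtain c1 where c1: "c1 \<in> Hom E D S" "p 0 \<cdot> c1 = \<iota>" "p 1 \<cdot> c1 = \<zero>[D]"
    using D2_elem[OF S D_incl_nilsq z] D_incl_hom by auto
  obtain c2 where c2: "c2 \<in> Hom E D S" "p 0 \<cdot> c2 = \<zero>[D]" "p 1 \<cdot> c2 = \<iota>"
    using D2_elem[OF S z D_incl_nilsq] D_incl_hom by auto
  have "c1 \<cdot> zD = c0"
    using u0[OF cmp_hom[OF zD_hom c1(1)]] cmp_assoc[OF zD_hom c1(1) p(1)] cmp_assoc[OF zD_hom c1(1) p(2)]
      c1 D_incl_elem[OF z] ring_zero_cmp[OF zD_hom] by simp
  moreover have "c2 \<cdot> zD = c0"
    using u0[OF cmp_hom[OF zD_hom c2(1)]] cmp_assoc[OF zD_hom c2(1) p(1)] cmp_assoc[OF zD_hom c2(1) p(2)]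
      c2 D_incl_elem[OF z] ring_zero_cmp[OF zD_hom] by simp
  ultimately show thesis
    using that[of "\<lambda>i. if i = 0 then c0 else if i = 1 then c1 else c2"] c0 c1 c2 by simp
qed

lemma D2_axes_elem:
  assumes "p \<in> Hom E S Rb" "c \<in> Hom E D S" "p \<cdot> c = q" "v \<in> Hom E K D"
  shows "p \<cdot> (c \<cdot> v) = q \<cdot> v"
  using cmp_assoc[OF assms(4,2,1)] assms(3) by simp

text \<open>On the axes a function has the form \<open>a + b d\<close>, respectively
  \<open>a' + b' d\<close>. Compatibility at the origin gives \<open>a = a'\<close>, and
  \<open>a + b p + b' q\<close> is the only extension to \<open>D(2)\<close>, where every function
  is affine.\<close>

lemma D2_perceived_by_line:
  assumes S: "represents E R 2 (D2_point E R) S p"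
    and c: "\<And>i. c i \<in> Hom E D S"
    and pc: "p 0 \<cdot> c 0 = \<zero>[D]" "p 1 \<cdot> c 0 = \<zero>[D]"
      "p 0 \<cdot> c 1 = \<iota>" "p 1 \<cdot> c 1 = \<zero>[D]"
      "p 0 \<cdot> c (2::nat) = \<zero>[D]" "p 1 \<cdot> c 2 = \<iota>"
  shows "perceives_colimit E Rb {0, 1, 2} (\<lambda>_. D) {(0, zD, 1), (0, zD, 2)} S c"
  unfolding perceives_colimit_def
proof (intro ballI allI impI)
  fix J and \<phi> :: "nat \<Rightarrow> 'm" assume J: "J \<in> Ob E"
    and "(\<forall>i\<in>{0, 1, 2}. \<phi> i \<in> Hom E (Prd E J D) Rb) \<and>
      (\<forall>(i, u, j)\<in>{(0, zD, 1), (0, zD, 2)}. \<phi> j \<cdot> stage_times E J u = \<phi> i)"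
  then have \<phi>: "\<phi> 0 \<in> Hom E (Prd E J D) Rb" "\<phi> 1 \<in> Hom E (Prd E J D) Rb" "\<phi> 2 \<in> Hom E (Prd E J D) Rb"
    and e1: "\<phi> 1 \<cdot> stage_times E J zD = \<phi> 0" and e2: "\<phi> 2 \<cdot> stage_times E J zD = \<phi> 0" by auto
  have So: "S \<in> Ob E" and p: "p 0 \<in> Hom E S Rb" "p 1 \<in> Hom E S Rb"
    using S by (simp_all add: represents_def)
  obtain a b where ab: "a \<in> Hom E J Rb" "b \<in> Hom E J Rb" and
    f1: "\<And>K h d. h \<in> Hom E K J \<Longrightarrow> d \<in> Nsq K \<Longrightarrow> \<phi> 1 \<cdot> \<langle>h, el d\<rangle> = a \<cdot> h +[K] (b \<cdot> h) *[K] d"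
    using kock_lawvere_D[OF J \<phi>(2)] by metis
  obtain a' b' where ab': "a' \<in> Hom E J Rb" "b' \<in> Hom E J Rb" and
    f2: "\<And>K h d. h \<in> Hom E K J \<Longrightarrow> d \<in> Nsq K \<Longrightarrow> \<phi> 2 \<cdot> \<langle>h, el d\<rangle> = a' \<cdot> h +[K] (b' \<cdot> h) *[K] d"
    using kock_lawvere_D[OF J \<phi>(3)] by metis
  have z1: "a \<cdot> h = \<phi> 0 \<cdot> \<langle>h, v\<rangle>" and z2: "a' \<cdot> h = \<phi> 0 \<cdot> \<langle>h, v\<rangle>"
    if h: "h \<in> Hom E K J" and v: "v \<in> Hom E K D" for K h v
  proof -
    have K: "K \<in> Ob E" using h hom_ob by blast
    have m: "a \<cdot> h \<in> Hom E K Rb" "b \<cdot> h \<in> Hom E K Rb" "a' \<cdot> h \<in> Hom E K Rb" "b' \<cdot> h \<in> Hom E K Rb"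
      using ab ab' h cmp_hom by blast+
    show "a \<cdot> h = \<phi> 0 \<cdot> \<langle>h, v\<rangle>" "a' \<cdot> h = \<phi> 0 \<cdot> \<langle>h, v\<rangle>"
      using stage_times_tup[OF \<phi>(2) zD_hom h v] stage_times_tup[OF \<phi>(3) zD_hom h v] e1 e2
        zD_cmp[OF v] f1[OF h zero_nilsq[OF K]] f2[OF h zero_nilsq[OF K]] m by simp_all
  qed
  have aa: "a' = a"
    using z1[OF idt_hom[OF J] D_elem_hom[OF zero_nilsq[OF J]]]
      z2[OF idt_hom[OF J] D_elem_hom[OF zero_nilsq[OF J]]] idt_right[OF ab(1)] idt_right[OF ab'(1)] by simp
  let ?P = "Prd E J S"
  have P: "?P \<in> Ob E" using J So prd_ob by blast
  note q1 = pr1_hom[OF J So] and q2 = pr2_hom[OF J So]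
  define \<psi> where "\<psi> = (a \<cdot> Pr1 E J S) +[?P] (b \<cdot> Pr1 E J S) *[?P] (p 0 \<cdot> Pr2 E J S)
      +[?P] (b' \<cdot> Pr1 E J S) *[?P] (p 1 \<cdot> Pr2 E J S)"
  have m: "a \<cdot> Pr1 E J S \<in> Hom E ?P Rb" "b \<cdot> Pr1 E J S \<in> Hom E ?P Rb" "b' \<cdot> Pr1 E J S \<in> Hom E ?P Rb"
    "p 0 \<cdot> Pr2 E J S \<in> Hom E ?P Rb" "p 1 \<cdot> Pr2 E J S \<in> Hom E ?P Rb"
    using ab ab' p q1 q2 cmp_hom by blast+
  have \<psi>: "\<psi> \<in> Hom E ?P Rb" unfolding \<psi>_def using m P by simp
  have \<psi>e: "\<psi> \<cdot> \<langle>h, u\<rangle> = a \<cdot> h +[K] (b \<cdot> h) *[K] (p 0 \<cdot> u) +[K] (b' \<cdot> h) *[K] (p 1 \<cdot> u)"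
    if h: "h \<in> Hom E K J" and u: "u \<in> Hom E K S" for K h u
  proof -
    note t = tup_hom[OF h u]
    show ?thesis
      unfolding \<psi>_def using m P
        cmp_assoc[OF t q1 ab(1)] cmp_assoc[OF t q1 ab(2)] cmp_assoc[OF t q1 ab'(2)]
        cmp_assoc[OF t q2 p(1)] cmp_assoc[OF t q2 p(2)] pr1_tup[OF h u] pr2_tup[OF h u]
      by (simp add: ring_add_cmp[OF _ _ t] ring_mult_cmp[OF _ _ t])
  qed
  have on_axes: "a0 \<cdot> h +[K] (a1 \<cdot> h) *[K] (p 0 \<cdot> (c i \<cdot> v)) +[K] (a2 \<cdot> h) *[K] (p 1 \<cdot> (c i \<cdot> v)) =
      (if i = 0 then a0 \<cdot> h else a0 \<cdot> h +[K] ((if i = 1 then a1 else a2) \<cdot> h) *[K] (\<iota> \<cdot> v))"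
    if "a0 \<in> Hom E J Rb" "a1 \<in> Hom E J Rb" "a2 \<in> Hom E J Rb" "h \<in> Hom E K J" "v \<in> Hom E K D" "i \<in> {0, 1, 2}"
    for a0 a1 a2 K h v i
  proof -
    have K: "K \<in> Ob E" using that hom_ob by blast
    have "a0 \<cdot> h \<in> Hom E K Rb" "a1 \<cdot> h \<in> Hom E K Rb" "a2 \<cdot> h \<in> Hom E K Rb" "\<iota> \<cdot> v \<in> Hom E K Rb"
      using that D_incl_hom cmp_hom by blast+
    then show ?thesis
      using that(6) K D2_axes_elem[OF p(1) c pc(1) that(5)] D2_axes_elem[OF p(2) c pc(2) that(5)]
        D2_axes_elem[OF p(1) c pc(3) that(5)] D2_axes_elem[OF p(2) c pc(4) that(5)]
        D2_axes_elem[OF p(1) c pc(5) that(5)] D2_axes_elem[OF p(2) c pc(6) that(5)]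
        ring_zero_cmp[OF that(5)]
      by auto
  qed
  show "\<exists>!\<psi>. \<psi> \<in> Hom E (Prd E J S) Rb \<and> (\<forall>i\<in>{0, 1, 2 :: nat}. \<psi> \<cdot> stage_times E J (c i) = \<phi> i)"
  proof (rule ex1I[of _ \<psi>])
    have "\<psi> \<cdot> stage_times E J (c i) = \<phi> i" if i: "i \<in> {0, 1, 2}" for i
    proof -
      have \<phi>i: "\<phi> i \<in> Hom E (Prd E J D) Rb" using i \<phi> by auto
      show ?thesis
        unfolding stage_times_eq_iff[OF J \<psi> c \<phi>i]
      proof (intro allI ballI)
        fix K h v assume h: "h \<in> Hom E K J" and v: "v \<in> Hom E K D"
        have "\<phi> i \<cdot> \<langle>h, v\<rangle> = \<psi> \<cdot> \<langle>h, c i \<cdot> v\<rangle>"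
          unfolding \<psi>e[OF h cmp_hom[OF v c]] on_axes[OF ab ab'(2) h v i]
          using i f1[OF h nilsq_cmp[OF D_incl_nilsq v]] f2[OF h nilsq_cmp[OF D_incl_nilsq v]]
            D_elem_eqI[OF v refl] z1[OF h v] aa by auto
        then show "\<psi> \<cdot> \<langle>h, c i \<cdot> v\<rangle> = \<phi> i \<cdot> \<langle>h, v\<rangle>" by simp
      qed
    qed
    with \<psi> show "\<psi> \<in> Hom E (Prd E J S) Rb \<and> (\<forall>i\<in>{0, 1, 2}. \<psi> \<cdot> stage_times E J (c i) = \<phi> i)" by blast
  next
    fix \<chi> assume \<chi>': "\<chi> \<in> Hom E (Prd E J S) Rb \<and> (\<forall>i\<in>{0, 1, 2}. \<chi> \<cdot> stage_times E J (c i) = \<phi> i)"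
    then have \<chi>: "\<chi> \<in> Hom E (Prd E J S) Rb" by blast
    \<comment> \<open>A competitor is affine on \<open>D(2)\<close> too; its three coefficients are
      recovered from its restrictions to the axes by uniqueness on \<open>D\<close>.\<close>
    obtain k :: "nat \<Rightarrow> 'm" where k: "\<forall>i\<le>2. k i \<in> Hom E J Rb" and
      ke: "\<forall>K. \<forall>h \<in> Hom E K J. \<forall>u \<in> Hom E K S. \<chi> \<cdot> \<langle>h, u\<rangle> =
        (\<Oplus>\<^bsub>RR K\<^esub>i\<in>{..2}. (k i \<cdot> h) *[K] ((if i = 0 then \<one>\<^sub>R[S] else p (i - 1)) \<cdot> u))"
      using kock_lawvere_elements[OF spectrum_D2[OF S] J \<chi>] by blast
    have kh: "k 0 \<in> Hom E J Rb" "k 1 \<in> Hom E J Rb" "k 2 \<in> Hom E J Rb" using k by auto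
    have \<chi>e: "\<chi> \<cdot> \<langle>h, u\<rangle> = k 0 \<cdot> h +[K] (k 1 \<cdot> h) *[K] (p 0 \<cdot> u) +[K] (k 2 \<cdot> h) *[K] (p 1 \<cdot> u)"
      if h: "h \<in> Hom E K J" and u: "u \<in> Hom E K S" for K h u
    proof -
      have K: "K \<in> Ob E" using h hom_ob by blast
      have "k 0 \<cdot> h \<in> Hom E K Rb" "k 1 \<cdot> h \<in> Hom E K Rb" "k 2 \<cdot> h \<in> Hom E K Rb"
        "p 0 \<cdot> u \<in> Hom E K Rb" "p 1 \<cdot> u \<in> Hom E K Rb"
        using kh h u p cmp_hom by blast+
      then show ?thesis
        unfolding ke[rule_format, OF h u] using K ring_one_cmp[OF u]
        by (subst finsum_atMost(2)) simp_all
    qed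
    have eq: "\<chi> \<cdot> \<langle>h, c i \<cdot> v\<rangle> = \<psi> \<cdot> \<langle>h, c i \<cdot> v\<rangle>"
      if h: "h \<in> Hom E K J" and v: "v \<in> Hom E K D" and i: "i \<in> {1, 2}" for K h v i
    proof -
      have \<phi>i: "\<phi> i \<in> Hom E (Prd E J D) Rb" using i \<phi> by auto
      have "\<chi> \<cdot> \<langle>h, c i \<cdot> v\<rangle> = \<phi> i \<cdot> \<langle>h, v\<rangle>"
        using \<chi>' i stage_times_eq_iff[OF J \<chi> c \<phi>i] h v by blast
      also have "\<dots> = \<psi> \<cdot> \<langle>h, c i \<cdot> v\<rangle>"
        unfolding \<psi>e[OF h cmp_hom[OF v c]]
        using i on_axes[OF ab ab'(2) h v, of i] f1[OF h nilsq_cmp[OF D_incl_nilsq v]]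
          f2[OF h nilsq_cmp[OF D_incl_nilsq v]] D_elem_eqI[OF v refl] aa by auto
      finally show ?thesis .
    qed
    have 1: "k 0 \<cdot> h +[K] (k 1 \<cdot> h) *[K] d = a \<cdot> h +[K] (b \<cdot> h) *[K] d"
      and 2: "k 0 \<cdot> h +[K] (k 2 \<cdot> h) *[K] d = a \<cdot> h +[K] (b' \<cdot> h) *[K] d"
      if h: "h \<in> Hom E K J" and d: "d \<in> Nsq K" for K h d
    proof -
      note v = D_elem_hom[OF d]
      show "k 0 \<cdot> h +[K] (k 1 \<cdot> h) *[K] d = a \<cdot> h +[K] (b \<cdot> h) *[K] d"
        using eq[OF h v, of 1] \<psi>e[OF h cmp_hom[OF v c]] \<chi>e[OF h cmp_hom[OF v c]] on_axes[OF kh h v, of 1]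
          on_axes[OF ab ab'(2) h v, of 1] D_incl_elem[OF d] by simp
      show "k 0 \<cdot> h +[K] (k 2 \<cdot> h) *[K] d = a \<cdot> h +[K] (b' \<cdot> h) *[K] d"
        using eq[OF h v, of 2] \<psi>e[OF h cmp_hom[OF v c]] \<chi>e[OF h cmp_hom[OF v c]] on_axes[OF kh h v, of 2]
          on_axes[OF ab ab'(2) h v, of 2] D_incl_elem[OF d] by simp
    qed
    have "k 0 = a" "k 1 = b" "k 2 = b'"
      using kock_lawvere_D_unique[OF J kh(1,2) ab 1] kock_lawvere_D_unique[OF J kh(1,3) ab(1) ab'(2) 2] by auto
    then show "\<chi> = \<psi>"
      by (intro prd_hom_ext[OF J So \<chi> \<psi>]) (simp add: \<chi>e \<psi>e)
  qed
qed

text \<open>Microlinearity transfers the quasi-colimit from the line to the group. Only the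
  uniqueness half is extracted: the legs of the cone are those of \<open>l\<close> itself.\<close>

lemma D2_ext:
  assumes S: "represents E R 2 (D2_point E R) S p" and J: "J \<in> Ob E"
    and l: "l \<in> Hom E (Prd E J S) Gb" and l': "l' \<in> Hom E (Prd E J S) Gb"
    and eq: "\<And>K f u. f \<in> Hom E K J \<Longrightarrow> u \<in> Hom E K S \<Longrightarrow>
      p 0 \<cdot> u = \<zero>[K] \<or> p 1 \<cdot> u = \<zero>[K] \<Longrightarrow> l \<cdot> \<langle>f, u\<rangle> = l' \<cdot> \<langle>f, u\<rangle>"
  shows "l = l'"
proof -
  have p: "p 0 \<in> Hom E S Rb" "p 1 \<in> Hom E S Rb" using S by (simp_all add: represents_def)
  obtain c where c: "\<And>i. c i \<in> Hom E D S" and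
    pc: "p 0 \<cdot> c 0 = \<zero>[D]" "p 1 \<cdot> c 0 = \<zero>[D]" "p 0 \<cdot> c 1 = \<iota>" "p 1 \<cdot> c 1 = \<zero>[D]"
      "p 0 \<cdot> c (2::nat) = \<zero>[D]" "p 1 \<cdot> c 2 = \<iota>"
    and cz: "c 1 \<cdot> zD = c 0" "c 2 \<cdot> zD = c 0"
    using D2_axes[OF S] by blast
  have "infinitesimal_cocone E R {0, 1, 2} (\<lambda>_. D) {(0, zD, 1), (0, zD, 2)} S c"
    unfolding infinitesimal_cocone_def using spectrum_D spectrum_D2[OF S] zD_hom c cz by auto
  then have "perceives_colimit E Gb {0, 1, 2} (\<lambda>_. D) {(0, zD, 1), (0, zD, 2)} S c"
    using lie_group D2_perceived_by_line[OF S c pc] unfolding lie_group_def microlinear_def by blast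
  note * = this[unfolded perceives_colimit_def, rule_format, OF J, of "\<lambda>i. l \<cdot> stage_times E J (c i)"]
  have lc: "l \<cdot> stage_times E J (c i) \<in> Hom E (Prd E J D) Gb" for i
    using cmp_hom[OF stage_times_hom[OF J c] l] .
  have lz: "(l \<cdot> stage_times E J (c i)) \<cdot> stage_times E J zD = l \<cdot> stage_times E J (c 0)" if "i \<in> {1, 2}" for i
    using that cz by (auto simp: stage_times_stage_times[OF J l c zD_hom])
  have "\<exists>!\<psi>. \<psi> \<in> Hom E (Prd E J S) Gb \<and> (\<forall>i\<in>{0, 1, 2}. \<psi> \<cdot> stage_times E J (c i) = l \<cdot> stage_times E J (c i))"
    by (rule *) (use lc lz in auto)
  moreover have "l' \<cdot> stage_times E J (c i) = l \<cdot> stage_times E J (c i)" if i: "i \<in> {0, 1, 2}" for i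
    unfolding stage_times_eq_iff[OF J l' c lc] stage_times_tup[OF l c]
  proof (intro allI ballI)
    fix K h v assume h: "h \<in> Hom E K J" and v: "v \<in> Hom E K D"
    have "p 0 \<cdot> (c i \<cdot> v) = \<zero>[K] \<or> p 1 \<cdot> (c i \<cdot> v) = \<zero>[K]"
      using i D2_axes_elem[OF p(1) c pc(1) v] D2_axes_elem[OF p(2) c pc(4) v] D2_axes_elem[OF p(1) c pc(5) v]
        ring_zero_cmp[OF v] by auto
    from eq[OF h cmp_hom[OF v c] this]
    show "l' \<cdot> \<langle>h, c i \<cdot> v\<rangle> = (l \<cdot> stage_times E J (c i)) \<cdot> \<langle>h, v\<rangle>"
      using stage_times_tup[OF l c h v] by simp
  qed
  ultimately show ?thesis using l l' by blast
qed

text \<open>For natural families, evaluated at the generic point of some representing object, so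
  that applications can speak of nilsquare elements alone.\<close>

lemma D2_family_ext:
  assumes J: "J \<in> Ob E"
    and hom: "\<And>K f a b. f \<in> Hom E K J \<Longrightarrow> a \<in> Nsq K \<Longrightarrow> b \<in> Nsq K \<Longrightarrow> \<Phi> f a b \<in> Hom E K Gb"
    and hom': "\<And>K f a b. f \<in> Hom E K J \<Longrightarrow> a \<in> Nsq K \<Longrightarrow> b \<in> Nsq K \<Longrightarrow> \<Phi>' f a b \<in> Hom E K Gb"
    and nat: "\<And>K L f a b h. f \<in> Hom E K J \<Longrightarrow> a \<in> Nsq K \<Longrightarrow> b \<in> Nsq K \<Longrightarrow> h \<in> Hom E L K \<Longrightarrow>
      \<Phi> f a b \<cdot> h = \<Phi> (f \<cdot> h) (a \<cdot> h) (b \<cdot> h)"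
    and nat': "\<And>K L f a b h. f \<in> Hom E K J \<Longrightarrow> a \<in> Nsq K \<Longrightarrow> b \<in> Nsq K \<Longrightarrow> h \<in> Hom E L K \<Longrightarrow>
      \<Phi>' f a b \<cdot> h = \<Phi>' (f \<cdot> h) (a \<cdot> h) (b \<cdot> h)"
    and ax1: "\<And>K f a. f \<in> Hom E K J \<Longrightarrow> a \<in> Nsq K \<Longrightarrow> \<Phi> f a \<zero>[K] = \<Phi>' f a \<zero>[K]"
    and ax2: "\<And>K f b. f \<in> Hom E K J \<Longrightarrow> b \<in> Nsq K \<Longrightarrow> \<Phi> f \<zero>[K] b = \<Phi>' f \<zero>[K] b"
    and f: "f \<in> Hom E K J" and ab: "a \<in> Nsq K" "b \<in> Nsq K" "a *[K] b = \<zero>[K]"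
  shows "\<Phi> f a b = \<Phi>' f a b"
proof -
  obtain S p where S: "represents E R 2 (D2_point E R) S p" by (rule D2_representable)
  have So: "S \<in> Ob E" and p: "p 0 \<in> Nsq S" "p 1 \<in> Nsq S"
    using S by (auto simp: represents_def D2_point_def nilsq_def)
  have ph: "p 0 \<in> Hom E S Rb" "p 1 \<in> Hom E S Rb" using p nilsq_hom by blast+
  note q1 = pr1_hom[OF J So] and q2 = pr2_hom[OF J So]
  note pq = nilsq_cmp[OF p(1) q2] nilsq_cmp[OF p(2) q2]
  let ?l = "\<Phi> (Pr1 E J S) (p 0 \<cdot> Pr2 E J S) (p 1 \<cdot> Pr2 E J S)"
  let ?l' = "\<Phi>' (Pr1 E J S) (p 0 \<cdot> Pr2 E J S) (p 1 \<cdot> Pr2 E J S)"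
  have le: "?l \<cdot> \<langle>h, u\<rangle> = \<Phi> h (p 0 \<cdot> u) (p 1 \<cdot> u)" "?l' \<cdot> \<langle>h, u\<rangle> = \<Phi>' h (p 0 \<cdot> u) (p 1 \<cdot> u)"
    if h: "h \<in> Hom E K J" and u: "u \<in> Hom E K S" for K h u
    using nat[OF q1 pq tup_hom[OF h u]] nat'[OF q1 pq tup_hom[OF h u]] pr1_tup[OF h u] pr2_tup[OF h u]
      cmp_assoc[OF tup_hom[OF h u] q2 ph(1)] cmp_assoc[OF tup_hom[OF h u] q2 ph(2)] by simp_all
  have "?l = ?l'"
  proof (rule D2_ext[OF S J hom[OF q1 pq] hom'[OF q1 pq]])
    fix K h u assume h: "h \<in> Hom E K J" and u: "u \<in> Hom E K S"
      and z: "p 0 \<cdot> u = \<zero>[K] \<or> p 1 \<cdot> u = \<zero>[K]"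
    show "?l \<cdot> \<langle>h, u\<rangle> = ?l' \<cdot> \<langle>h, u\<rangle>"
      unfolding le[OF h u] using z ax1[OF h nilsq_cmp[OF p(1) u]] ax2[OF h nilsq_cmp[OF p(2) u]] by auto
  qed
  moreover obtain u where "u \<in> Hom E K S" "p 0 \<cdot> u = a" "p 1 \<cdot> u = b"
    using D2_elem[OF S ab] by blast
  ultimately show ?thesis using le[OF f] by metis
qed

section \<open>Maps on \<open>D x D\<close> that factor through multiplication\<close>

abbreviation "DD \<equiv> Prd E D D"

lemma DD_ob: "DD \<in> Ob E"
  by (simp add: prd_ob)

lemma DD_elemE:
  assumes v: "v \<in> Hom E K DD"
  obtains a b where "a \<in> Nsq K" "b \<in> Nsq K" "v = \<langle>el a, el b\<rangle>"
proof -
  note p = pr1_hom[OF D_ob D_ob] pr2_hom[OF D_ob D_ob]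
  show thesis
  proof (rule that)
    show "\<iota> \<cdot> (Pr1 E D D \<cdot> v) \<in> Nsq K" "\<iota> \<cdot> (Pr2 E D D \<cdot> v) \<in> Nsq K"
      using nilsq_cmp[OF D_incl_nilsq cmp_hom[OF v p(1)]] nilsq_cmp[OF D_incl_nilsq cmp_hom[OF v p(2)]] .
    show "v = \<langle>el (\<iota> \<cdot> (Pr1 E D D \<cdot> v)), el (\<iota> \<cdot> (Pr2 E D D \<cdot> v))\<rangle>"
      using D_elem_eqI[OF cmp_hom[OF v p(1)] refl] D_elem_eqI[OF cmp_hom[OF v p(2)] refl]
        tup_unique[OF D_ob D_ob v] by simp
  qed
qed

lemma kl_DD_sum:
  assumes k: "\<And>i. i \<le> 3 \<Longrightarrow> k i \<in> Hom E J Rb" and h: "h \<in> Hom E K J" and a: "a \<in> Nsq K" and b: "b \<in> Nsq K"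
  shows "(\<Oplus>\<^bsub>RR K\<^esub>i\<in>{..3::nat}. (k i \<cdot> h) *[K] (bidual_coords i \<cdot> \<langle>el a, el b\<rangle>)) =
    k 0 \<cdot> h +[K] (k 1 \<cdot> h) *[K] a +[K] (k 2 \<cdot> h) *[K] b +[K] (k 3 \<cdot> h) *[K] (a *[K] b)"
proof -
  have K: "K \<in> Ob E" using h hom_ob by blast
  have "k 0 \<cdot> h \<in> Hom E K Rb" "k 1 \<cdot> h \<in> Hom E K Rb" "k 2 \<cdot> h \<in> Hom E K Rb" "k 3 \<cdot> h \<in> Hom E K Rb"
    using k h cmp_hom by simp_all
  then show ?thesis
    by (subst finsum_atMost(3)[OF K])
      (simp_all only: bidual_coords_tup[OF a b] ring_units ring_closed K nilsq_hom[OF a] nilsq_hom[OF b])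
qed

lemma kock_lawvere_DD:
  assumes J: "J \<in> Ob E" and f: "f \<in> Hom E (Prd E J DD) Rb"
  shows "\<exists>k. (\<forall>i\<le>3. k i \<in> Hom E J Rb) \<and>
    (\<forall>K. \<forall>h \<in> Hom E K J. \<forall>a \<in> Nsq K. \<forall>b \<in> Nsq K. f \<cdot> \<langle>h, \<langle>el a, el b\<rangle>\<rangle> =
      k 0 \<cdot> h +[K] (k 1 \<cdot> h) *[K] a +[K] (k 2 \<cdot> h) *[K] b
        +[K] (k (3::nat) \<cdot> h) *[K] (a *[K] b))"
proof -
  obtain k :: "nat \<Rightarrow> 'm" where k: "\<forall>i\<le>3. k i \<in> Hom E J Rb" and
    e: "\<forall>K. \<forall>h \<in> Hom E K J. \<forall>u \<in> Hom E K DD. f \<cdot> \<langle>h, u\<rangle> =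
      (\<Oplus>\<^bsub>RR K\<^esub>i\<in>{..3}. (k i \<cdot> h) *[K] (bidual_coords i \<cdot> u))"
    using kock_lawvere_elements[OF spectrum_DD J f] by blast
  show ?thesis
  proof (intro exI[of _ k] conjI k allI ballI)
    fix K h a b assume h: "h \<in> Hom E K J" and a: "a \<in> Nsq K" and b: "b \<in> Nsq K"
    show "f \<cdot> \<langle>h, \<langle>el a, el b\<rangle>\<rangle> =
      k 0 \<cdot> h +[K] (k 1 \<cdot> h) *[K] a +[K] (k 2 \<cdot> h) *[K] b
        +[K] (k 3 \<cdot> h) *[K] (a *[K] b)"
      unfolding e[rule_format, OF h tup_hom[OF D_elem_hom[OF a] D_elem_hom[OF b]]]
      by (rule kl_DD_sum[OF _ h a b]) (use k in auto)
  qed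
qed

text \<open>Viewed on \<open>D x D\<close>, both sides have zero coefficients at \<open>d\<close>
  and at \<open>e\<close>; comparing all four coefficients there isolates the two in question. So
  products of nilsquare elements are enough to test an affine function.\<close>

lemma kock_lawvere_DD_unique:
  assumes J: "J \<in> Ob E" and h: "a \<in> Hom E J Rb" "b \<in> Hom E J Rb" "a' \<in> Hom E J Rb" "b' \<in> Hom E J Rb"
    and eq: "\<And>K h d e. h \<in> Hom E K J \<Longrightarrow> d \<in> Nsq K \<Longrightarrow> e \<in> Nsq K \<Longrightarrow>
      a \<cdot> h +[K] (b \<cdot> h) *[K] (d *[K] e) = a' \<cdot> h +[K] (b' \<cdot> h) *[K] (d *[K] e)"
  shows "a = a'" "b = b'"
proof -
  define k where "k p q i = (if i = 0 then p else if i = 3 then q else \<zero>[J])" for p q and i :: nat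
  have kh: "k p q i \<in> Hom E J Rb" if "p \<in> Hom E J Rb" "q \<in> Hom E J Rb" for p q i
    using that J by (simp add: k_def)
  have t: "(\<Oplus>\<^bsub>RR K\<^esub>i\<in>{..3::nat}. (k p q i \<cdot> h) *[K] (bidual_coords i \<cdot> \<langle>el d, el e\<rangle>)) =
      p \<cdot> h +[K] (q \<cdot> h) *[K] (d *[K] e)"
    if p: "p \<in> Hom E J Rb" and q: "q \<in> Hom E J Rb" and h: "h \<in> Hom E K J"
      and d: "d \<in> Nsq K" and e: "e \<in> Nsq K" for p q K h d e
  proof -
    have K: "K \<in> Ob E" using h hom_ob by blast
    have "p \<cdot> h \<in> Hom E K Rb" "q \<cdot> h \<in> Hom E K Rb" using p q h cmp_hom by blast+
    then show ?thesis
      unfolding kl_DD_sum[OF kh[OF p q] h d e] using K nilsq_hom[OF d] nilsq_hom[OF e] ring_zero_cmp[OF h]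
      by (simp add: k_def)
  qed
  have "k a b i = k a' b' i" if "i \<le> 3" for i
  proof (rule kock_lawvere_unique[OF spectrum_DD J _ _ _ that])
    fix K h u assume hh: "h \<in> Hom E K J" and u: "u \<in> Hom E K DD"
    obtain d e where de: "d \<in> Nsq K" "e \<in> Nsq K" "u = \<langle>el d, el e\<rangle>" using DD_elemE[OF u] .
    show "(\<Oplus>\<^bsub>RR K\<^esub>i\<in>{..3}. (k a b i \<cdot> h) *[K] (bidual_coords i \<cdot> u)) =
        (\<Oplus>\<^bsub>RR K\<^esub>i\<in>{..3}. (k a' b' i \<cdot> h) *[K] (bidual_coords i \<cdot> u))"
      unfolding de(3) t[OF h(1,2) hh de(1,2)] t[OF h(3,4) hh de(1,2)] by (rule eq[OF hh de(1,2)])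
  qed (use kh h in auto)
  from this[of 0] this[of 3] show "a = a'" "b = b'" by (simp_all add: k_def)
qed

abbreviation "mD \<equiv> el (bidual_coords 3)"

lemma mD:
  shows mD_hom: "mD \<in> Hom E DD D"
    and mD_tup: "a \<in> Nsq K \<Longrightarrow> b \<in> Nsq K \<Longrightarrow> mD \<cdot> \<langle>el a, el b\<rangle> = el (a *[K] b)"
proof -
  have n: "bidual_coords 3 \<in> Nsq DD"
    using nilsq_mult[OF nilsq_cmp[OF D_incl_nilsq pr1_hom[OF D_ob D_ob]] cmp_hom[OF pr2_hom[OF D_ob D_ob] D_incl_hom]]
    by (simp add: bidual_coords_def Let_def)
  show "mD \<in> Hom E DD D" by (rule D_elem_hom[OF n])
  assume a: "a \<in> Nsq K" and b: "b \<in> Nsq K"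
  show "mD \<cdot> \<langle>el a, el b\<rangle> = el (a *[K] b)"
    using D_elem_cmp[OF n tup_hom[OF D_elem_hom[OF a] D_elem_hom[OF b]]] bidual_coords_tup(4)[OF a b] by simp
qed

definition DD_vertex :: "nat \<Rightarrow> 'o" where
  "DD_vertex i = (if i = 0 then D else DD)"

text \<open>The two axis inclusions and the constant at the origin. A cone over this diagram is a
  map on \<open>D x D\<close> that does not vary along either axis.\<close>

definition DD_edges :: "(nat \<times> 'm \<times> nat) set" where
  "DD_edges = {(0, \<langle>Idt E D, zD\<rangle>, 1), (0, \<langle>zD, Idt E D\<rangle>, 1), (0, \<langle>zD, zD\<rangle>, 1)}"

definition DD_cocone :: "nat \<Rightarrow> 'm" where
  "DD_cocone i = (if i = 0 then zD else mD)"

lemma DD_edge_homs: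
  "\<langle>Idt E D, zD\<rangle> \<in> Hom E D DD" "\<langle>zD, Idt E D\<rangle> \<in> Hom E D DD" "\<langle>zD, zD\<rangle> \<in> Hom E D DD"
  using idt_hom[OF D_ob] zD_hom tup_hom by blast+

lemma D_elem_incl: "el \<iota> = Idt E D"
  using D_elem_eqI[OF idt_hom[OF D_ob] idt_right[OF D_incl_hom]] .

lemma DD_edge_elems:
  assumes d: "d \<in> Nsq K"
  shows "\<langle>Idt E D, zD\<rangle> \<cdot> el d = \<langle>el d, el \<zero>[K]\<rangle>" "\<langle>zD, Idt E D\<rangle> \<cdot> el d = \<langle>el \<zero>[K], el d\<rangle>"
    "\<langle>zD, zD\<rangle> \<cdot> el d = \<langle>el \<zero>[K], el \<zero>[K]\<rangle>"
  using tup_cmp[OF idt_hom[OF D_ob] zD_hom D_elem_hom[OF d]] tup_cmp[OF zD_hom idt_hom[OF D_ob] D_elem_hom[OF d]]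
    tup_cmp[OF zD_hom zD_hom D_elem_hom[OF d]] idt_left[OF D_elem_hom[OF d]] zD_cmp[OF D_elem_hom[OF d]]
  by simp_all

lemma DD_infinitesimal_cocone:
  "infinitesimal_cocone E R {0, 1} DD_vertex DD_edges D DD_cocone"
proof -
  have z: "\<zero>[D] \<in> Nsq D" by (simp add: zero_nilsq)
  have "mD \<cdot> \<langle>Idt E D, zD\<rangle> = zD" "mD \<cdot> \<langle>zD, Idt E D\<rangle> = zD" "mD \<cdot> \<langle>zD, zD\<rangle> = zD"
    using mD_tup[OF D_incl_nilsq z] mD_tup[OF z D_incl_nilsq] mD_tup[OF z z] D_incl_hom nilsq_hom[OF z]
    by (simp_all add: D_elem_incl)
  then show ?thesis
    unfolding infinitesimal_cocone_def DD_vertex_def DD_edges_def DD_cocone_def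
    using spectrum_D spectrum_DD zD_hom mD_hom DD_edge_homs by auto
qed

text \<open>A function \<open>k0 + k1 a + k2 b + k3 a b\<close> that is constant along both axes has
  \<open>k1 = k2 = 0\<close>, so it is the affine function \<open>k0 + k3 d\<close> evaluated at the
  product.\<close>

lemma DD_perceived_by_line: "perceives_colimit E Rb {0, 1} DD_vertex DD_edges D DD_cocone"
  unfolding perceives_colimit_def
proof (intro ballI allI impI)
  fix J and \<phi> :: "nat \<Rightarrow> 'm" assume J: "J \<in> Ob E"
    and "(\<forall>i\<in>{0, 1}. \<phi> i \<in> Hom E (Prd E J (DD_vertex i)) Rb) \<and>
      (\<forall>(i, u, j)\<in>DD_edges. \<phi> j \<cdot> stage_times E J u = \<phi> i)"
  then have \<phi>: "\<phi> 0 \<in> Hom E (Prd E J D) Rb" "\<phi> 1 \<in> Hom E (Prd E J DD) Rb"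
    and e: "\<phi> 1 \<cdot> stage_times E J \<langle>Idt E D, zD\<rangle> = \<phi> 0" "\<phi> 1 \<cdot> stage_times E J \<langle>zD, Idt E D\<rangle> = \<phi> 0"
      "\<phi> 1 \<cdot> stage_times E J \<langle>zD, zD\<rangle> = \<phi> 0"
    by (auto simp: DD_vertex_def DD_edges_def)
  obtain k :: "nat \<Rightarrow> 'm" where "\<forall>i\<le>3. k i \<in> Hom E J Rb" and
    f1: "\<forall>K. \<forall>h \<in> Hom E K J. \<forall>a \<in> Nsq K. \<forall>b \<in> Nsq K. \<phi> 1 \<cdot> \<langle>h, \<langle>el a, el b\<rangle>\<rangle> =
      k 0 \<cdot> h +[K] (k 1 \<cdot> h) *[K] a +[K] (k 2 \<cdot> h) *[K] b
        +[K] (k (3::nat) \<cdot> h) *[K] (a *[K] b)"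
    using kock_lawvere_DD[OF J \<phi>(2)] by blast
  then have k: "k 0 \<in> Hom E J Rb" "k 1 \<in> Hom E J Rb" "k 2 \<in> Hom E J Rb" "k 3 \<in> Hom E J Rb" by auto
  have kh: "k 0 \<cdot> h \<in> Hom E K Rb" "k 1 \<cdot> h \<in> Hom E K Rb" "k 2 \<cdot> h \<in> Hom E K Rb" "k 3 \<cdot> h \<in> Hom E K Rb"
    if "h \<in> Hom E K J" for K h
    using k that cmp_hom by blast+
  have f0: "k 0 \<cdot> h +[K] (k 1 \<cdot> h) *[K] d = \<phi> 0 \<cdot> \<langle>h, el d\<rangle>"
      "k 0 \<cdot> h +[K] (k 2 \<cdot> h) *[K] d = \<phi> 0 \<cdot> \<langle>h, el d\<rangle>" "k 0 \<cdot> h = \<phi> 0 \<cdot> \<langle>h, el d\<rangle>"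
    if h: "h \<in> Hom E K J" and d: "d \<in> Nsq K" for K h d
  proof -
    have K: "K \<in> Ob E" using h hom_ob by blast
    note z = zero_nilsq[OF K] and v = D_elem_hom[OF d] and dh = nilsq_hom[OF d]
    note s = stage_times_tup[OF \<phi>(2) DD_edge_homs(1) h v] stage_times_tup[OF \<phi>(2) DD_edge_homs(2) h v]
      stage_times_tup[OF \<phi>(2) DD_edge_homs(3) h v]
    show "k 0 \<cdot> h +[K] (k 1 \<cdot> h) *[K] d = \<phi> 0 \<cdot> \<langle>h, el d\<rangle>"
      using s(1) e(1) f1[rule_format, OF h d z] kh[OF h] K dh by (simp add: DD_edge_elems[OF d])
    show "k 0 \<cdot> h +[K] (k 2 \<cdot> h) *[K] d = \<phi> 0 \<cdot> \<langle>h, el d\<rangle>"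
      using s(2) e(2) f1[rule_format, OF h z d] kh[OF h] K dh by (simp add: DD_edge_elems[OF d])
    show "k 0 \<cdot> h = \<phi> 0 \<cdot> \<langle>h, el d\<rangle>"
      using s(3) e(3) f1[rule_format, OF h z z] kh[OF h] K dh by (simp add: DD_edge_elems[OF d])
  qed
  \<comment> \<open>Along an axis the function is affine with slope \<open>k i\<close> and also
    constant, so uniqueness on \<open>D\<close> makes the slope zero.\<close>
  have z0: "k i = \<zero>[J]" if i: "i \<in> {1, 2}" for i
  proof (rule kock_lawvere_D_unique(2)[OF J k(1) _ k(1) ring_closed(1)[OF J]])
    show "k i \<in> Hom E J Rb" using i k by auto
    fix K h d assume h: "h \<in> Hom E K J" and d: "d \<in> Nsq K"
    then show "k 0 \<cdot> h +[K] (k i \<cdot> h) *[K] d = k 0 \<cdot> h +[K] (\<zero>[J] \<cdot> h) *[K] d"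
      using i f0[OF h d] ring_zero_cmp[OF h] kh[OF h] nilsq_hom[OF d] by auto
  qed
  let ?P = "Prd E J D"
  have P: "?P \<in> Ob E" using J prd_ob D_ob by blast
  note q1 = pr1_hom[OF J D_ob] and q2 = pr2_hom[OF J D_ob]
  define \<psi> where "\<psi> = (k 0 \<cdot> Pr1 E J D) +[?P] (k 3 \<cdot> Pr1 E J D) *[?P] (\<iota> \<cdot> Pr2 E J D)"
  have m: "k 0 \<cdot> Pr1 E J D \<in> Hom E ?P Rb" "k 3 \<cdot> Pr1 E J D \<in> Hom E ?P Rb" "\<iota> \<cdot> Pr2 E J D \<in> Hom E ?P Rb"
    using k D_incl_hom q1 q2 cmp_hom by blast+
  have \<psi>: "\<psi> \<in> Hom E ?P Rb" unfolding \<psi>_def using m P by simp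
  have \<psi>e: "\<psi> \<cdot> \<langle>h, el d\<rangle> = k 0 \<cdot> h +[K] (k 3 \<cdot> h) *[K] d"
    if h: "h \<in> Hom E K J" and d: "d \<in> Nsq K" for K h d
  proof -
    note v = D_elem_hom[OF d]
    note t = tup_hom[OF h v]
    show ?thesis
      unfolding \<psi>_def using m P cmp_assoc[OF t q1 k(1)] cmp_assoc[OF t q1 k(4)] cmp_assoc[OF t q2 D_incl_hom]
        pr1_tup[OF h v] pr2_tup[OF h v] D_incl_elem[OF d]
      by (simp add: ring_add_cmp[OF _ _ t] ring_mult_cmp[OF _ _ t])
  qed
  show "\<exists>!\<psi>. \<psi> \<in> Hom E (Prd E J D) Rb \<and> (\<forall>i\<in>{0, 1 :: nat}. \<psi> \<cdot> stage_times E J (DD_cocone i) = \<phi> i)"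
  proof (rule ex1I[of _ \<psi>])
    have "\<psi> \<cdot> stage_times E J zD = \<phi> 0"
      unfolding stage_times_eq_iff[OF J \<psi> zD_hom \<phi>(1)]
    proof (intro allI ballI)
      fix K h v assume h: "h \<in> Hom E K J" and v: "v \<in> Hom E K D"
      have K: "K \<in> Ob E" using h hom_ob by blast
      show "\<psi> \<cdot> \<langle>h, zD \<cdot> v\<rangle> = \<phi> 0 \<cdot> \<langle>h, v\<rangle>"
        using \<psi>e[OF h zero_nilsq[OF K]] f0(3)[OF h nilsq_cmp[OF D_incl_nilsq v]] D_elem_eqI[OF v refl]
          kh[OF h] by (simp add: zD_cmp[OF v])
    qed
    moreover have "\<psi> \<cdot> stage_times E J mD = \<phi> 1"
      unfolding stage_times_eq_iff[OF J \<psi> mD_hom \<phi>(2)]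
    proof (intro allI ballI)
      fix K h v assume h: "h \<in> Hom E K J" and v: "v \<in> Hom E K DD"
      obtain a b where ab: "a \<in> Nsq K" "b \<in> Nsq K" and ve: "v = \<langle>el a, el b\<rangle>" using DD_elemE[OF v] .
      show "\<psi> \<cdot> \<langle>h, mD \<cdot> v\<rangle> = \<phi> 1 \<cdot> \<langle>h, v\<rangle>"
        unfolding ve mD_tup[OF ab] \<psi>e[OF h nilsq_mult[OF ab(1) nilsq_hom[OF ab(2)]]] f1[rule_format, OF h ab]
        using z0[of 1] z0[of 2] kh[OF h] ab nilsq_hom ring_zero_cmp[OF h] by simp
    qed
    ultimately show "\<psi> \<in> Hom E (Prd E J D) Rb \<and> (\<forall>i\<in>{0, 1}. \<psi> \<cdot> stage_times E J (DD_cocone i) = \<phi> i)"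
      using \<psi> by (simp add: DD_cocone_def)
  next
    fix \<chi> assume "\<chi> \<in> Hom E (Prd E J D) Rb \<and> (\<forall>i\<in>{0, 1}. \<chi> \<cdot> stage_times E J (DD_cocone i) = \<phi> i)"
    then have \<chi>: "\<chi> \<in> Hom E ?P Rb" and \<chi>m: "\<chi> \<cdot> stage_times E J mD = \<phi> 1"
      by (auto simp: DD_cocone_def)
    obtain a b where ab: "a \<in> Hom E J Rb" "b \<in> Hom E J Rb" and
      \<chi>e: "\<And>K h d. h \<in> Hom E K J \<Longrightarrow> d \<in> Nsq K \<Longrightarrow> \<chi> \<cdot> \<langle>h, el d\<rangle> = a \<cdot> h +[K] (b \<cdot> h) *[K] d"
      using kock_lawvere_D[OF J \<chi>] by metis
    have "a \<cdot> h +[K] (b \<cdot> h) *[K] (d *[K] d') = k 0 \<cdot> h +[K] (k 3 \<cdot> h) *[K] (d *[K] d')"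
      if h: "h \<in> Hom E K J" and d: "d \<in> Nsq K" "d' \<in> Nsq K" for K h d d'
    proof -
      note v = tup_hom[OF D_elem_hom[OF d(1)] D_elem_hom[OF d(2)]]
      show ?thesis
        using stage_times_tup[OF \<chi> mD_hom h v] \<chi>m f1[rule_format, OF h d]
          \<chi>e[OF h nilsq_mult[OF d(1) nilsq_hom[OF d(2)]]]
          z0[of 1] z0[of 2] kh[OF h] d nilsq_hom ring_zero_cmp[OF h] by (simp add: mD_tup[OF d])
    qed
    then have "a = k 0" "b = k 3"
      using kock_lawvere_DD_unique[OF J ab k(1,4)] by blast+
    then show "\<chi> = \<psi>"
      by (intro prd_hom_ext[OF J D_ob \<chi> \<psi>])
        (metis \<chi>e \<psi>e D_elem_eqI nilsq_cmp[OF D_incl_nilsq])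
  qed
qed

lemma DD_perceived: "perceives_colimit E Gb {0, 1} DD_vertex DD_edges D DD_cocone"
  using lie_group DD_infinitesimal_cocone DD_perceived_by_line
  unfolding lie_group_def microlinear_def by blast

lemma DD_factor:
  assumes J: "J \<in> Ob E" and \<phi>: "\<phi> \<in> Hom E (Prd E J DD) Gb"
    and ax: "\<And>K h d. h \<in> Hom E K J \<Longrightarrow> d \<in> Nsq K \<Longrightarrow> \<phi> \<cdot> \<langle>h, \<langle>el d, el \<zero>[K]\<rangle>\<rangle> = \<one>[K]"
      "\<And>K h d. h \<in> Hom E K J \<Longrightarrow> d \<in> Nsq K \<Longrightarrow> \<phi> \<cdot> \<langle>h, \<langle>el \<zero>[K], el d\<rangle>\<rangle> = \<one>[K]"
  shows "\<exists>!\<psi>. \<psi> \<in> Hom E (Prd E J D) Gb \<and> \<psi> \<cdot> stage_times E J mD = \<phi>"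
proof -
  let ?z = "\<phi> \<cdot> stage_times E J \<langle>zD, zD\<rangle>"
  have zh: "?z \<in> Hom E (Prd E J D) Gb" using cmp_hom[OF stage_times_hom[OF J DD_edge_homs(3)] \<phi>] .
  have ze: "?z \<cdot> \<langle>h, v\<rangle> = \<one>[K]" if h: "h \<in> Hom E K J" and v: "v \<in> Hom E K D" for K h v
  proof -
    have K: "K \<in> Ob E" using h hom_ob by blast
    have d: "\<iota> \<cdot> v \<in> Nsq K" using nilsq_cmp[OF D_incl_nilsq v] .
    show ?thesis
      using stage_times_tup[OF \<phi> DD_edge_homs(3) h v] DD_edge_elems(3)[OF d] D_elem_eqI[OF v refl]
        ax(1)[OF h zero_nilsq[OF K]] by simp
  qed
  have e: "\<phi> \<cdot> stage_times E J \<langle>Idt E D, zD\<rangle> = ?z" "\<phi> \<cdot> stage_times E J \<langle>zD, Idt E D\<rangle> = ?z"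
    unfolding stage_times_eq_iff[OF J \<phi> DD_edge_homs(1) zh] stage_times_eq_iff[OF J \<phi> DD_edge_homs(2) zh]
    using DD_edge_elems ze ax D_elem_eqI[OF _ refl] nilsq_cmp[OF D_incl_nilsq] by metis+
  let ?\<phi> = "\<lambda>i::nat. if i = 0 then ?z else \<phi>"
  have ex1: "\<exists>!\<psi>. \<psi> \<in> Hom E (Prd E J D) Gb \<and> (\<forall>i\<in>{0, 1}. \<psi> \<cdot> stage_times E J (DD_cocone i) = ?\<phi> i)"
    by (rule DD_perceived[unfolded perceives_colimit_def, rule_format, OF J])
      (use \<phi> zh e in \<open>auto simp: DD_vertex_def DD_edges_def\<close>)
  have "(\<forall>i\<in>{0, 1::nat}. \<psi> \<cdot> stage_times E J (DD_cocone i) = ?\<phi> i) \<longleftrightarrow> \<psi> \<cdot> stage_times E J mD = \<phi>"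
    if \<psi>: "\<psi> \<in> Hom E (Prd E J D) Gb" for \<psi>
  proof -
    \<comment> \<open>The leg at vertex 0 follows from the leg at vertex 1, because multiplication
      after the origin of \<open>D x D\<close> is the constant \<open>zD\<close>.\<close>
    have "\<psi> \<cdot> stage_times E J zD = ?z" if m: "\<psi> \<cdot> stage_times E J mD = \<phi>"
    proof -
      have "?z = \<psi> \<cdot> stage_times E J (mD \<cdot> \<langle>zD, zD\<rangle>)"
        using stage_times_stage_times[OF J \<psi> mD_hom DD_edge_homs(3)] m by simp
      moreover have "mD \<cdot> \<langle>zD, zD\<rangle> = zD"
        using mD_tup[OF zero_nilsq[OF D_ob] zero_nilsq[OF D_ob]] by simp
      ultimately show ?thesis by simp
    qed
    then show ?thesis by (auto simp: DD_cocone_def)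
  qed
  then show ?thesis using ex1 by (metis (no_types, lifting))
qed

text \<open>The source of the bracket: a family that is trivial on both axes, such as a commutator,
  depends on the product of its two parameters only and defines a tangent vector.\<close>

lemma DD_family_factor:
  assumes J: "J \<in> Ob E"
    and hom: "\<And>K f a b. f \<in> Hom E K J \<Longrightarrow> a \<in> Nsq K \<Longrightarrow> b \<in> Nsq K \<Longrightarrow> \<Phi> f a b \<in> Hom E K Gb"
    and nat: "\<And>K L f a b h. f \<in> Hom E K J \<Longrightarrow> a \<in> Nsq K \<Longrightarrow> b \<in> Nsq K \<Longrightarrow> h \<in> Hom E L K \<Longrightarrow>
      \<Phi> f a b \<cdot> h = \<Phi> (f \<cdot> h) (a \<cdot> h) (b \<cdot> h)"
    and ax1: "\<And>K f a. f \<in> Hom E K J \<Longrightarrow> a \<in> Nsq K \<Longrightarrow> \<Phi> f a \<zero>[K] = \<one>[K]"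
    and ax2: "\<And>K f b. f \<in> Hom E K J \<Longrightarrow> b \<in> Nsq K \<Longrightarrow> \<Phi> f \<zero>[K] b = \<one>[K]"
  shows "\<exists>Z \<in> Hom E J \<g>. \<forall>K. \<forall>f \<in> Hom E K J. \<forall>a \<in> Nsq K. \<forall>b \<in> Nsq K.
    app (Z \<cdot> f) (a *[K] b) = \<Phi> f a b"
proof -
  let ?a = "\<iota> \<cdot> Pr1 E D D" and ?b = "\<iota> \<cdot> Pr2 E D D"
  have ah: "?a \<in> Hom E DD Rb" and bh: "?b \<in> Hom E DD Rb" and an: "?a \<in> Nsq DD" and bn: "?b \<in> Nsq DD"
    using cmp_hom[OF pr1_hom[OF D_ob D_ob] D_incl_hom] cmp_hom[OF pr2_hom[OF D_ob D_ob] D_incl_hom]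
      nilsq_cmp[OF D_incl_nilsq pr1_hom[OF D_ob D_ob]] nilsq_cmp[OF D_incl_nilsq pr2_hom[OF D_ob D_ob]]
    by blast+
  note q1 = pr1_hom[OF J DD_ob] and q2 = pr2_hom[OF J DD_ob]
  note n = nilsq_cmp[OF an q2] nilsq_cmp[OF bn q2]
  define \<phi> where "\<phi> = \<Phi> (Pr1 E J DD) (?a \<cdot> Pr2 E J DD) (?b \<cdot> Pr2 E J DD)"
  have \<phi>: "\<phi> \<in> Hom E (Prd E J DD) Gb" unfolding \<phi>_def by (rule hom[OF q1 n])
  have \<phi>e: "\<phi> \<cdot> \<langle>h, \<langle>el a, el b\<rangle>\<rangle> = \<Phi> h a b" if h: "h \<in> Hom E K J" and ab: "a \<in> Nsq K" "b \<in> Nsq K" for K h a b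
  proof -
    note v = tup_hom[OF D_elem_hom[OF ab(1)] D_elem_hom[OF ab(2)]]
    note t = tup_hom[OF h v]
    show ?thesis
      unfolding \<phi>_def nat[OF q1 n t] cmp_assoc[OF t q2 ah] cmp_assoc[OF t q2 bh] pr1_tup[OF h v] pr2_tup[OF h v]
      using DD_elem_unique[OF ab, of "\<langle>el a, el b\<rangle>"] by simp
  qed
  obtain \<psi> where \<psi>: "\<psi> \<in> Hom E (Prd E J D) Gb" and \<psi>m: "\<psi> \<cdot> stage_times E J mD = \<phi>"
    using DD_factor[OF J \<phi>] \<phi>e ax1 ax2 zero_nilsq hom_ob by metis
  have \<psi>e: "\<psi> \<cdot> \<langle>h, el (a *[K] b)\<rangle> = \<Phi> h a b" if h: "h \<in> Hom E K J" and ab: "a \<in> Nsq K" "b \<in> Nsq K" for K h a b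
    using stage_times_tup[OF \<psi> mD_hom h tup_hom[OF D_elem_hom[OF ab(1)] D_elem_hom[OF ab(2)]]]
      mD_tup[OF ab] \<phi>e[OF that] \<psi>m by simp
  have "\<exists>Z \<in> Hom E J \<g>. \<forall>K. \<forall>f \<in> Hom E K J. \<forall>d \<in> Nsq K. app (Z \<cdot> f) d = \<psi> \<cdot> \<langle>f, el d\<rangle>"
  proof (rule tangent_comprehension[OF J])
    fix K f d assume f: "f \<in> Hom E K J" and d: "d \<in> Nsq K"
    show "\<psi> \<cdot> \<langle>f, el d\<rangle> \<in> Hom E K Gb" using cmp_hom[OF tup_hom[OF f D_elem_hom[OF d]] \<psi>] .
    fix L h assume h: "h \<in> Hom E L K"
    show "(\<psi> \<cdot> \<langle>f, el d\<rangle>) \<cdot> h = \<psi> \<cdot> \<langle>f \<cdot> h, el (d \<cdot> h)\<rangle>"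
      using cmp_assoc[OF h tup_hom[OF f D_elem_hom[OF d]] \<psi>] tup_cmp[OF f D_elem_hom[OF d] h]
        D_elem_cmp[OF d h] by simp
  next
    fix K f assume f: "f \<in> Hom E K J"
    then have K: "K \<in> Ob E" using hom_ob by blast
    show "\<psi> \<cdot> \<langle>f, el \<zero>[K]\<rangle> = \<one>[K]"
      using \<psi>e[OF f zero_nilsq[OF K] zero_nilsq[OF K]] ax1[OF f zero_nilsq[OF K]] K by simp
  qed
  then obtain Z where Z: "Z \<in> Hom E J \<g>"
    and Ze: "\<forall>K. \<forall>f \<in> Hom E K J. \<forall>d \<in> Nsq K. app (Z \<cdot> f) d = \<psi> \<cdot> \<langle>f, el d\<rangle>" by blast
  have "app (Z \<cdot> f) (a *[K] b) = \<Phi> f a b" if "f \<in> Hom E K J" "a \<in> Nsq K" "b \<in> Nsq K" for K f a b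
    using Ze that \<psi>e[OF that] nilsq_mult[OF that(2) nilsq_hom[OF that(3)]] by simp
  then show ?thesis using Z by blast
qed

text \<open>A nilsquare element need not be a product of two others, but the group perceives
  multiplication as a quotient map. Uniqueness in \<open>DD_factor\<close> therefore makes the
  values at products sufficient.\<close>

lemma tangent_ext_DD:
  assumes X: "X \<in> Hom E J \<g>" and Y: "Y \<in> Hom E J \<g>"
    and eq: "\<And>K f a b. f \<in> Hom E K J \<Longrightarrow> a \<in> Nsq K \<Longrightarrow> b \<in> Nsq K \<Longrightarrow>
      app (X \<cdot> f) (a *[K] b) = app (Y \<cdot> f) (a *[K] b)"
  shows "X = Y"
proof -
  have J: "J \<in> Ob E" using X hom_ob by blast
  note q1 = pr1_hom[OF J D_ob] and q2 = pr2_hom[OF J D_ob]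
  have n: "\<iota> \<cdot> Pr2 E J D \<in> Nsq (Prd E J D)" using nilsq_cmp[OF D_incl_nilsq q2] .
  define \<psi> where "\<psi> Z = app (Z \<cdot> Pr1 E J D) (\<iota> \<cdot> Pr2 E J D)" for Z
  have \<psi>: "\<psi> Z \<in> Hom E (Prd E J D) Gb" and \<psi>e: "\<And>K h d. h \<in> Hom E K J \<Longrightarrow> d \<in> Nsq K \<Longrightarrow> \<psi> Z \<cdot> \<langle>h, el d\<rangle> = app (Z \<cdot> h) d"
    if Z: "Z \<in> Hom E J \<g>" for Z
  proof -
    show "\<psi> Z \<in> Hom E (Prd E J D) Gb" unfolding \<psi>_def by (rule tapp_hom[OF cmp_hom[OF q1 Z] n])
    fix K h d assume h: "h \<in> Hom E K J" and d: "d \<in> Nsq K"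
    note v = D_elem_hom[OF d]
    note t = tup_hom[OF h v]
    show "\<psi> Z \<cdot> \<langle>h, el d\<rangle> = app (Z \<cdot> h) d"
      unfolding \<psi>_def tapp_cmp[OF cmp_hom[OF q1 Z] n t] cmp_assoc[OF t q1 Z] cmp_assoc[OF t q2 D_incl_hom]
        pr1_tup[OF h v] pr2_tup[OF h v] D_incl_elem[OF d] by (rule refl)
  qed
  let ?\<phi> = "\<psi> X \<cdot> stage_times E J mD"
  have \<phi>: "?\<phi> \<in> Hom E (Prd E J DD) Gb" using cmp_hom[OF stage_times_hom[OF J mD_hom] \<psi>[OF X]] .
  have \<phi>e: "\<psi> Z \<cdot> stage_times E J mD \<cdot> \<langle>h, \<langle>el a, el b\<rangle>\<rangle> = app (Z \<cdot> h) (a *[K] b)"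
    if Z: "Z \<in> Hom E J \<g>" and h: "h \<in> Hom E K J" and ab: "a \<in> Nsq K" "b \<in> Nsq K" for Z K h a b
  proof -
    note v = tup_hom[OF D_elem_hom[OF ab(1)] D_elem_hom[OF ab(2)]]
    show ?thesis
      using stage_times_tup[OF \<psi>[OF Z] mD_hom h v] mD_tup[OF ab] \<psi>e[OF Z h nilsq_mult[OF ab(1) nilsq_hom[OF ab(2)]]]
        cmp_assoc[OF tup_hom[OF h v] stage_times_hom[OF J mD_hom] \<psi>[OF Z]] by simp
  qed
  have \<phi>z: "?\<phi> \<cdot> \<langle>h, \<langle>el a, el b\<rangle>\<rangle> = \<one>[K]"
    if h: "h \<in> Hom E K J" and ab: "a \<in> Nsq K" "b \<in> Nsq K" "a *[K] b = \<zero>[K]" for K h a b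
    using \<phi>e[OF X h ab(1,2)] tapp_zero[OF cmp_hom[OF h X]] ab(3)
      cmp_assoc[OF tup_hom[OF h tup_hom[OF D_elem_hom[OF ab(1)] D_elem_hom[OF ab(2)]]]
        stage_times_hom[OF J mD_hom] \<psi>[OF X]] by simp
  have "\<exists>!\<psi>'. \<psi>' \<in> Hom E (Prd E J D) Gb \<and> \<psi>' \<cdot> stage_times E J mD = ?\<phi>"
    using \<phi>z zero_nilsq hom_ob nilsq_hom by (intro DD_factor[OF J \<phi>]) simp_all
  moreover have "\<psi> Y \<cdot> stage_times E J mD = ?\<phi>"
  proof (rule prd_hom_ext[OF J DD_ob cmp_hom[OF stage_times_hom[OF J mD_hom] \<psi>[OF Y]] \<phi>])
    fix K h u assume h: "h \<in> Hom E K J" and u: "u \<in> Hom E K DD"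
    obtain a b where ab: "a \<in> Nsq K" "b \<in> Nsq K" and ue: "u = \<langle>el a, el b\<rangle>" using DD_elemE[OF u] .
    show "(\<psi> Y \<cdot> stage_times E J mD) \<cdot> \<langle>h, u\<rangle> = ?\<phi> \<cdot> \<langle>h, u\<rangle>"
      using \<phi>e[OF X h ab] \<phi>e[OF Y h ab] eq[OF h ab] cmp_assoc[OF tup_hom[OF h u] stage_times_hom[OF J mD_hom] \<psi>[OF X]]
        cmp_assoc[OF tup_hom[OF h u] stage_times_hom[OF J mD_hom] \<psi>[OF Y]]
      unfolding ue by simp
  qed
  ultimately have "\<psi> X = \<psi> Y" using \<psi>[OF X] \<psi>[OF Y] by blast
  then show ?thesis
    using \<psi>e[OF X] \<psi>e[OF Y] by (intro tangent_ext[OF X Y]) metis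
qed

section \<open>The Lie algebra as a module\<close>

text \<open>Discharges the definite descriptions: existence by comprehension, uniqueness by
  extensionality.\<close>

lemma tangent_THE:
  assumes J: "J \<in> Ob E"
    and hom: "\<And>K f d. f \<in> Hom E K J \<Longrightarrow> d \<in> Nsq K \<Longrightarrow> \<Phi> f d \<in> Hom E K Gb"
    and nat: "\<And>K L f d h. f \<in> Hom E K J \<Longrightarrow> d \<in> Nsq K \<Longrightarrow> h \<in> Hom E L K \<Longrightarrow>
      \<Phi> f d \<cdot> h = \<Phi> (f \<cdot> h) (d \<cdot> h)"
    and zero: "\<And>K f. f \<in> Hom E K J \<Longrightarrow> \<Phi> f \<zero>[K] = \<one>[K]"
  defines "Z \<equiv> THE Z. Z \<in> Hom E J \<g> \<and> (\<forall>K. \<forall>f \<in> Hom E K J. \<forall>d \<in> Nsq K. app (Z \<cdot> f) d = \<Phi> f d)"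
  shows "Z \<in> Hom E J \<g>"
    and "f \<in> Hom E K J \<Longrightarrow> d \<in> Nsq K \<Longrightarrow> app (Z \<cdot> f) d = \<Phi> f d"
proof -
  have "\<exists>Z \<in> Hom E J \<g>. \<forall>K. \<forall>f \<in> Hom E K J. \<forall>d \<in> Nsq K. app (Z \<cdot> f) d = \<Phi> f d"
    using J by (rule tangent_comprehension) (use hom nat zero in auto)
  then obtain Z' where Z': "Z' \<in> Hom E J \<g> \<and> (\<forall>K. \<forall>f \<in> Hom E K J. \<forall>d \<in> Nsq K. app (Z' \<cdot> f) d = \<Phi> f d)"
    by blast
  have "Z'' = Z'" if "Z'' \<in> Hom E J \<g> \<and> (\<forall>K. \<forall>f \<in> Hom E K J. \<forall>d \<in> Nsq K. app (Z'' \<cdot> f) d = \<Phi> f d)" for Z''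
    by (rule tangent_ext) (use that Z' in auto)
  with Z' have "Z = Z'" unfolding Z_def by (rule the_equality)
  with Z' show "Z \<in> Hom E J \<g>" "f \<in> Hom E K J \<Longrightarrow> d \<in> Nsq K \<Longrightarrow> app (Z \<cdot> f) d = \<Phi> f d"
    by blast+
qed

lemma tzero_spec:
  assumes J: "J \<in> Ob E"
  shows tzero_hom: "tzero E R G J \<in> Hom E J \<g>"
    and "f \<in> Hom E K J \<Longrightarrow> d \<in> Nsq K \<Longrightarrow> app (tzero E R G J \<cdot> f) d = \<one>[K]"
proof -
  \<comment> \<open>The family in \<open>tangent_THE\<close> depends on \<open>f\<close> and
    \<open>d\<close> alone, so the stage has to be recovered as \<open>Dom E f\<close>.\<close>
  have dom: "Dom E f = K" if "f \<in> Hom E K J" for f K using that hom_dom by blast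
  have "tzero E R G J = (THE Z. Z \<in> Hom E J \<g> \<and>
      (\<forall>K. \<forall>f \<in> Hom E K J. \<forall>d \<in> Nsq K. app (Z \<cdot> f) d = \<one>[Dom E f]))"
    unfolding tzero_def by (intro arg_cong[where f = The] ext) (auto simp: dom)
  moreover have "f \<in> Hom E K J \<Longrightarrow> d \<in> Nsq K \<Longrightarrow> \<one>[Dom E f] \<in> Hom E K Gb" for K f d
    using dom hom_ob by auto
  moreover have "\<one>[Dom E f] \<cdot> h = \<one>[Dom E (f \<cdot> h)]" if "f \<in> Hom E K J" "h \<in> Hom E L K" for K L f h
    using dom[OF that(1)] dom[OF cmp_hom[OF that(2,1)]] group_one_cmp[OF that(2)] by simp
  ultimately show "tzero E R G J \<in> Hom E J \<g>"
    "f \<in> Hom E K J \<Longrightarrow> d \<in> Nsq K \<Longrightarrow> app (tzero E R G J \<cdot> f) d = \<one>[K]"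
    using tangent_THE[OF J, where \<Phi> = "\<lambda>f d. \<one>[Dom E f]"] dom by (simp_all add: dom)
qed

lemma tapp_tzero: "d \<in> Nsq K \<Longrightarrow> app (tzero E R G K) d = \<one>[K]"
  using tzero_spec(2)[OF nilsq_ob idt_hom[OF nilsq_ob]] idt_right[OF tzero_hom[OF nilsq_ob]] by metis

lemma tsmult_spec:
  assumes r: "r \<in> Hom E J Rb" and X: "X \<in> Hom E J \<g>"
  shows tsmult_hom: "smul J r X \<in> Hom E J \<g>"
    and "f \<in> Hom E K J \<Longrightarrow> d \<in> Nsq K \<Longrightarrow>
      app (smul J r X \<cdot> f) d = app (X \<cdot> f) ((r \<cdot> f) *[K] d)"
proof -
  have J: "J \<in> Ob E" using r hom_ob by blast
  have dom: "Dom E f = K" if "f \<in> Hom E K J" for f K using that hom_dom by blast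
  let ?\<Phi> = "\<lambda>f d. app (X \<cdot> f) ((r \<cdot> f) *[Dom E f] d)"
  have eq: "smul J r X = (THE Z. Z \<in> Hom E J \<g> \<and>
      (\<forall>K. \<forall>f \<in> Hom E K J. \<forall>d \<in> Nsq K. app (Z \<cdot> f) d = ?\<Phi> f d))"
    unfolding tsmult_def by (intro arg_cong[where f = The] ext) (auto simp: dom)
  have 1: "?\<Phi> f d \<in> Hom E K Gb" if f: "f \<in> Hom E K J" and d: "d \<in> Nsq K" for K f d
    using tapp_hom[OF cmp_hom[OF f X] nilsq_smult[OF d cmp_hom[OF f r]]] by (simp add: dom[OF f])
  have 2: "?\<Phi> f d \<cdot> h = ?\<Phi> (f \<cdot> h) (d \<cdot> h)" if f: "f \<in> Hom E K J" and d: "d \<in> Nsq K" and h: "h \<in> Hom E L K"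
    for K L f d h
    using tapp_cmp[OF cmp_hom[OF f X] nilsq_smult[OF d cmp_hom[OF f r]] h] cmp_assoc[OF h f X] cmp_assoc[OF h f r]
      ring_mult_cmp[OF cmp_hom[OF f r] nilsq_hom[OF d] h]
    by (simp add: dom[OF f] dom[OF cmp_hom[OF h f]])
  have 3: "?\<Phi> f \<zero>[K] = \<one>[K]" if f: "f \<in> Hom E K J" for K f
    using tapp_zero[OF cmp_hom[OF f X]] cmp_hom[OF f r] by (simp add: dom[OF f])
  show "smul J r X \<in> Hom E J \<g>"
    unfolding eq by (rule tangent_THE(1)[where \<Phi> = ?\<Phi>, OF J 1 2 3])
  show "app (smul J r X \<cdot> f) d = app (X \<cdot> f) ((r \<cdot> f) *[K] d)"
    if "f \<in> Hom E K J" "d \<in> Nsq K" for f d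
    unfolding eq using tangent_THE(2)[where \<Phi> = ?\<Phi>, OF J 1 2 3 that] that by (simp add: dom)
qed

lemma tapp_tsmult:
  assumes "r \<in> Hom E K Rb" "X \<in> Hom E K \<g>" "d \<in> Nsq K"
  shows "app (smul K r X) d = app X (r *[K] d)"
  using tsmult_spec(2)[OF assms(1,2) idt_hom[OF nilsq_ob[OF assms(3)]] assms(3)]
    idt_right[OF assms(1)] idt_right[OF assms(2)] idt_right[OF tsmult_hom[OF assms(1,2)]] by simp

lemma tsmult_cmp:
  assumes r: "r \<in> Hom E J Rb" and X: "X \<in> Hom E J \<g>" and f: "f \<in> Hom E K J"
  shows "smul J r X \<cdot> f = smul K (r \<cdot> f) (X \<cdot> f)"
proof (rule tangent_ext[OF cmp_hom[OF f tsmult_hom[OF r X]] tsmult_hom[OF cmp_hom[OF f r] cmp_hom[OF f X]]])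
  fix L h d assume h: "h \<in> Hom E L K" and d: "d \<in> Nsq L"
  show "app ((smul J r X \<cdot> f) \<cdot> h) d = app (smul K (r \<cdot> f) (X \<cdot> f) \<cdot> h) d"
    using tsmult_spec(2)[OF r X cmp_hom[OF h f] d] tsmult_spec(2)[OF cmp_hom[OF f r] cmp_hom[OF f X] h d]
      cmp_assoc[OF h f tsmult_hom[OF r X]] cmp_assoc[OF h f r] cmp_assoc[OF h f X] by simp
qed

section \<open>One-parameter subgroups and their infinitesimal consequences\<close>

lemma exp_curve_tup:
  assumes X: "X \<in> Hom E J \<g>" and f: "f \<in> Hom E K J" and t: "t \<in> Hom E K Rb"
  shows "exp_curve E R G ex J X \<cdot> \<langle>f, t\<rangle> = ex \<cdot> smul K t (X \<cdot> f)"
proof -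
  have J: "J \<in> Ob E" using X hom_ob by blast
  note q1 = pr1_hom[OF J line_ob] and q2 = pr2_hom[OF J line_ob] and ft = tup_hom[OF f t]
  have ex: "ex \<in> Hom E \<g> Gb" using exponential by (simp add: exponential_map_def)
  show ?thesis
    unfolding exp_curve_def
    using cmp_assoc[OF ft tsmult_hom[OF q2 cmp_hom[OF q1 X]] ex] tsmult_cmp[OF q2 cmp_hom[OF q1 X] ft]
      pr1_tup[OF f t] pr2_tup[OF f t] cmp_assoc[OF ft q1 X] by (simp add: lie_algebra_at_def)
qed

lemma ex_hom: "X \<in> Hom E K \<g> \<Longrightarrow> ex \<cdot> X \<in> Hom E K Gb"
  using exponential cmp_hom by (auto simp: exponential_map_def)

lemma ex_add:
  assumes X: "X \<in> Hom E K \<g>" and t: "t \<in> Hom E K Rb" "t' \<in> Hom E K Rb"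
  shows "ex \<cdot> smul K (t +[K] t') X = (ex \<cdot> smul K t X) \<otimes>[K] (ex \<cdot> smul K t' X)"
proof -
  have K: "K \<in> Ob E" using X hom_ob by blast
  have "one_param_subgroup E R G K (exp_curve E R G ex K X)"
    using exponential X K by (simp add: exponential_map_def)
  from this[unfolded one_param_subgroup_def, THEN conjunct2, rule_format, OF idt_hom[OF K] t]
  show ?thesis
    using exp_curve_tup[OF X idt_hom[OF K]] t K idt_right[OF X] by simp
qed

lemma ex_nilsq:
  assumes X: "X \<in> Hom E K \<g>" and d: "d \<in> Nsq K"
  shows "ex \<cdot> smul K d X = app X d"
proof -
  have K: "K \<in> Ob E" using X hom_ob by blast
  have "has_velocity E R G K (exp_curve E R G ex K X) X"
    using exponential X K by (simp add: exponential_map_def)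
  from this[unfolded has_velocity_def, rule_format, OF idt_hom[OF K] d]
  show ?thesis
    using exp_curve_tup[OF X idt_hom[OF K] nilsq_hom[OF d]] idt_right[OF X] by simp
qed

text \<open>Uniqueness of the one-parameter subgroup for natural families. The arrow on
  \<open>Prd E J Rb\<close> is the value of the family at the generic time.\<close>

lemma ex_unique:
  assumes X: "X \<in> Hom E J \<g>"
    and hom: "\<And>K f t. f \<in> Hom E K J \<Longrightarrow> t \<in> Hom E K Rb \<Longrightarrow> \<Phi> f t \<in> Hom E K Gb"
    and nat: "\<And>K L f t h. f \<in> Hom E K J \<Longrightarrow> t \<in> Hom E K Rb \<Longrightarrow> h \<in> Hom E L K \<Longrightarrow>
      \<Phi> f t \<cdot> h = \<Phi> (f \<cdot> h) (t \<cdot> h)"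
    and add: "\<And>K f t t'. f \<in> Hom E K J \<Longrightarrow> t \<in> Hom E K Rb \<Longrightarrow> t' \<in> Hom E K Rb \<Longrightarrow>
      \<Phi> f (t +[K] t') = \<Phi> f t \<otimes>[K] \<Phi> f t'"
    and velocity: "\<And>K f d. f \<in> Hom E K J \<Longrightarrow> d \<in> Nsq K \<Longrightarrow> \<Phi> f d = app (X \<cdot> f) d"
    and t: "t \<in> Hom E J Rb"
  shows "ex \<cdot> smul J t X = \<Phi> (Idt E J) t"
proof -
  have J: "J \<in> Ob E" using X hom_ob by blast
  note q1 = pr1_hom[OF J line_ob] and q2 = pr2_hom[OF J line_ob]
  define \<phi> where "\<phi> = \<Phi> (Pr1 E J Rb) (Pr2 E J Rb)"
  have \<phi>: "\<phi> \<in> Hom E (Prd E J Rb) Gb" unfolding \<phi>_def by (rule hom[OF q1 q2])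
  have \<phi>e: "\<phi> \<cdot> \<langle>f, t\<rangle> = \<Phi> f t" if "f \<in> Hom E K J" "t \<in> Hom E K Rb" for K f t
    unfolding \<phi>_def nat[OF q1 q2 tup_hom[OF that]] pr1_tup[OF that] pr2_tup[OF that] by (rule refl)
  have "one_param_subgroup E R G J \<phi>"
    unfolding one_param_subgroup_def
  proof (intro conjI \<phi> allI ballI)
    fix K f t t' assume *: "f \<in> Hom E K J" "t \<in> Hom E K Rb" "t' \<in> Hom E K Rb"
    then have K: "K \<in> Ob E" using hom_ob by blast
    show "\<phi> \<cdot> \<langle>f, t +[K] t'\<rangle> = (\<phi> \<cdot> \<langle>f, t\<rangle>) \<otimes>[K] (\<phi> \<cdot> \<langle>f, t'\<rangle>)"
      using * K \<phi>e add by simp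
  qed
  moreover have "has_velocity E R G J \<phi> X"
    unfolding has_velocity_def using \<phi>e velocity nilsq_hom by simp
  ultimately have "\<phi> = exp_curve E R G ex J X"
    using exponential X J by (simp add: exponential_map_def)
  then show ?thesis
    using exp_curve_tup[OF X idt_hom[OF J] t] \<phi>e[OF idt_hom[OF J] t] idt_right[OF X] by simp
qed

text \<open>Read off from the one-parameter subgroup of \<open>X\<close>, which agrees with
  \<open>X\<close> on nilsquare times. It becomes additivity of scalar multiplication in the
  scalar.\<close>

lemma tapp_add:
  assumes X: "X \<in> Hom E K \<g>" and ab: "a \<in> Nsq K" "b \<in> Nsq K" "a +[K] b \<in> Nsq K"
  shows "app X (a +[K] b) = app X a \<otimes>[K] app X b"
  using ex_add[OF X nilsq_hom[OF ab(1)] nilsq_hom[OF ab(2)]] ex_nilsq[OF X] ab by simp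

lemma tapp_minus:
  assumes X: "X \<in> Hom E K \<g>" and a: "a \<in> Nsq K"
  shows "app X (\<ominus>[K] a) = inv[K] (app X a)"
proof -
  have K: "K \<in> Ob E" using X hom_ob by blast
  interpret A: cring "RR K" using K by (rule ring_at_cring)
  interpret B: group "GG K" using K by (rule group_at_group)
  have z: "\<ominus>[K] a +[K] a = \<zero>[K]" using A.l_neg[of a] nilsq_hom[OF a] by simp
  have "app X (\<ominus>[K] a) \<otimes>[K] app X a = \<one>[K]"
    using tapp_add[OF X nilsq_minus[OF a] a] z zero_nilsq[OF K] tapp_zero[OF X] by simp
  then show ?thesis
    using B.inv_equality tapp_hom[OF X a] tapp_hom[OF X nilsq_minus[OF a]] by simp
qed

section \<open>Addition of tangent vectors\<close>

lemma tapp_pair_cmp: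
  assumes X: "X \<in> Hom E J \<g>" and Y: "Y \<in> Hom E J \<g>" and f: "f \<in> Hom E K J"
    and ab: "a \<in> Nsq K" "b \<in> Nsq K" and h: "h \<in> Hom E L K"
  shows "(app (X \<cdot> f) a \<otimes>[K] app (Y \<cdot> f) b) \<cdot> h = app (X \<cdot> (f \<cdot> h)) (a \<cdot> h) \<otimes>[L] app (Y \<cdot> (f \<cdot> h)) (b \<cdot> h)"
  using group_mult_cmp[OF tapp_hom[OF cmp_hom[OF f X] ab(1)] tapp_hom[OF cmp_hom[OF f Y] ab(2)] h]
    tapp_cmp[OF cmp_hom[OF f X] ab(1) h] tapp_cmp[OF cmp_hom[OF f Y] ab(2) h]
    cmp_assoc[OF h f X] cmp_assoc[OF h f Y] by simp

text \<open>Both products are families on \<open>D(2)\<close>. On each axis one factor is the unit,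
  so they agree there, hence everywhere on \<open>D(2)\<close>.\<close>

lemma tapp_commute:
  assumes X: "X \<in> Hom E K \<g>" and Y: "Y \<in> Hom E K \<g>"
    and ab: "a \<in> Nsq K" "b \<in> Nsq K" "a *[K] b = \<zero>[K]"
  shows "app X a \<otimes>[K] app Y b = app Y b \<otimes>[K] app X a"
proof -
  have K: "K \<in> Ob E" using X hom_ob by blast
  have dom: "Dom E f = L" if "f \<in> Hom E L K" for f L using that hom_dom by blast
  let ?\<Phi> = "\<lambda>f a b. app (X \<cdot> f) a \<otimes>[Dom E f] app (Y \<cdot> f) b"
  let ?\<Phi>' = "\<lambda>f a b. app (Y \<cdot> f) b \<otimes>[Dom E f] app (X \<cdot> f) a"
  have app: "app (Z \<cdot> f) c \<in> Hom E L Gb" if "Z \<in> Hom E K \<g>" "f \<in> Hom E L K" "c \<in> Nsq L" for Z L f c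
    using tapp_hom[OF cmp_hom[OF that(2,1)] that(3)] .
  have "?\<Phi> (Idt E K) a b = ?\<Phi>' (Idt E K) a b"
  proof (rule D2_family_ext[OF K, where \<Phi> = ?\<Phi> and \<Phi>' = ?\<Phi>', OF _ _ _ _ _ _ idt_hom[OF K] ab])
    fix L f a b assume f: "f \<in> Hom E L K" and a: "a \<in> Nsq L" and b: "b \<in> Nsq L"
    have L: "L \<in> Ob E" using f hom_ob by blast
    show "?\<Phi> f a b \<in> Hom E L Gb" "?\<Phi>' f a b \<in> Hom E L Gb"
      using app[OF X f a] app[OF Y f b] L by (simp_all add: dom[OF f])
    fix M h assume h: "h \<in> Hom E M L"
    show "?\<Phi> f a b \<cdot> h = ?\<Phi> (f \<cdot> h) (a \<cdot> h) (b \<cdot> h)" "?\<Phi>' f a b \<cdot> h = ?\<Phi>' (f \<cdot> h) (a \<cdot> h) (b \<cdot> h)"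
      using tapp_pair_cmp[OF X Y f a b h] tapp_pair_cmp[OF Y X f b a h]
      by (simp_all add: dom[OF f] dom[OF cmp_hom[OF h f]])
  next
    fix L f a assume f: "f \<in> Hom E L K" and a: "a \<in> Nsq L"
    show "?\<Phi> f a \<zero>[L] = ?\<Phi>' f a \<zero>[L]" "?\<Phi> f \<zero>[L] a = ?\<Phi>' f \<zero>[L] a"
      using app[OF X f a] app[OF Y f a] tapp_zero[OF cmp_hom[OF f X]] tapp_zero[OF cmp_hom[OF f Y]]
      by (simp_all add: dom[OF f])
  qed
  then show ?thesis
    using dom[OF idt_hom[OF K]] idt_right[OF X] idt_right[OF Y] by simp
qed

text \<open>The family \<open>X_p Y_q\<close> on \<open>D(2)\<close> restricts to \<open>X\<close>
  and \<open>Y\<close> on the axes, so by \<open>D2_ext\<close> it is the map \<open>l\<close> of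
  the definition; the diagonal then gives \<open>X_d Y_d\<close>.\<close>

lemma tadd_spec:
  assumes X: "X \<in> Hom E J \<g>" and Y: "Y \<in> Hom E J \<g>"
  shows tadd_hom: "vadd J X Y \<in> Hom E J \<g>"
    and "f \<in> Hom E K J \<Longrightarrow> d \<in> Nsq K \<Longrightarrow> app (vadd J X Y \<cdot> f) d = app (X \<cdot> f) d \<otimes>[K] app (Y \<cdot> f) d"
proof -
  have J: "J \<in> Ob E" using X hom_ob by blast
  have dom: "Dom E f = K" if "f \<in> Hom E K J" for f K using that hom_dom by blast
  let ?\<Phi> = "\<lambda>f d. app (X \<cdot> f) d \<otimes>[Dom E f] app (Y \<cdot> f) d"
  have app: "app (Z \<cdot> f) d \<in> Hom E K Gb" if "Z \<in> Hom E J \<g>" "f \<in> Hom E K J" "d \<in> Nsq K" for Z K f d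
    using tapp_hom[OF cmp_hom[OF that(2,1)] that(3)] .
  have "\<exists>Z \<in> Hom E J \<g>. \<forall>K. \<forall>f \<in> Hom E K J. \<forall>d \<in> Nsq K. app (Z \<cdot> f) d = ?\<Phi> f d"
  proof (rule tangent_comprehension[OF J])
    fix K f d assume f: "f \<in> Hom E K J" and d: "d \<in> Nsq K"
    have K: "K \<in> Ob E" using f hom_ob by blast
    show "?\<Phi> f d \<in> Hom E K Gb"
      using app[OF X f d] app[OF Y f d] K by (simp add: dom[OF f])
    fix L h assume h: "h \<in> Hom E L K"
    show "?\<Phi> f d \<cdot> h = ?\<Phi> (f \<cdot> h) (d \<cdot> h)"
      using tapp_pair_cmp[OF X Y f d d h] by (simp add: dom[OF f] dom[OF cmp_hom[OF h f]])
  next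
    fix K f assume f: "f \<in> Hom E K J"
    have K: "K \<in> Ob E" using f hom_ob by blast
    show "?\<Phi> f \<zero>[K] = \<one>[K]"
      using tapp_zero[OF cmp_hom[OF f X]] tapp_zero[OF cmp_hom[OF f Y]] K by (simp add: dom[OF f])
  qed
  then obtain W where W: "W \<in> Hom E J \<g>"
    and We: "\<And>K f d. f \<in> Hom E K J \<Longrightarrow> d \<in> Nsq K \<Longrightarrow> app (W \<cdot> f) d = app (X \<cdot> f) d \<otimes>[K] app (Y \<cdot> f) d"
    using dom by fastforce
  define l where "l S p = app (X \<cdot> Pr1 E J S) (p 0 \<cdot> Pr2 E J S) \<otimes>[Prd E J S] app (Y \<cdot> Pr1 E J S) (p 1 \<cdot> Pr2 E J S)"
    for S and p :: "nat \<Rightarrow> 'm"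
  have l: "l S p \<in> Hom E (Prd E J S) Gb"
    and le: "\<And>K f u. f \<in> Hom E K J \<Longrightarrow> u \<in> Hom E K S \<Longrightarrow>
      l S p \<cdot> \<langle>f, u\<rangle> = app (X \<cdot> f) (p 0 \<cdot> u) \<otimes>[K] app (Y \<cdot> f) (p 1 \<cdot> u)"
    and pn: "p 0 \<in> Nsq S" "p 1 \<in> Nsq S"
    if S: "represents E R 2 (D2_point E R) S p" for S p
  proof -
    have So: "S \<in> Ob E" and p: "p 0 \<in> Nsq S" "p 1 \<in> Nsq S"
      using S by (auto simp: represents_def D2_point_def nilsq_def)
    show "p 0 \<in> Nsq S" "p 1 \<in> Nsq S" using p .
    have P: "Prd E J S \<in> Ob E" using J So prd_ob by blast
    note q1 = pr1_hom[OF J So] and q2 = pr2_hom[OF J So]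
    note n = nilsq_cmp[OF p(1) q2] nilsq_cmp[OF p(2) q2]
    show "l S p \<in> Hom E (Prd E J S) Gb" unfolding l_def using app[OF X q1 n(1)] app[OF Y q1 n(2)] P by simp
    fix K f u assume f: "f \<in> Hom E K J" and u: "u \<in> Hom E K S"
    note t = tup_hom[OF f u]
    show "l S p \<cdot> \<langle>f, u\<rangle> = app (X \<cdot> f) (p 0 \<cdot> u) \<otimes>[K] app (Y \<cdot> f) (p 1 \<cdot> u)"
      unfolding l_def tapp_pair_cmp[OF X Y q1 n t] pr1_tup[OF f u] pr2_tup[OF f u]
        cmp_assoc[OF t q2 nilsq_hom[OF p(1)]] cmp_assoc[OF t q2 nilsq_hom[OF p(2)]] by (rule refl)
  qed
  have "vadd J X Y = W"
    unfolding tadd_def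
  proof (rule the_equality, intro conjI W)
    obtain S p where S: "represents E R 2 (D2_point E R) S p" by (rule D2_representable)
    show "\<exists>S p l. represents E R 2 (D2_point E R) S p \<and> l \<in> Hom E (Prd E J S) (gobj G) \<and>
           (\<forall>K. \<forall>f \<in> Hom E K J. \<forall>u \<in> Hom E K S.
              (p 1 \<cdot> u = \<zero>[K] \<longrightarrow> l \<cdot> \<langle>f, u\<rangle> = app (X \<cdot> f) (p 0 \<cdot> u)) \<and>
              (p 0 \<cdot> u = \<zero>[K] \<longrightarrow> l \<cdot> \<langle>f, u\<rangle> = app (Y \<cdot> f) (p 1 \<cdot> u)) \<and>
              (p 0 \<cdot> u = p 1 \<cdot> u \<longrightarrow> l \<cdot> \<langle>f, u\<rangle> = app (W \<cdot> f) (p 0 \<cdot> u)))"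
    proof (intro exI conjI allI ballI impI)
      show "represents E R 2 (D2_point E R) S p" by (rule S)
      show "l S p \<in> Hom E (Prd E J S) Gb" by (rule l[OF S])
      fix K f u assume f: "f \<in> Hom E K J" and u: "u \<in> Hom E K S"
      note n = nilsq_cmp[OF pn(1)[OF S] u] nilsq_cmp[OF pn(2)[OF S] u]
      show "l S p \<cdot> \<langle>f, u\<rangle> = app (X \<cdot> f) (p 0 \<cdot> u)" if "p 1 \<cdot> u = \<zero>[K]"
        using that le[OF S f u] tapp_zero[OF cmp_hom[OF f Y]] app[OF X f n(1)] by simp
      show "l S p \<cdot> \<langle>f, u\<rangle> = app (Y \<cdot> f) (p 1 \<cdot> u)" if "p 0 \<cdot> u = \<zero>[K]"
        using that le[OF S f u] tapp_zero[OF cmp_hom[OF f X]] app[OF Y f n(2)] by simp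
      show "l S p \<cdot> \<langle>f, u\<rangle> = app (W \<cdot> f) (p 0 \<cdot> u)" if "p 0 \<cdot> u = p 1 \<cdot> u"
        using that le[OF S f u] We[OF f n(2)] by simp
    qed
  next
    fix Z assume Z': "Z \<in> Hom E J \<g> \<and> (\<exists>S p l. represents E R 2 (D2_point E R) S p \<and> l \<in> Hom E (Prd E J S) (gobj G) \<and>
           (\<forall>K. \<forall>f \<in> Hom E K J. \<forall>u \<in> Hom E K S.
              (p 1 \<cdot> u = \<zero>[K] \<longrightarrow> l \<cdot> \<langle>f, u\<rangle> = app (X \<cdot> f) (p 0 \<cdot> u)) \<and>
              (p 0 \<cdot> u = \<zero>[K] \<longrightarrow> l \<cdot> \<langle>f, u\<rangle> = app (Y \<cdot> f) (p 1 \<cdot> u)) \<and>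
              (p 0 \<cdot> u = p 1 \<cdot> u \<longrightarrow> l \<cdot> \<langle>f, u\<rangle> = app (Z \<cdot> f) (p 0 \<cdot> u))))"
    then obtain S p l' where S: "represents E R 2 (D2_point E R) S p" and l': "l' \<in> Hom E (Prd E J S) Gb"
      and e: "\<forall>K. \<forall>f \<in> Hom E K J. \<forall>u \<in> Hom E K S.
              (p 1 \<cdot> u = \<zero>[K] \<longrightarrow> l' \<cdot> \<langle>f, u\<rangle> = app (X \<cdot> f) (p 0 \<cdot> u)) \<and>
              (p 0 \<cdot> u = \<zero>[K] \<longrightarrow> l' \<cdot> \<langle>f, u\<rangle> = app (Y \<cdot> f) (p 1 \<cdot> u)) \<and>
              (p 0 \<cdot> u = p 1 \<cdot> u \<longrightarrow> l' \<cdot> \<langle>f, u\<rangle> = app (Z \<cdot> f) (p 0 \<cdot> u))" by blast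
    have Z: "Z \<in> Hom E J \<g>" using Z' by blast
    have "l' = l S p"
    proof (rule D2_ext[OF S J l' l[OF S]])
      fix K f u assume f: "f \<in> Hom E K J" and u: "u \<in> Hom E K S"
        and z: "p 0 \<cdot> u = \<zero>[K] \<or> p 1 \<cdot> u = \<zero>[K]"
      note e' = e[rule_format, OF f u]
      note app' = app[OF X f nilsq_cmp[OF pn(1)[OF S] u]] app[OF Y f nilsq_cmp[OF pn(2)[OF S] u]]
      from z show "l' \<cdot> \<langle>f, u\<rangle> = l S p \<cdot> \<langle>f, u\<rangle>"
      proof
        assume *: "p 0 \<cdot> u = \<zero>[K]"
        with e' have "l' \<cdot> \<langle>f, u\<rangle> = app (Y \<cdot> f) (p 1 \<cdot> u)" by blast
        then show ?thesis unfolding le[OF S f u] using * tapp_zero[OF cmp_hom[OF f X]] app'(2) by simp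
      next
        assume *: "p 1 \<cdot> u = \<zero>[K]"
        with e' have "l' \<cdot> \<langle>f, u\<rangle> = app (X \<cdot> f) (p 0 \<cdot> u)" by blast
        then show ?thesis unfolding le[OF S f u] using * tapp_zero[OF cmp_hom[OF f Y]] app'(1) by simp
      qed
    qed
    show "Z = W"
    proof (rule tangent_ext[OF Z W])
      fix K f d assume f: "f \<in> Hom E K J" and d: "d \<in> Nsq K"
      \<comment> \<open>The diagonal point lies in \<open>D(2)\<close> because all its coordinate
        products are the square of \<open>d\<close>.\<close>
      obtain u where u: "u \<in> Hom E K S" "p 0 \<cdot> u = d" "p 1 \<cdot> u = d"
        using D2_elem[OF S d d nilsq_square[OF d]] by blast
      show "app (Z \<cdot> f) d = app (W \<cdot> f) d"
        using e[rule_format, OF f u(1)] u le[OF S f u(1)] \<open>l' = l S p\<close> We[OF f d] by simp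
    qed
  qed
  with W We show "vadd J X Y \<in> Hom E J \<g>"
    "f \<in> Hom E K J \<Longrightarrow> d \<in> Nsq K \<Longrightarrow> app (vadd J X Y \<cdot> f) d = app (X \<cdot> f) d \<otimes>[K] app (Y \<cdot> f) d"
    by auto
qed

lemma tapp_tadd:
  assumes "X \<in> Hom E K \<g>" "Y \<in> Hom E K \<g>" "d \<in> Nsq K"
  shows "app (vadd K X Y) d = app X d \<otimes>[K] app Y d"
  using tadd_spec(2)[OF assms(1,2) idt_hom[OF nilsq_ob[OF assms(3)]] assms(3)]
    idt_right[OF assms(1)] idt_right[OF assms(2)] idt_right[OF tadd_hom[OF assms(1,2)]] by simp

lemma tadd_cmp:
  assumes X: "X \<in> Hom E J \<g>" and Y: "Y \<in> Hom E J \<g>" and f: "f \<in> Hom E K J"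
  shows "vadd J X Y \<cdot> f = vadd K (X \<cdot> f) (Y \<cdot> f)"
proof (rule tangent_ext[OF cmp_hom[OF f tadd_hom[OF X Y]] tadd_hom[OF cmp_hom[OF f X] cmp_hom[OF f Y]]])
  fix L h d assume h: "h \<in> Hom E L K" and d: "d \<in> Nsq L"
  show "app ((vadd J X Y \<cdot> f) \<cdot> h) d = app (vadd K (X \<cdot> f) (Y \<cdot> f) \<cdot> h) d"
    using tadd_spec(2)[OF X Y cmp_hom[OF h f] d] tadd_spec(2)[OF cmp_hom[OF f X] cmp_hom[OF f Y] h d]
      cmp_assoc[OF h f tadd_hom[OF X Y]] cmp_assoc[OF h f Y] cmp_assoc[OF h f X] by simp
qed

lemma lie_algebra_at_simps:
  "carrier (gg J) = Hom E J \<g>" "add (gg J) = vadd J" "zero (gg J) = tzero E R G J"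
  "smult (gg J) = smul J"
  by (simp_all add: lie_algebra_at_def)

lemma tzero_cmp:
  assumes f: "f \<in> Hom E K J"
  shows "tzero E R G J \<cdot> f = tzero E R G K"
proof -
  have J: "J \<in> Ob E" and K: "K \<in> Ob E" using f hom_ob by blast+
  show ?thesis
  proof (rule tangent_ext[OF cmp_hom[OF f tzero_hom[OF J]] tzero_hom[OF K]])
    fix L h d assume h: "h \<in> Hom E L K" and d: "d \<in> Nsq L"
    show "app ((tzero E R G J \<cdot> f) \<cdot> h) d = app (tzero E R G K \<cdot> h) d"
      using tzero_spec(2)[OF J cmp_hom[OF h f] d] tzero_spec(2)[OF K h d] cmp_assoc[OF h f tzero_hom[OF J]] by simp
  qed
qed

text \<open>Everything is checked pointwise in the group: commutativity comes from
  \<open>tapp_commute\<close> with both parameters equal, additivity in the scalar from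
  \<open>tapp_add\<close>, and multiplication by -1 provides the negatives.\<close>

lemma lie_module:
  assumes J: "J \<in> Ob E"
  shows "module (RR J) (gg J)"
proof (rule moduleI)
  show "cring (RR J)" using J by (rule ring_at_cring)
  note ext = tangent_ext[OF tadd_hom tadd_hom]
  show "abelian_group (gg J)"
  proof (rule abelian_groupI; unfold lie_algebra_at_simps)
    show "vadd J X Y \<in> Hom E J \<g>" if "X \<in> Hom E J \<g>" "Y \<in> Hom E J \<g>" for X Y
      using that by (rule tadd_hom)
    show "tzero E R G J \<in> Hom E J \<g>" using J by (rule tzero_hom)
    show "vadd J (vadd J X Y) Z = vadd J X (vadd J Y Z)"
      if X: "X \<in> Hom E J \<g>" and Y: "Y \<in> Hom E J \<g>" and Z: "Z \<in> Hom E J \<g>" for X Y Z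
    proof (rule ext)
      fix K f d assume f: "f \<in> Hom E K J" and d: "d \<in> Nsq K"
      interpret group "GG K" using nilsq_ob[OF d] by (rule group_at_group)
      note xs = cmp_hom[OF f X] cmp_hom[OF f Y] cmp_hom[OF f Z]
      show "app (vadd J (vadd J X Y) Z \<cdot> f) d = app (vadd J X (vadd J Y Z) \<cdot> f) d"
        using X Y Z f d xs m_assoc tapp_hom[OF _ d] by (simp add: tadd_cmp tapp_tadd tadd_hom)
    qed (use X Y Z tadd_hom in auto)
    show "vadd J X Y = vadd J Y X" if X: "X \<in> Hom E J \<g>" and Y: "Y \<in> Hom E J \<g>" for X Y
    proof (rule ext)
      fix K f d assume f: "f \<in> Hom E K J" and d: "d \<in> Nsq K"
      note xs = cmp_hom[OF f X] cmp_hom[OF f Y]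
      show "app (vadd J X Y \<cdot> f) d = app (vadd J Y X \<cdot> f) d"
        using X Y f d xs tapp_commute[OF xs d d nilsq_square[OF d]] by (simp add: tadd_cmp tapp_tadd)
    qed (use X Y in auto)
    show "vadd J (tzero E R G J) X = X" if X: "X \<in> Hom E J \<g>" for X
    proof (rule tangent_ext[OF tadd_hom[OF tzero_hom[OF J] X] X])
      fix K f d assume f: "f \<in> Hom E K J" and d: "d \<in> Nsq K"
      show "app (vadd J (tzero E R G J) X \<cdot> f) d = app (X \<cdot> f) d"
        using tadd_cmp[OF tzero_hom[OF J] X f] tzero_cmp[OF f] cmp_hom[OF f X] d tapp_hom[OF cmp_hom[OF f X] d]
          tzero_hom[OF nilsq_ob[OF d]]
        by (simp add: tapp_tadd tapp_tzero)
    qed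
    show "\<exists>Y\<in>Hom E J \<g>. vadd J Y X = tzero E R G J" if X: "X \<in> Hom E J \<g>" for X
    proof (rule bexI)
      let ?m = "\<ominus>[J] \<one>\<^sub>R[J]"
      have m: "?m \<in> Hom E J Rb" using J by simp
      show Y: "smul J ?m X \<in> Hom E J \<g>" using tsmult_hom[OF m X] .
      show "vadd J (smul J ?m X) X = tzero E R G J"
      proof (rule tangent_ext[OF tadd_hom[OF Y X] tzero_hom[OF J]])
        fix K f d assume f: "f \<in> Hom E K J" and d: "d \<in> Nsq K"
        interpret A: cring "RR K" using nilsq_ob[OF d] by (rule ring_at_cring)
        interpret B: group "GG K" using nilsq_ob[OF d] by (rule group_at_group)
        have mf: "?m \<cdot> f = \<ominus>[K] \<one>\<^sub>R[K]"
          using ring_minus_cmp[OF f, of "\<one>\<^sub>R[J]"] ring_one_cmp[OF f] J by simp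
        have md: "(\<ominus>[K] \<one>\<^sub>R[K]) *[K] d = \<ominus>[K] d"
          using A.l_minus[of "\<one>\<^sub>R[K]" d] nilsq_hom[OF d] nilsq_ob[OF d] by simp
        have "app (smul J ?m X \<cdot> f) d = inv[K] (app (X \<cdot> f) d)"
          using tsmult_spec(2)[OF m X f d] mf md tapp_minus[OF cmp_hom[OF f X] d] by simp
        then show "app (vadd J (smul J ?m X) X \<cdot> f) d = app (tzero E R G J \<cdot> f) d"
          using tadd_spec(2)[OF Y X f d] tzero_spec(2)[OF J f d] B.l_inv tapp_hom[OF cmp_hom[OF f X] d] by simp
      qed
    qed
  qed
  have at: "(a \<cdot> f) *[K] d \<in> Nsq K"
    if "a \<in> Hom E J Rb" "f \<in> Hom E K J" "d \<in> Nsq K" for a K f d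
    using nilsq_smult[OF that(3) cmp_hom[OF that(2,1)]] .
  show "(a +[J] b) \<odot>\<^bsub>gg J\<^esub> X = (a \<odot>\<^bsub>gg J\<^esub> X) \<oplus>\<^bsub>gg J\<^esub> (b \<odot>\<^bsub>gg J\<^esub> X)"
    if a': "a \<in> carrier (RR J)" and b': "b \<in> carrier (RR J)" and X': "X \<in> carrier (gg J)" for a b X
  proof -
    have a: "a \<in> Hom E J Rb" using a' by simp
    have b: "b \<in> Hom E J Rb" using b' by simp
    have ab: "a +[J] b \<in> Hom E J Rb" "a *[J] b \<in> Hom E J Rb" using a b J by simp_all
    have X: "X \<in> Hom E J \<g>" using X' by (simp add: lie_algebra_at_simps)
    note sX = tsmult_hom[OF a X] tsmult_hom[OF b X]
    show ?thesis
      unfolding lie_algebra_at_simps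
    proof (rule tangent_ext[OF tsmult_hom[OF ab(1) X] tadd_hom[OF sX]])
      fix K f d assume f: "f \<in> Hom E K J" and d: "d \<in> Nsq K"
      interpret A: cring "RR K" using nilsq_ob[OF d] by (rule ring_at_cring)
      have e: "((a +[J] b) \<cdot> f) *[K] d = (a \<cdot> f) *[K] d +[K] (b \<cdot> f) *[K] d"
        using ring_add_cmp[OF a b f] A.l_distr[of "a \<cdot> f" "b \<cdot> f" d] cmp_hom[OF f a] cmp_hom[OF f b] nilsq_hom[OF d] by simp
      have n: "(a \<cdot> f) *[K] d +[K] (b \<cdot> f) *[K] d \<in> Nsq K"
        using nilsq_smult[OF d cmp_hom[OF f ab(1)]] e by simp
      show "app (smul J (a +[J] b) X \<cdot> f) d = app (vadd J (smul J a X) (smul J b X) \<cdot> f) d"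
        using tsmult_spec(2)[OF ab(1) X f d] e tadd_spec(2)[OF sX f d] tsmult_spec(2)[OF a X f d]
          tsmult_spec(2)[OF b X f d] tapp_add[OF cmp_hom[OF f X] at[OF a f d] at[OF b f d] n] by simp
    qed
  qed
  show "a \<odot>\<^bsub>gg J\<^esub> (X \<oplus>\<^bsub>gg J\<^esub> Y) = (a \<odot>\<^bsub>gg J\<^esub> X) \<oplus>\<^bsub>gg J\<^esub> (a \<odot>\<^bsub>gg J\<^esub> Y)"
    if a': "a \<in> carrier (RR J)" and X': "X \<in> carrier (gg J)" and Y': "Y \<in> carrier (gg J)" for a X Y
  proof -
    have a: "a \<in> Hom E J Rb" using a' by simp
    have X: "X \<in> Hom E J \<g>" using X' by (simp add: lie_algebra_at_simps)
    have Y: "Y \<in> Hom E J \<g>" using Y' by (simp add: lie_algebra_at_simps)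
    note sX = tsmult_hom[OF a X] tsmult_hom[OF a Y]
    show ?thesis
      unfolding lie_algebra_at_simps
    proof (rule tangent_ext[OF tsmult_hom[OF a tadd_hom[OF X Y]] tadd_hom[OF sX]])
      fix K f d assume f: "f \<in> Hom E K J" and d: "d \<in> Nsq K"
      show "app (smul J a (vadd J X Y) \<cdot> f) d = app (vadd J (smul J a X) (smul J a Y) \<cdot> f) d"
        using tsmult_spec(2)[OF a tadd_hom[OF X Y] f d] tadd_spec(2)[OF X Y f at[OF a f d]]
          tadd_spec(2)[OF sX f d] tsmult_spec(2)[OF a X f d] tsmult_spec(2)[OF a Y f d] by simp
    qed
  qed
  show "(a *[J] b) \<odot>\<^bsub>gg J\<^esub> X = a \<odot>\<^bsub>gg J\<^esub> (b \<odot>\<^bsub>gg J\<^esub> X)"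
    if a': "a \<in> carrier (RR J)" and b': "b \<in> carrier (RR J)" and X': "X \<in> carrier (gg J)" for a b X
  proof -
    have a: "a \<in> Hom E J Rb" using a' by simp
    have b: "b \<in> Hom E J Rb" using b' by simp
    have ab: "a +[J] b \<in> Hom E J Rb" "a *[J] b \<in> Hom E J Rb" using a b J by simp_all
    have X: "X \<in> Hom E J \<g>" using X' by (simp add: lie_algebra_at_simps)
    note sX = tsmult_hom[OF a X] tsmult_hom[OF b X]
    show ?thesis
      unfolding lie_algebra_at_simps
    proof (rule tangent_ext[OF tsmult_hom[OF ab(2) X] tsmult_hom[OF a sX(2)]])
      fix K f d assume f: "f \<in> Hom E K J" and d: "d \<in> Nsq K"
      interpret A: cring "RR K" using nilsq_ob[OF d] by (rule ring_at_cring)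
      \<comment> \<open>Scalars act on the argument, so the outer one meets \<open>d\<close> first:
        the value of \<open>a (b X)\<close> at \<open>d\<close> is that of \<open>X\<close> at
        \<open>b (a d)\<close>.\<close>
      have e: "((a *[J] b) \<cdot> f) *[K] d = (b \<cdot> f) *[K] ((a \<cdot> f) *[K] d)"
        using ring_mult_cmp[OF a b f] A.m_assoc[of "b \<cdot> f" "a \<cdot> f" d] A.m_comm[of "b \<cdot> f" "a \<cdot> f"]
          cmp_hom[OF f a] cmp_hom[OF f b] nilsq_hom[OF d] by simp
      show "app (smul J (a *[J] b) X \<cdot> f) d = app (smul J a (smul J b X) \<cdot> f) d"
        using tsmult_spec(2)[OF ab(2) X f d] e tsmult_spec(2)[OF a sX(2) f d] tsmult_spec(2)[OF b X f at[OF a f d]]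
        by simp
    qed
  qed
  show "\<one>\<^sub>R[J] \<odot>\<^bsub>gg J\<^esub> X = X"
    if X': "X \<in> carrier (gg J)" for X
  proof -
    have X: "X \<in> Hom E J \<g>" using X' by (simp add: lie_algebra_at_simps)
    show ?thesis
      unfolding lie_algebra_at_simps
    proof (rule tangent_ext[OF tsmult_hom[OF _ X] X])
      show o: "\<one>\<^sub>R[J] \<in> Hom E J Rb" using J by simp
      fix K f d assume f: "f \<in> Hom E K J" and d: "d \<in> Nsq K"
      show "app (smul J \<one>\<^sub>R[J] X \<cdot> f) d = app (X \<cdot> f) d"
        using tsmult_spec(2)[OF o X f d] ring_one_cmp[OF f] nilsq_hom[OF d] by simp
    qed
  qed
qed (auto simp: lie_algebra_at_simps intro: tsmult_hom)

section \<open>The Lie bracket and the adjoint action\<close>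

text \<open>A group commutator is trivial as soon as one of its entries is, so
  \<open>DD_family_factor\<close> turns it into a tangent vector, and \<open>tangent_ext_DD\<close>
  shows that no other one fits.\<close>

lemma lie_bracket_spec:
  assumes X: "X \<in> Hom E J \<g>" and Y: "Y \<in> Hom E J \<g>"
  shows lie_bracket_hom: "brac J X Y \<in> Hom E J \<g>"
    and "f \<in> Hom E K J \<Longrightarrow> a \<in> Nsq K \<Longrightarrow> b \<in> Nsq K \<Longrightarrow>
      app (brac J X Y \<cdot> f) (a *[K] b) =
        app (X \<cdot> f) a \<otimes>[K] app (Y \<cdot> f) b \<otimes>[K] app (X \<cdot> f) (\<ominus>[K] a) \<otimes>[K] app (Y \<cdot> f) (\<ominus>[K] b)"
proof -
  have J: "J \<in> Ob E" using X hom_ob by blast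
  have dom: "Dom E f = K" if "f \<in> Hom E K J" for f K using that hom_dom by blast
  let ?\<Phi> = "\<lambda>f a b. let K = Dom E f in
    app (X \<cdot> f) a \<otimes>[K] app (Y \<cdot> f) b \<otimes>[K] app (X \<cdot> f) (\<ominus>[K] a) \<otimes>[K] app (Y \<cdot> f) (\<ominus>[K] b)"
  have app: "app (Z \<cdot> f) a \<in> Hom E K Gb" if "Z \<in> Hom E J \<g>" "f \<in> Hom E K J" "a \<in> Nsq K" for Z K f a
    using tapp_hom[OF cmp_hom[OF that(2,1)] that(3)] .
  have "\<exists>Z \<in> Hom E J \<g>. \<forall>K. \<forall>f \<in> Hom E K J. \<forall>a \<in> Nsq K. \<forall>b \<in> Nsq K.
    app (Z \<cdot> f) (a *[K] b) = ?\<Phi> f a b"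
  proof (rule DD_family_factor[OF J])
    fix K f a b assume f: "f \<in> Hom E K J" and ab: "a \<in> Nsq K" "b \<in> Nsq K"
    have K: "K \<in> Ob E" using f hom_ob by blast
    note ab' = nilsq_minus[OF ab(1)] nilsq_minus[OF ab(2)]
    note G = app[OF X f ab(1)] app[OF Y f ab(2)] app[OF X f ab'(1)] app[OF Y f ab'(2)]
    show "?\<Phi> f a b \<in> Hom E K Gb" using G K by (simp add: dom[OF f] Let_def)
    fix L h assume h: "h \<in> Hom E L K"
    have "?\<Phi> f a b \<cdot> h = (app (X \<cdot> f) a \<otimes>[K] app (Y \<cdot> f) b) \<cdot> h \<otimes>[L] app (X \<cdot> f) (\<ominus>[K] a) \<cdot> h
        \<otimes>[L] app (Y \<cdot> f) (\<ominus>[K] b) \<cdot> h"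
      using G K by (simp add: dom[OF f] Let_def group_mult_cmp[OF _ _ h])
    also have "\<dots> = ?\<Phi> (f \<cdot> h) (a \<cdot> h) (b \<cdot> h)"
      using tapp_pair_cmp[OF X Y f ab h] tapp_cmp[OF cmp_hom[OF f X] ab'(1) h] tapp_cmp[OF cmp_hom[OF f Y] ab'(2) h]
        cmp_assoc[OF h f X] cmp_assoc[OF h f Y] ring_minus_cmp[OF h nilsq_hom[OF ab(1)]]
        ring_minus_cmp[OF h nilsq_hom[OF ab(2)]]
      by (simp add: dom[OF cmp_hom[OF h f]] Let_def)
    finally show "?\<Phi> f a b \<cdot> h = ?\<Phi> (f \<cdot> h) (a \<cdot> h) (b \<cdot> h)" .
  next
    fix K f a assume f: "f \<in> Hom E K J" and a: "a \<in> Nsq K"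
    have K: "K \<in> Ob E" using f hom_ob by blast
    interpret A: cring "RR K" using K by (rule ring_at_cring)
    interpret B: group "GG K" using K by (rule group_at_group)
    note z = A.minus_zero and G = app[OF X f a] app[OF Y f a] and t = tapp_zero[OF cmp_hom[OF f X]] tapp_zero[OF cmp_hom[OF f Y]]
    show "?\<Phi> f a \<zero>[K] = \<one>[K]" "?\<Phi> f \<zero>[K] a = \<one>[K]"
      using z G t tapp_minus[OF cmp_hom[OF f X] a] tapp_minus[OF cmp_hom[OF f Y] a] K
        B.r_inv[of "app (X \<cdot> f) a"] B.r_inv[of "app (Y \<cdot> f) a"]
      by (simp_all add: dom[OF f] Let_def)
  qed
  then obtain W where W: "W \<in> Hom E J \<g>" and We': "\<forall>K. \<forall>f \<in> Hom E K J. \<forall>a \<in> Nsq K. \<forall>b \<in> Nsq K.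
    app (W \<cdot> f) (a *[K] b) = ?\<Phi> f a b" by blast
  have We: "app (W \<cdot> f) (a *[K] b) =
      app (X \<cdot> f) a \<otimes>[K] app (Y \<cdot> f) b \<otimes>[K] app (X \<cdot> f) (\<ominus>[K] a) \<otimes>[K] app (Y \<cdot> f) (\<ominus>[K] b)"
    if "f \<in> Hom E K J" "a \<in> Nsq K" "b \<in> Nsq K" for K f a b
    unfolding We'[rule_format, OF that] Let_def dom[OF that(1)] by (rule refl)
  have "brac J X Y = W"
    unfolding lie_bracket_def
  proof (rule the_equality)
    fix Z assume Z: "Z \<in> Hom E J \<g> \<and>
        (\<forall>K. \<forall>f \<in> Hom E K J. \<forall>d\<^sub>1 \<in> Nsq K. \<forall>d\<^sub>2 \<in> Nsq K.
           app (Z \<cdot> f) (d\<^sub>1 *[K] d\<^sub>2) =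
             app (X \<cdot> f) d\<^sub>1 \<otimes>[K] app (Y \<cdot> f) d\<^sub>2 \<otimes>[K]
             app (X \<cdot> f) (\<ominus>[K] d\<^sub>1) \<otimes>[K] app (Y \<cdot> f) (\<ominus>[K] d\<^sub>2))"
    show "Z = W"
    proof (rule tangent_ext_DD[OF conjunct1[OF Z] W])
      show "app (Z \<cdot> f) (a *[K] b) = app (W \<cdot> f) (a *[K] b)"
        if "f \<in> Hom E K J" "a \<in> Nsq K" "b \<in> Nsq K" for K f a b
        unfolding We[OF that] using conjunct2[OF Z] that by blast
    qed
  qed (use W We in blast)
  with W We show "brac J X Y \<in> Hom E J \<g>"
    "f \<in> Hom E K J \<Longrightarrow> a \<in> Nsq K \<Longrightarrow> b \<in> Nsq K \<Longrightarrow>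
      app (brac J X Y \<cdot> f) (a *[K] b) =
        app (X \<cdot> f) a \<otimes>[K] app (Y \<cdot> f) b \<otimes>[K] app (X \<cdot> f) (\<ominus>[K] a) \<otimes>[K] app (Y \<cdot> f) (\<ominus>[K] b)"
    by auto
qed

lemma tapp_lie_bracket:
  assumes X: "X \<in> Hom E K \<g>" and Y: "Y \<in> Hom E K \<g>" and ab: "a \<in> Nsq K" "b \<in> Nsq K"
  shows "app (brac K X Y) (a *[K] b) =
    app X a \<otimes>[K] app Y b \<otimes>[K] inv[K] (app X a) \<otimes>[K] inv[K] (app Y b)"
  using lie_bracket_spec(2)[OF X Y idt_hom[OF nilsq_ob[OF ab(1)]] ab] idt_right[OF X] idt_right[OF Y]
    idt_right[OF lie_bracket_hom[OF X Y]] tapp_minus[OF X ab(1)] tapp_minus[OF Y ab(2)] by simp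

lemma lie_bracket_cmp:
  assumes X: "X \<in> Hom E J \<g>" and Y: "Y \<in> Hom E J \<g>" and f: "f \<in> Hom E K J"
  shows "brac J X Y \<cdot> f = brac K (X \<cdot> f) (Y \<cdot> f)"
proof (rule tangent_ext_DD[OF cmp_hom[OF f lie_bracket_hom[OF X Y]] lie_bracket_hom[OF cmp_hom[OF f X] cmp_hom[OF f Y]]])
  fix L h a b assume h: "h \<in> Hom E L K" and ab: "a \<in> Nsq L" "b \<in> Nsq L"
  show "app ((brac J X Y \<cdot> f) \<cdot> h) (a *[L] b) =
      app (brac K (X \<cdot> f) (Y \<cdot> f) \<cdot> h) (a *[L] b)"
    using lie_bracket_spec(2)[OF X Y cmp_hom[OF h f] ab]
      lie_bracket_spec(2)[OF cmp_hom[OF f X] cmp_hom[OF f Y] h ab]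
      cmp_assoc[OF h f lie_bracket_hom[OF X Y]] cmp_assoc[OF h f Y] cmp_assoc[OF h f X] by simp
qed

text \<open>Conjugation \<open>g W g^-1 = W'\<close>, written without inverses. As a relation it
  lets one conjugate be described in several ways, which \<open>adj_unique\<close> then equates;
  this is how the laws of the bracket are obtained.\<close>

definition adj :: "'o \<Rightarrow> 'm \<Rightarrow> 'm \<Rightarrow> 'm \<Rightarrow> bool" where
  "adj J g W W' \<longleftrightarrow> g \<in> Hom E J Gb \<and> W \<in> Hom E J \<g> \<and> W' \<in> Hom E J \<g> \<and>
    (\<forall>K. \<forall>f \<in> Hom E K J. \<forall>d \<in> Nsq K.
      (g \<cdot> f) \<otimes>[K] app (W \<cdot> f) d = app (W' \<cdot> f) d \<otimes>[K] (g \<cdot> f))"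

lemma adjD:
  assumes "adj J g W W'"
  shows "g \<in> Hom E J Gb" "W \<in> Hom E J \<g>" "W' \<in> Hom E J \<g>"
    and "f \<in> Hom E K J \<Longrightarrow> d \<in> Nsq K \<Longrightarrow> (g \<cdot> f) \<otimes>[K] app (W \<cdot> f) d = app (W' \<cdot> f) d \<otimes>[K] (g \<cdot> f)"
  using assms by (simp_all add: adj_def)

lemma adj_tapp_commute:
  assumes "adj J g W W'" "d \<in> Nsq J"
  shows "g \<otimes>[J] app W d = app W' d \<otimes>[J] g"
  using adjD(4)[OF assms(1) idt_hom[OF nilsq_ob[OF assms(2)]] assms(2)] adjD(1-3)[OF assms(1)] idt_right by simp

lemma adj_unique:
  assumes "adj J g W W'" "adj J g W W''"
  shows "W' = W''"
proof (rule tangent_ext[OF adjD(3)[OF assms(1)] adjD(3)[OF assms(2)]])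
  fix K f d assume f: "f \<in> Hom E K J" and d: "d \<in> Nsq K"
  interpret group "GG K" using nilsq_ob[OF d] by (rule group_at_group)
  have "app (W' \<cdot> f) d \<otimes>[K] (g \<cdot> f) = app (W'' \<cdot> f) d \<otimes>[K] (g \<cdot> f)"
    using adjD(4)[OF assms(1) f d] adjD(4)[OF assms(2) f d] by simp
  then show "app (W' \<cdot> f) d = app (W'' \<cdot> f) d"
    using tapp_hom[OF cmp_hom[OF f adjD(3)[OF assms(1)]] d] tapp_hom[OF cmp_hom[OF f adjD(3)[OF assms(2)]] d]
      cmp_hom[OF f adjD(1)[OF assms(1)]] by simp
qed

lemma adj_exists:
  assumes g: "g \<in> Hom E J Gb" and W: "W \<in> Hom E J \<g>"
  shows "\<exists>W'. adj J g W W'"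
proof -
  have J: "J \<in> Ob E" using g hom_ob by blast
  have dom: "Dom E f = K" if "f \<in> Hom E K J" for f K using that hom_dom by blast
  let ?\<Phi> = "\<lambda>f d. (g \<cdot> f) \<otimes>[Dom E f] app (W \<cdot> f) d \<otimes>[Dom E f] inv[Dom E f] (g \<cdot> f)"
  have "\<exists>Z \<in> Hom E J \<g>. \<forall>K. \<forall>f \<in> Hom E K J. \<forall>d \<in> Nsq K. app (Z \<cdot> f) d = ?\<Phi> f d"
  proof (rule tangent_comprehension[OF J])
    fix K f d assume f: "f \<in> Hom E K J" and d: "d \<in> Nsq K"
    have K: "K \<in> Ob E" using f hom_ob by blast
    note G = cmp_hom[OF f g] tapp_hom[OF cmp_hom[OF f W] d]
    show "?\<Phi> f d \<in> Hom E K Gb" using G K by (simp add: dom[OF f])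
    fix L h assume h: "h \<in> Hom E L K"
    have L: "L \<in> Ob E" using h hom_ob by blast
    interpret K: group "GG K" using K by (rule group_at_group)
    interpret L: group "GG L" using L by (rule group_at_group)
    \<comment> \<open>A group object carries no arrow for inversion, so that inversion commutes with
      restriction is derived from uniqueness of inverses.\<close>
    have "(inv[K] (g \<cdot> f)) \<cdot> h \<otimes>[L] (g \<cdot> f) \<cdot> h = \<one>[L]"
      using group_mult_cmp[OF group_closed(3)[OF K G(1)] G(1) h] K.l_inv[of "g \<cdot> f"] G(1) group_one_cmp[OF h] by simp
    then have "inv[L] ((g \<cdot> f) \<cdot> h) = (inv[K] (g \<cdot> f)) \<cdot> h"
      using L.inv_equality cmp_hom[OF h G(1)] cmp_hom[OF h group_closed(3)[OF K G(1)]] by simp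
    then show "?\<Phi> f d \<cdot> h = ?\<Phi> (f \<cdot> h) (d \<cdot> h)"
      using G K cmp_assoc[OF h f g] cmp_assoc[OF h f W] tapp_cmp[OF cmp_hom[OF f W] d h]
      by (simp add: dom[OF f] dom[OF cmp_hom[OF h f]] group_mult_cmp[OF _ _ h])
  next
    fix K f assume f: "f \<in> Hom E K J"
    have K: "K \<in> Ob E" using f hom_ob by blast
    interpret K: group "GG K" using K by (rule group_at_group)
    show "?\<Phi> f \<zero>[K] = \<one>[K]"
      using tapp_zero[OF cmp_hom[OF f W]] cmp_hom[OF f g] K.r_inv[of "g \<cdot> f"] by (simp add: dom[OF f])
  qed
  then obtain W' where W': "W' \<in> Hom E J \<g>"
    and e: "\<forall>K. \<forall>f \<in> Hom E K J. \<forall>d \<in> Nsq K. app (W' \<cdot> f) d = ?\<Phi> f d" by blast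
  have "(g \<cdot> f) \<otimes>[K] app (W \<cdot> f) d = app (W' \<cdot> f) d \<otimes>[K] (g \<cdot> f)"
    if f: "f \<in> Hom E K J" and d: "d \<in> Nsq K" for K f d
  proof -
    interpret K: group "GG K" using nilsq_ob[OF d] by (rule group_at_group)
    show ?thesis
      using e[rule_format, OF f d] cmp_hom[OF f g] tapp_hom[OF cmp_hom[OF f W] d] nilsq_ob[OF d]
        K.m_assoc[of "(g \<cdot> f) \<otimes>[K] app (W \<cdot> f) d" "inv[K] (g \<cdot> f)" "g \<cdot> f"] K.l_inv[of "g \<cdot> f"]
      by (simp add: dom[OF f])
  qed
  then show ?thesis using g W W' by (auto simp: adj_def)
qed

lemma adj_mult:
  assumes "adj J g W W'" "adj J h W' W''"
  shows "adj J (h \<otimes>[J] g) W W''"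
  unfolding adj_def
proof (intro conjI allI ballI)
  note g = adjD[OF assms(1)] and h = adjD[OF assms(2)]
  show "h \<otimes>[J] g \<in> Hom E J Gb" using g(1) h(1) hom_ob by simp
  show "W \<in> Hom E J \<g>" "W'' \<in> Hom E J \<g>" using g h by blast+
  fix K f d assume f: "f \<in> Hom E K J" and d: "d \<in> Nsq K"
  interpret K: group "GG K" using nilsq_ob[OF d] by (rule group_at_group)
  have c: "g \<cdot> f \<in> carrier (GG K)" "h \<cdot> f \<in> carrier (GG K)" "app (W \<cdot> f) d \<in> carrier (GG K)"
    "app (W' \<cdot> f) d \<in> carrier (GG K)" "app (W'' \<cdot> f) d \<in> carrier (GG K)"
    using cmp_hom[OF f g(1)] cmp_hom[OF f h(1)] tapp_hom[OF cmp_hom[OF f g(2)] d]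
      tapp_hom[OF cmp_hom[OF f h(2)] d] tapp_hom[OF cmp_hom[OF f h(3)] d] by simp_all
  show "((h \<otimes>[J] g) \<cdot> f) \<otimes>[K] app (W \<cdot> f) d = app (W'' \<cdot> f) d \<otimes>[K] ((h \<otimes>[J] g) \<cdot> f)"
    unfolding group_mult_cmp[OF h(1) g(1) f]
    using g(4)[OF f d] h(4)[OF f d] c K.m_assoc by metis
qed

lemma adj_add:
  assumes "adj J g W W'" "adj J g V V'"
  shows "adj J g (vadd J W V) (vadd J W' V')"
  unfolding adj_def
proof (intro conjI allI ballI)
  note g = adjD[OF assms(1)] and h = adjD[OF assms(2)]
  show "g \<in> Hom E J Gb" "vadd J W V \<in> Hom E J \<g>" "vadd J W' V' \<in> Hom E J \<g>"
    using g h tadd_hom by blast+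
  fix K f d assume f: "f \<in> Hom E K J" and d: "d \<in> Nsq K"
  interpret K: group "GG K" using nilsq_ob[OF d] by (rule group_at_group)
  have c: "g \<cdot> f \<in> carrier (GG K)" "app (W \<cdot> f) d \<in> carrier (GG K)" "app (V \<cdot> f) d \<in> carrier (GG K)"
    "app (W' \<cdot> f) d \<in> carrier (GG K)" "app (V' \<cdot> f) d \<in> carrier (GG K)"
    using cmp_hom[OF f g(1)] tapp_hom[OF cmp_hom[OF f g(2)] d] tapp_hom[OF cmp_hom[OF f g(3)] d]
      tapp_hom[OF cmp_hom[OF f h(2)] d] tapp_hom[OF cmp_hom[OF f h(3)] d] by simp_all
  show "(g \<cdot> f) \<otimes>[K] app (vadd J W V \<cdot> f) d = app (vadd J W' V' \<cdot> f) d \<otimes>[K] (g \<cdot> f)"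
    unfolding tadd_spec(2)[OF g(2) h(2) f d] tadd_spec(2)[OF g(3) h(3) f d]
    using g(4)[OF f d] h(4)[OF f d] c K.m_assoc by metis
qed

lemma adj_smult:
  assumes "adj J g W W'" and r: "r \<in> Hom E J Rb"
  shows "adj J g (smul J r W) (smul J r W')"
  unfolding adj_def
proof (intro conjI allI ballI)
  note g = adjD[OF assms(1)]
  show "g \<in> Hom E J Gb" "smul J r W \<in> Hom E J \<g>" "smul J r W' \<in> Hom E J \<g>"
    using g r tsmult_hom by blast+
  fix K f d assume f: "f \<in> Hom E K J" and d: "d \<in> Nsq K"
  show "(g \<cdot> f) \<otimes>[K] app (smul J r W \<cdot> f) d = app (smul J r W' \<cdot> f) d \<otimes>[K] (g \<cdot> f)"
    unfolding tsmult_spec(2)[OF r g(2) f d] tsmult_spec(2)[OF r g(3) f d]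
    by (rule g(4)[OF f nilsq_smult[OF d cmp_hom[OF f r]]])
qed

text \<open>The definition of the bracket gives \<open>X_a W_d = [X, W]_(a d) W_d X_a\<close>. The
  first two factors are exchanged to form the sum of tangent vectors, which is possible because
  \<open>d (a d) = 0\<close>.\<close>

lemma adj_tapp:
  assumes X: "X \<in> Hom E J \<g>" and W: "W \<in> Hom E J \<g>" and a: "a \<in> Nsq J"
  shows "adj J (app X a) W (vadd J W (smul J a (brac J X W)))"
proof -
  let ?B = "brac J X W"
  have B: "?B \<in> Hom E J \<g>" using lie_bracket_hom[OF X W] .
  have aB: "smul J a ?B \<in> Hom E J \<g>" using tsmult_hom[OF nilsq_hom[OF a] B] .
  have "(app X a \<cdot> f) \<otimes>[K] app (W \<cdot> f) d = app (vadd J W (smul J a ?B) \<cdot> f) d \<otimes>[K] (app X a \<cdot> f)"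
    if f: "f \<in> Hom E K J" and d: "d \<in> Nsq K" for K f d
  proof -
    interpret K: group "GG K" using nilsq_ob[OF d] by (rule group_at_group)
    note n = nilsq_cmp[OF a f] and Xf = cmp_hom[OF f X] and Wf = cmp_hom[OF f W]
    let ?x = "app (X \<cdot> f) (a \<cdot> f)" and ?w = "app (W \<cdot> f) d"
      and ?b = "app (?B \<cdot> f) ((a \<cdot> f) *[K] d)"
    have c: "?x \<in> carrier (GG K)" "?w \<in> carrier (GG K)" "?b \<in> carrier (GG K)"
      using tapp_hom[OF Xf n] tapp_hom[OF Wf d] tapp_hom[OF cmp_hom[OF f B] nilsq_mult[OF n nilsq_hom[OF d]]] by simp_all
    have b: "?b = ?x \<otimes>[K] ?w \<otimes>[K] inv[K] ?x \<otimes>[K] inv[K] ?w"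
      using tapp_lie_bracket[OF Xf Wf n d] lie_bracket_cmp[OF X W f] by simp
    then have bwx: "?b \<otimes>[K] ?w \<otimes>[K] ?x = ?x \<otimes>[K] ?w"
      using c by (simp add: K.m_assoc del: carrier_group_at)
    have "app (vadd J W (smul J a ?B) \<cdot> f) d = ?w \<otimes>[K] ?b"
      using tadd_spec(2)[OF W aB f d] tsmult_spec(2)[OF nilsq_hom[OF a] B f d] by simp
    also have "?w \<otimes>[K] ?b = ?b \<otimes>[K] ?w"
    proof -
      interpret A: cring "RR K" using nilsq_ob[OF d] by (rule ring_at_cring)
      have ac: "a \<cdot> f \<in> carrier (RR K)" "d \<in> carrier (RR K)" using nilsq_hom[OF n] nilsq_hom[OF d] by simp_all
      have "d *[K] ((a \<cdot> f) *[K] d) = (a \<cdot> f) *[K] (d *[K] d)"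
        using A.m_lcomm ac by blast
      then have "d *[K] ((a \<cdot> f) *[K] d) = \<zero>[K]"
        using nilsq_square[OF d] nilsq_hom[OF n] by simp
      then show ?thesis
        by (rule tapp_commute[OF Wf cmp_hom[OF f B] d nilsq_mult[OF n nilsq_hom[OF d]]])
    qed
    finally show ?thesis
      using bwx tapp_cmp[OF X a f] by simp
  qed
  then show ?thesis
    using tapp_hom[OF X a] W tadd_hom[OF W aB] by (simp add: adj_def)
qed

text \<open>Conjugation respects products and inverses, hence commutators. The conjugate of the
  bracket exists by \<open>adj_exists\<close> and is identified by its values at products.\<close>

lemma adj_bracket:
  assumes "adj J g W W'" "adj J g V V'"
  shows "adj J g (brac J W V) (brac J W' V')"
proof -
  note g = adjD[OF assms(1)] and h = adjD[OF assms(2)]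
  obtain C where C: "adj J g (brac J W V) C"
    using adj_exists[OF g(1) lie_bracket_hom[OF g(2) h(2)]] by blast
  have "C = brac J W' V'"
  proof (rule tangent_ext_DD[OF adjD(3)[OF C] lie_bracket_hom[OF g(3) h(3)]])
    fix K f a b assume f: "f \<in> Hom E K J" and ab: "a \<in> Nsq K" "b \<in> Nsq K"
    interpret K: group "GG K" using nilsq_ob[OF ab(1)] by (rule group_at_group)
    let ?g = "g \<cdot> f"
    let ?w = "app (W \<cdot> f) a" and ?v = "app (V \<cdot> f) b" and ?w' = "app (W' \<cdot> f) a" and ?v' = "app (V' \<cdot> f) b"
      and ?c = "app (C \<cdot> f) (a *[K] b)"
    note n = nilsq_mult[OF ab(1) nilsq_hom[OF ab(2)]]
    have c: "?g \<in> carrier (GG K)" "?w \<in> carrier (GG K)" "?v \<in> carrier (GG K)"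
      "?w' \<in> carrier (GG K)" "?v' \<in> carrier (GG K)" "?c \<in> carrier (GG K)"
      using cmp_hom[OF f g(1)] tapp_hom[OF cmp_hom[OF f g(2)] ab(1)] tapp_hom[OF cmp_hom[OF f g(3)] ab(1)]
        tapp_hom[OF cmp_hom[OF f h(2)] ab(2)] tapp_hom[OF cmp_hom[OF f h(3)] ab(2)]
        tapp_hom[OF cmp_hom[OF f adjD(3)[OF C]] n] by simp_all
    have inverse: "?g \<otimes>[K] inv[K] x = inv[K] y \<otimes>[K] ?g"
      if "?g \<otimes>[K] x = y \<otimes>[K] ?g" "x \<in> carrier (GG K)" "y \<in> carrier (GG K)" for x y
      using that c(1) by (metis K.inv_closed K.inv_solve_left K.inv_solve_right K.m_assoc K.m_closed)
    have e: "?g \<otimes>[K] ?w = ?w' \<otimes>[K] ?g" "?g \<otimes>[K] ?v = ?v' \<otimes>[K] ?g"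
      using g(4)[OF f ab(1)] h(4)[OF f ab(2)] .
    note e' = inverse[OF e(1) c(2,4)] inverse[OF e(2) c(3,5)]
    let ?k = "?w \<otimes>[K] ?v \<otimes>[K] inv[K] ?w \<otimes>[K] inv[K] ?v"
    let ?k' = "?w' \<otimes>[K] ?v' \<otimes>[K] inv[K] ?w' \<otimes>[K] inv[K] ?v'"
    have step: "?g \<otimes>[K] (x \<otimes>[K] z) = (y \<otimes>[K] u) \<otimes>[K] ?g"
      if "?g \<otimes>[K] x = y \<otimes>[K] ?g" "?g \<otimes>[K] z = u \<otimes>[K] ?g"
        "x \<in> carrier (GG K)" "y \<in> carrier (GG K)" "z \<in> carrier (GG K)" "u \<in> carrier (GG K)" for x y z u
      using that c(1) K.m_assoc by metis
    have "?g \<otimes>[K] ?k = ?k' \<otimes>[K] ?g"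
      using c by (intro step e e') (simp_all del: carrier_group_at)
    moreover have "?g \<otimes>[K] ?k = ?c \<otimes>[K] ?g"
      using adjD(4)[OF C f n] tapp_lie_bracket[OF cmp_hom[OF f g(2)] cmp_hom[OF f h(2)] ab]
        lie_bracket_cmp[OF g(2) h(2) f] by simp
    ultimately have "?c = ?k'"
      using c K.right_cancel[of ?g ?c ?k'] by (simp del: carrier_group_at)
    then show "?c = app (brac J W' V' \<cdot> f) (a *[K] b)"
      using tapp_lie_bracket[OF cmp_hom[OF f g(3)] cmp_hom[OF f h(3)] ab] lie_bracket_cmp[OF g(3) h(3) f] by simp
  qed
  with C show ?thesis by simp
qed

section \<open>Lie algebra laws by cancelling a nilsquare scalar\<close>

lemma lie_algebra_at_carrierI: "X \<in> Hom E J \<g> \<Longrightarrow> X \<in> carrier (gg J)"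
  by (simp add: lie_algebra_at_simps)

text \<open>The value of \<open>X\<close> at \<open>a b\<close> is the value of \<open>a X\<close>
  at \<open>b\<close>, and values at products determine a tangent vector. The scalar must range over
  all later stages; a single \<open>a\<close> could not be cancelled.\<close>

lemma tsmult_cancel:
  assumes X: "X \<in> Hom E J \<g>" and Y: "Y \<in> Hom E J \<g>"
    and eq: "\<And>K f a. f \<in> Hom E K J \<Longrightarrow> a \<in> Nsq K \<Longrightarrow> smul K a (X \<cdot> f) = smul K a (Y \<cdot> f)"
  shows "X = Y"
proof (rule tangent_ext_DD[OF X Y])
  fix K f a b assume f: "f \<in> Hom E K J" and a: "a \<in> Nsq K" and b: "b \<in> Nsq K"
  show "app (X \<cdot> f) (a *[K] b) = app (Y \<cdot> f) (a *[K] b)"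
    using tapp_tsmult[OF nilsq_hom[OF a] cmp_hom[OF f X] b] tapp_tsmult[OF nilsq_hom[OF a] cmp_hom[OF f Y] b] eq[OF f a]
    by simp
qed

text \<open>The conjugate of \<open>V + W\<close> by \<open>X_a\<close> is computed in two ways,
  directly and summand by summand. The comparison sees the bracket only multiplied by
  \<open>a\<close>; the next lemma removes this factor.\<close>

lemma smult_bracket_add_right:
  assumes X: "X \<in> Hom E K \<g>" and V: "V \<in> Hom E K \<g>" and W: "W \<in> Hom E K \<g>" and a: "a \<in> Nsq K"
  shows "smul K a (brac K X (vadd K V W)) =
    smul K a (vadd K (brac K X V) (brac K X W))"
proof -
  interpret module "RR K" "gg K" using nilsq_ob[OF a] by (rule lie_module)
  note ah = nilsq_hom[OF a]
  have "vadd K (vadd K V W) (smul K a (brac K X (vadd K V W))) =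
      vadd K (vadd K V (smul K a (brac K X V)))
        (vadd K W (smul K a (brac K X W)))"
    by (rule adj_unique[OF adj_tapp[OF X tadd_hom[OF V W] a] adj_add[OF adj_tapp[OF X V a] adj_tapp[OF X W a]]])
  then have "smul K a (brac K X (vadd K V W)) =
      vadd K (smul K a (brac K X V)) (smul K a (brac K X W))"
    by (rule M.add4_cancel[unfolded lie_algebra_at_simps])
      (use X V W ah tadd_hom tsmult_hom lie_bracket_hom in auto)
  then show ?thesis
    using smult_r_distr[unfolded lie_algebra_at_simps, of a "brac K X V" "brac K X W"]
      ah lie_bracket_hom[OF X V] lie_bracket_hom[OF X W] by simp
qed

lemma lie_bracket_add_right:
  assumes X: "X \<in> Hom E J \<g>" and V: "V \<in> Hom E J \<g>" and W: "W \<in> Hom E J \<g>"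
  shows "brac J X (vadd J V W) =
    vadd J (brac J X V) (brac J X W)"
proof (rule tsmult_cancel[OF lie_bracket_hom[OF X tadd_hom[OF V W]] tadd_hom[OF lie_bracket_hom[OF X V] lie_bracket_hom[OF X W]]])
  fix K f a assume f: "f \<in> Hom E K J" and a: "a \<in> Nsq K"
  show "smul K a (brac J X (vadd J V W) \<cdot> f) =
    smul K a (vadd J (brac J X V) (brac J X W) \<cdot> f)"
    unfolding lie_bracket_cmp[OF X tadd_hom[OF V W] f] tadd_cmp[OF V W f] lie_bracket_cmp[OF X V f]
      tadd_cmp[OF lie_bracket_hom[OF X V] lie_bracket_hom[OF X W] f] lie_bracket_cmp[OF X W f]
    by (rule smult_bracket_add_right[OF cmp_hom[OF f X] cmp_hom[OF f V] cmp_hom[OF f W] a])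
qed

lemma smult_bracket_smult_right:
  assumes X: "X \<in> Hom E K \<g>" and W: "W \<in> Hom E K \<g>" and r: "r \<in> Hom E K Rb" and a: "a \<in> Nsq K"
  shows "smul K a (brac K X (smul K r W)) =
    smul K a (smul K r (brac K X W))"
proof -
  interpret module "RR K" "gg K" using nilsq_ob[OF a] by (rule lie_module)
  note ah = nilsq_hom[OF a] and B = lie_bracket_hom[OF X W]
  have "vadd K (smul K r W) (smul K a (brac K X (smul K r W))) =
      smul K r (vadd K W (smul K a (brac K X W)))"
    by (rule adj_unique[OF adj_tapp[OF X tsmult_hom[OF r W] a] adj_smult[OF adj_tapp[OF X W a] r]])
  also have "\<dots> = vadd K (smul K r W) (smul K r (smul K a (brac K X W)))"
    using smult_r_distr[unfolded lie_algebra_at_simps, of r W] r W tsmult_hom[OF ah B] by simp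
  finally have "smul K a (brac K X (smul K r W)) =
      smul K r (smul K a (brac K X W))"
    using M.add_left_cancel[unfolded lie_algebra_at_simps] X W r ah B tsmult_hom lie_bracket_hom
    by (simp add: lie_algebra_at_simps)
  also have "\<dots> = smul K a (smul K r (brac K X W))"
    using smult_assoc1[unfolded lie_algebra_at_simps, symmetric] R.m_comm[of r a] r ah B by simp
  finally show ?thesis .
qed

lemma lie_bracket_smult_right:
  assumes X: "X \<in> Hom E J \<g>" and W: "W \<in> Hom E J \<g>" and r: "r \<in> Hom E J Rb"
  shows "brac J X (smul J r W) = smul J r (brac J X W)"
proof (rule tsmult_cancel[OF lie_bracket_hom[OF X tsmult_hom[OF r W]] tsmult_hom[OF r lie_bracket_hom[OF X W]]])
  fix K f a assume f: "f \<in> Hom E K J" and a: "a \<in> Nsq K"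
  show "smul K a (brac J X (smul J r W) \<cdot> f) =
    smul K a (smul J r (brac J X W) \<cdot> f)"
    unfolding lie_bracket_cmp[OF X tsmult_hom[OF r W] f] tsmult_cmp[OF r W f]
      tsmult_cmp[OF r lie_bracket_hom[OF X W] f] lie_bracket_cmp[OF X W f]
    by (rule smult_bracket_smult_right[OF cmp_hom[OF f X] cmp_hom[OF f W] cmp_hom[OF f r] a])
qed

text \<open>Inverting a commutator exchanges its two entries, and inversion in the group is the
  scalar -1 on tangent vectors.\<close>

lemma lie_bracket_skew:
  assumes X: "X \<in> Hom E J \<g>" and Y: "Y \<in> Hom E J \<g>"
  shows "brac J Y X = \<ominus>\<^bsub>gg J\<^esub> brac J X Y"
proof -
  have J: "J \<in> Ob E" using X hom_ob by blast
  interpret module "RR J" "gg J" using J by (rule lie_module)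
  note B = lie_bracket_hom[OF X Y] and B' = lie_bracket_hom[OF Y X]
  let ?m = "\<ominus>[J] \<one>\<^sub>R[J]"
  have m: "?m \<in> Hom E J Rb" using J by simp
  have "brac J Y X = smul J ?m (brac J X Y)"
  proof (rule tangent_ext_DD[OF B' tsmult_hom[OF m B]])
    fix K f a b assume f: "f \<in> Hom E K J" and ab: "a \<in> Nsq K" "b \<in> Nsq K"
    interpret A: cring "RR K" using nilsq_ob[OF ab(1)] by (rule ring_at_cring)
    interpret B: group "GG K" using nilsq_ob[OF ab(1)] by (rule group_at_group)
    note Xf = cmp_hom[OF f X] and Yf = cmp_hom[OF f Y]
    let ?x = "app (X \<cdot> f) b" and ?y = "app (Y \<cdot> f) a"
    have c: "?x \<in> carrier (GG K)" "?y \<in> carrier (GG K)" using tapp_hom[OF Xf ab(2)] tapp_hom[OF Yf ab(1)] by simp_all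
    have abh: "a \<in> carrier (RR K)" "b \<in> carrier (RR K)" using ab nilsq_hom by simp_all
    have n: "b *[K] a \<in> Nsq K" using nilsq_mult[OF ab(2) nilsq_hom[OF ab(1)]] .
    have "?m \<cdot> f = \<ominus>[K] \<one>\<^sub>R[K]"
      using ring_minus_cmp[OF f, of "\<one>\<^sub>R[J]"] ring_one_cmp[OF f] J by simp
    moreover have "(\<ominus>[K] \<one>\<^sub>R[K]) *[K] (a *[K] b) = \<ominus>[K] (b *[K] a)"
      using abh A.l_minus[of "\<one>\<^sub>R[K]" "a *[K] b"] A.m_comm[of a b] by (simp del: carrier_ring_at)
    ultimately have "app (smul J ?m (brac J X Y) \<cdot> f) (a *[K] b) =
        inv[K] (app (brac J X Y \<cdot> f) (b *[K] a))"
      using tsmult_spec(2)[OF m B f nilsq_mult[OF ab(1) nilsq_hom[OF ab(2)]]] tapp_minus[OF cmp_hom[OF f B] n] by simp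
    also have "\<dots> = inv[K] (?x \<otimes>[K] ?y \<otimes>[K] inv[K] ?x \<otimes>[K] inv[K] ?y)"
      unfolding lie_bracket_cmp[OF X Y f] tapp_lie_bracket[OF Xf Yf ab(2,1)] by (rule refl)
    also have "\<dots> = ?y \<otimes>[K] ?x \<otimes>[K] inv[K] ?y \<otimes>[K] inv[K] ?x"
      using c by (simp add: B.inv_mult_group B.m_assoc del: carrier_group_at)
    also have "\<dots> = app (brac J Y X \<cdot> f) (a *[K] b)"
      unfolding lie_bracket_cmp[OF Y X f] tapp_lie_bracket[OF Yf Xf ab] by (rule refl)
    finally show "app (brac J Y X \<cdot> f) (a *[K] b) =
      app (smul J ?m (brac J X Y) \<cdot> f) (a *[K] b)" by simp
  qed
  also have "\<dots> = \<ominus>\<^bsub>gg J\<^esub> brac J X Y"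
    using smult_l_minus[of "\<one>\<^sub>R[J]" "brac J X Y"] lie_algebra_at_carrierI[OF B] R.one_closed smult_one
    by (simp add: lie_algebra_at_simps(4) del: carrier_ring_at)
  finally show ?thesis .
qed

text \<open>Both products equal \<open>exp ((a + b) X)\<close>, whatever \<open>a b\<close> is. This
  makes the commutator behind \<open>[X, X]\<close> trivial.\<close>

lemma tapp_self_commute:
  assumes X: "X \<in> Hom E K \<g>" and a: "a \<in> Nsq K" and b: "b \<in> Nsq K"
  shows "app X a \<otimes>[K] app X b = app X b \<otimes>[K] app X a"
proof -
  interpret cring "RR K" using nilsq_ob[OF a] by (rule ring_at_cring)
  show ?thesis
    using ex_add[OF X nilsq_hom[OF a] nilsq_hom[OF b]] ex_add[OF X nilsq_hom[OF b] nilsq_hom[OF a]]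
      a_comm[of a b] nilsq_hom[OF a] nilsq_hom[OF b] ex_nilsq[OF X a] ex_nilsq[OF X b] by simp
qed

lemma lie_bracket_self:
  assumes X: "X \<in> Hom E J \<g>"
  shows "brac J X X = tzero E R G J"
proof (rule tangent_ext_DD[OF lie_bracket_hom[OF X X]])
  have J: "J \<in> Ob E" using X hom_ob by blast
  show "tzero E R G J \<in> Hom E J \<g>" using J by (rule tzero_hom)
  fix K f a b assume f: "f \<in> Hom E K J" and ab: "a \<in> Nsq K" "b \<in> Nsq K"
  interpret B: group "GG K" using nilsq_ob[OF ab(1)] by (rule group_at_group)
  note Xf = cmp_hom[OF f X]
  have c: "app (X \<cdot> f) a \<in> carrier (GG K)" "app (X \<cdot> f) b \<in> carrier (GG K)"
    using tapp_hom[OF Xf ab(1)] tapp_hom[OF Xf ab(2)] by simp_all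
  show "app (brac J X X \<cdot> f) (a *[K] b) = app (tzero E R G J \<cdot> f) (a *[K] b)"
    unfolding lie_bracket_cmp[OF X X f] tapp_lie_bracket[OF Xf Xf ab] tapp_self_commute[OF Xf ab]
      tzero_spec(2)[OF J f nilsq_mult[OF ab(1) nilsq_hom[OF ab(2)]]]
    using c by (simp add: B.m_assoc del: carrier_group_at)
qed

text \<open>Conjugation by \<open>Z_a\<close> preserves brackets. Expanding both sides of this
  statement to first order, with the quadratic terms removed by \<open>aa\<close>, leaves the
  Leibniz rule multiplied by \<open>a\<close>.\<close>

lemma smult_lie_bracket_jacobi:
  assumes X: "X \<in> Hom E K \<g>" and Y: "Y \<in> Hom E K \<g>" and Z: "Z \<in> Hom E K \<g>" and a: "a \<in> Nsq K"
  defines "B \<equiv> brac K"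
  shows "smul K a (B Z (B X Y)) = smul K a (vadd K (B (B Z X) Y) (B X (B Z Y)))"
proof -
  interpret module "RR K" "gg K" using nilsq_ob[OF a] by (rule lie_module)
  let ?c = "carrier (gg K)"
  note ops = lie_algebra_at_simps(2-4)[symmetric]
  note c = lie_algebra_at_carrierI
  have ac: "a \<in> carrier (RR K)" using nilsq_hom[OF a] by simp
  have Bc: "B U V \<in> ?c" if "U \<in> ?c" "V \<in> ?c" for U V
    using that lie_bracket_hom unfolding B_def lie_algebra_at_simps by blast
  have add: "B U (V \<oplus>\<^bsub>gg K\<^esub> W) = B U V \<oplus>\<^bsub>gg K\<^esub> B U W" if "U \<in> ?c" "V \<in> ?c" "W \<in> ?c" for U V W
    using that lie_bracket_add_right unfolding B_def lie_algebra_at_simps by blast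
  have sm: "B U (a \<odot>\<^bsub>gg K\<^esub> V) = a \<odot>\<^bsub>gg K\<^esub> B U V" if "U \<in> ?c" "V \<in> ?c" for U V
    using that ac lie_bracket_smult_right unfolding B_def lie_algebra_at_simps by simp
  have skew: "B V U = \<ominus>\<^bsub>gg K\<^esub> B U V" if "U \<in> ?c" "V \<in> ?c" for U V
    using that lie_bracket_skew unfolding B_def lie_algebra_at_simps by blast
  have addl: "B (V \<oplus>\<^bsub>gg K\<^esub> W) U = B V U \<oplus>\<^bsub>gg K\<^esub> B W U" if "U \<in> ?c" "V \<in> ?c" "W \<in> ?c" for U V W
    using that Bc by (simp add: skew[of U] add M.minus_add)
  have sml: "B (a \<odot>\<^bsub>gg K\<^esub> V) U = a \<odot>\<^bsub>gg K\<^esub> B V U" if "U \<in> ?c" "V \<in> ?c" for U V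
    using that Bc ac by (simp add: skew[of U] sm smult_r_minus)
  have aa: "a \<odot>\<^bsub>gg K\<^esub> (a \<odot>\<^bsub>gg K\<^esub> V) = \<zero>\<^bsub>gg K\<^esub>" if "V \<in> ?c" for V
    using smult_assoc1[OF ac ac that] nilsq_square[OF a] that by simp
  have XYZ: "X \<in> ?c" "Y \<in> ?c" "Z \<in> ?c" using X Y Z c by blast+
  have "B X Y \<oplus>\<^bsub>gg K\<^esub> a \<odot>\<^bsub>gg K\<^esub> B Z (B X Y) =
      B (X \<oplus>\<^bsub>gg K\<^esub> a \<odot>\<^bsub>gg K\<^esub> B Z X) (Y \<oplus>\<^bsub>gg K\<^esub> a \<odot>\<^bsub>gg K\<^esub> B Z Y)"
    unfolding B_def lie_algebra_at_simps
    by (rule adj_unique[OF adj_tapp[OF Z lie_bracket_hom[OF X Y] a] adj_bracket[OF adj_tapp[OF Z X a] adj_tapp[OF Z Y a]]])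
  also have "\<dots> = B X Y \<oplus>\<^bsub>gg K\<^esub> a \<odot>\<^bsub>gg K\<^esub> (B (B Z X) Y \<oplus>\<^bsub>gg K\<^esub> B X (B Z Y))"
    using XYZ ac Bc by (simp add: add addl sm sml aa smult_r_distr M.a_ac)
  finally have "a \<odot>\<^bsub>gg K\<^esub> B Z (B X Y) = a \<odot>\<^bsub>gg K\<^esub> (B (B Z X) Y \<oplus>\<^bsub>gg K\<^esub> B X (B Z Y))"
    using XYZ ac Bc by simp
  then show ?thesis unfolding lie_algebra_at_simps .
qed

lemma lie_bracket_jacobi:
  assumes X: "X \<in> Hom E J \<g>" and Y: "Y \<in> Hom E J \<g>" and Z: "Z \<in> Hom E J \<g>"
  defines "B \<equiv> brac J"
  shows "B Z (B X Y) = vadd J (B (B Z X) Y) (B X (B Z Y))"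
proof -
  note h = lie_bracket_hom[OF Z lie_bracket_hom[OF X Y]] lie_bracket_hom[OF lie_bracket_hom[OF Z X] Y]
    lie_bracket_hom[OF X lie_bracket_hom[OF Z Y]]
  show ?thesis
    unfolding B_def
  proof (rule tsmult_cancel[OF h(1) tadd_hom[OF h(2,3)]])
    fix K f a assume f: "f \<in> Hom E K J" and a: "a \<in> Nsq K"
    show "smul K a (brac J Z (brac J X Y) \<cdot> f) =
      smul K a (vadd J (brac J (brac J Z X) Y)
        (brac J X (brac J Z Y)) \<cdot> f)"
      unfolding tadd_cmp[OF h(2,3) f] lie_bracket_cmp[OF Z lie_bracket_hom[OF X Y] f]
        lie_bracket_cmp[OF lie_bracket_hom[OF Z X] Y f] lie_bracket_cmp[OF X lie_bracket_hom[OF Z Y] f]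
        lie_bracket_cmp[OF X Y f] lie_bracket_cmp[OF Z X f] lie_bracket_cmp[OF Z Y f]
      by (rule smult_lie_bracket_jacobi[OF cmp_hom[OF f X] cmp_hom[OF f Y] cmp_hom[OF f Z] a])
  qed
qed

lemma lie_algebra_at:
  assumes J: "J \<in> Ob E"
  shows "lie_algebra (RR J) (gg J) (brac J)"
proof -
  interpret module "RR J" "gg J" using J by (rule lie_module)
  show ?thesis
    by (unfold_locales; unfold lie_algebra_at_simps carrier_ring_at;
        (rule lie_bracket_hom lie_bracket_add_right lie_bracket_smult_right lie_bracket_self
          lie_bracket_skew lie_bracket_jacobi; assumption))
qed

section \<open>The exponential map\<close>

lemma rational_lie_algebra_at:
  assumes "J \<in> Ob E"
  shows "rational_lie_algebra (RR J) (gg J) (brac J) (rat_at E R J)"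
  unfolding rational_lie_algebra_def rational_lie_algebra_axioms_def
  using assms lie_algebra_at rat_at_hom rat_at_add rat_at_mult rat_at_one by simp

abbreviation "exp_ad_at K \<equiv> rational_lie_algebra.exp_ad (RR K) (gg K) (brac K) (rat_at E R K)"
abbreviation "int_exp_ad_at K \<equiv> rational_lie_algebra.int_exp_ad (RR K) (gg K) (brac K) (rat_at E R K)"

lemma int_exp_ad_at_hom:
  assumes "s \<in> Hom E K Rb" "z \<in> Hom E K \<g>" "w \<in> Hom E K \<g>" "t \<in> Hom E K Rb"
  shows "int_exp_ad_at K s z w t \<in> Hom E K \<g>"
proof -
  have K: "K \<in> Ob E" using assms hom_ob by blast
  interpret rational_lie_algebra "RR K" "gg K" "brac K" "rat_at E R K"
    using K by (rule rational_lie_algebra_at)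
  show ?thesis
    using int_exp_ad_closed[of s z t w] assms by (simp add: lie_algebra_at_simps)
qed

text \<open>All constituents commute with restriction. The lemma supplies the naturality that
  \<open>ex_unique\<close> demands of the curve below.\<close>

lemma int_exp_ad_at_cmp:
  assumes s: "s \<in> Hom E J Rb" and z: "z \<in> Hom E J \<g>" and w: "w \<in> Hom E J \<g>" and t: "t \<in> Hom E J Rb"
    and f: "f \<in> Hom E K J"
  shows "int_exp_ad_at J s z w t \<cdot> f = int_exp_ad_at K (s \<cdot> f) (z \<cdot> f) (w \<cdot> f) (t \<cdot> f)"
proof -
  have J: "J \<in> Ob E" and K: "K \<in> Ob E" using f hom_ob by blast+
  interpret J: rational_lie_algebra "RR J" "gg J" "brac J" "rat_at E R J"
    using J by (rule rational_lie_algebra_at)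
  interpret K: rational_lie_algebra "RR K" "gg K" "brac K" "rat_at E R K"
    using K by (rule rational_lie_algebra_at)
  note R = ring_closed[OF J] rat_at_hom[OF J] s t
  note M = tadd_hom tsmult_hom lie_bracket_hom z w
  show ?thesis
    unfolding J.int_exp_ad_def K.int_exp_ad_def J.horner_def K.horner_def lie_algebra_at_simps
    by (simp add: R M tadd_cmp[OF _ _ f] tsmult_cmp[OF _ _ f] lie_bracket_cmp[OF _ _ f] ring_mult_cmp[OF _ _ f]
        rat_at_cmp[OF f])
qed

text \<open>Since \<open>r a\<close>, \<open>r b\<close>, \<open>r c\<close> are nilsquare, the
  exponential is a product of three values of \<open>z\<close>, each conjugating by
  \<open>adj_tapp\<close>; \<open>exp_ad_three\<close> adds up the effect. The scalar
  \<open>r\<close> is arbitrary, because it will be the time of a one-parameter subgroup.\<close>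

lemma adj_exp:
  assumes e: "a \<in> Nsq K" "b \<in> Nsq K" "c \<in> Nsq K"
    and z: "z \<in> Hom E K \<g>" and w: "w \<in> Hom E K \<g>" and r: "r \<in> Hom E K Rb"
  defines "s \<equiv> a +[K] b +[K] c"
  shows "adj K (ex \<cdot> smul K (r *[K] s) z) w (exp_ad_at K s z r w)"
proof -
  have K: "K \<in> Ob E" using r hom_ob by blast
  interpret rational_lie_algebra "RR K" "gg K" "brac K" "rat_at E R K"
    using K by (rule rational_lie_algebra_at)
  define step where "step e w = vadd K w (smul K (r *[K] e) (brac K z w))" for e w
  have eh: "a \<in> Hom E K Rb" "b \<in> Hom E K Rb" "c \<in> Hom E K Rb" using e nilsq_hom by blast+
  have re: "r *[K] a \<in> Nsq K" "r *[K] b \<in> Nsq K" "r *[K] c \<in> Nsq K"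
    using e r nilsq_smult by blast+
  note reh = nilsq_hom[OF re(1)] nilsq_hom[OF re(2)] nilsq_hom[OF re(3)]
  have "r *[K] s = r *[K] a +[K] r *[K] b +[K] r *[K] c"
    using eh r K by (simp add: s_def R.r_distr)
  then have "ex \<cdot> smul K (r *[K] s) z =
      app z (r *[K] a) \<otimes>[K] app z (r *[K] b) \<otimes>[K] app z (r *[K] c)"
    using ex_add[OF z ring_closed(3)[OF K reh(1,2)] reh(3)] ex_add[OF z reh(1,2)]
      ex_nilsq[OF z re(1)] ex_nilsq[OF z re(2)] ex_nilsq[OF z re(3)] by simp
  moreover have st: "adj K (app z (r *[K] e)) v (step e v)"
    if "r *[K] e \<in> Nsq K" "v \<in> Hom E K \<g>" for e v
    unfolding step_def by (rule adj_tapp[OF z that(2,1)])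
  have "adj K (app z (r *[K] a) \<otimes>[K] app z (r *[K] b) \<otimes>[K] app z (r *[K] c)) w (step a (step b (step c w)))"
  proof -
    \<comment> \<open>Conjugation by a product applies the rightmost factor first.\<close>
    note c = st[OF re(3) w]
    note b = st[OF re(2) adjD(3)[OF c]]
    note a = st[OF re(1) adjD(3)[OF b]]
    show ?thesis by (rule adj_mult[OF c adj_mult[OF b a]])
  qed
  moreover have "step a (step b (step c w)) = exp_ad_at K s z r w"
    using exp_ad_three[of a b c z w r] eh e z w r nilsq_square
    by (simp add: lie_algebra_at_simps step_def s_def)
  ultimately show ?thesis by simp
qed

text \<open>With \<open>U(t) = int_exp_ad s z w t\<close>, the curve \<open>t \<mapsto> U(t)\<^sub>d \<cdot> exp (t s z)\<close> is the one-parameter subgroup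
  with velocity \<open>s z + d w\<close>.\<close>

lemma exp_derivative:
  assumes e: "a \<in> Nsq J" "b \<in> Nsq J" "c \<in> Nsq J"
    and z: "z \<in> Hom E J \<g>" and w: "w \<in> Hom E J \<g>" and d: "d \<in> Nsq J"
  defines "s \<equiv> a +[J] b +[J] c"
  shows "ex \<cdot> vadd J (smul J s z) (smul J d w) =
    app (int_exp_ad_at J s z w \<one>\<^sub>R[J]) d \<otimes>[J] (ex \<cdot> smul J s z)"
proof -
  have J: "J \<in> Ob E" using z hom_ob by blast
  have dom: "Dom E f = K" if "f \<in> Hom E K J" for f K using that hom_dom by blast
  have eh: "a \<in> Hom E J Rb" "b \<in> Hom E J Rb" "c \<in> Hom E J Rb" using e nilsq_hom by blast+
  have s: "s \<in> Hom E J Rb" using J eh by (simp add: s_def)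
  note dh = nilsq_hom[OF d]
  note X1 = tsmult_hom[OF s z] and X2 = tsmult_hom[OF dh w]
  note X = tadd_hom[OF X1 X2]
  define U where "U f t = int_exp_ad_at (Dom E f) (s \<cdot> f) (z \<cdot> f) (w \<cdot> f) t" for f t
  define C where "C f t = ex \<cdot> smul (Dom E f) t (smul J s z \<cdot> f)" for f t
  have U: "U f t \<in> Hom E K \<g>" if f: "f \<in> Hom E K J" and t: "t \<in> Hom E K Rb" for K f t
    unfolding U_def dom[OF f] by (rule int_exp_ad_at_hom[OF cmp_hom[OF f s] cmp_hom[OF f z] cmp_hom[OF f w] t])
  have C: "C f t \<in> Hom E K Gb" if f: "f \<in> Hom E K J" and t: "t \<in> Hom E K Rb" for K f t
    unfolding C_def dom[OF f] by (rule ex_hom[OF tsmult_hom[OF t cmp_hom[OF f X1]]])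
  let ?\<Phi> = "\<lambda>f t. app (U f t) (d \<cdot> f) \<otimes>[Dom E f] C f t"
  have \<Phi>: "?\<Phi> f t \<in> Hom E K Gb" if f: "f \<in> Hom E K J" and t: "t \<in> Hom E K Rb" for K f t
    using tapp_hom[OF U[OF that] nilsq_cmp[OF d f]] C[OF that] hom_ob[OF f] by (simp add: dom[OF f])
  \<comment> \<open>The uniqueness of one-parameter subgroups is applied at time 1; the scalar 1 is
    removed at the end.\<close>
  have "ex \<cdot> smul J \<one>\<^sub>R[J] (vadd J (smul J s z) (smul J d w)) = ?\<Phi> (Idt E J) \<one>\<^sub>R[J]"
  proof (rule ex_unique[where \<Phi> = ?\<Phi>, OF X])
    show "?\<Phi> f t \<in> Hom E K Gb" if "f \<in> Hom E K J" "t \<in> Hom E K Rb" for K f t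
      using that by (rule \<Phi>)
  next
    fix K L f t h assume f: "f \<in> Hom E K J" and t: "t \<in> Hom E K Rb" and h: "h \<in> Hom E L K"
    have "ex \<in> Hom E \<g> Gb" using exponential by (simp add: exponential_map_def)
    then show "?\<Phi> f t \<cdot> h = ?\<Phi> (f \<cdot> h) (t \<cdot> h)"
      using group_mult_cmp[OF tapp_hom[OF U[OF f t] nilsq_cmp[OF d f]] C[OF f t] h]
        tapp_cmp[OF U[OF f t] nilsq_cmp[OF d f] h]
        int_exp_ad_at_cmp[OF cmp_hom[OF f s] cmp_hom[OF f z] cmp_hom[OF f w] t h]
        cmp_assoc[OF h tsmult_hom[OF t cmp_hom[OF f X1]], of ex Gb] tsmult_cmp[OF t cmp_hom[OF f X1] h]
        cmp_assoc[OF h f s] cmp_assoc[OF h f z] cmp_assoc[OF h f w] cmp_assoc[OF h f X1] cmp_assoc[OF h f dh]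
      by (simp add: U_def C_def dom[OF f] dom[OF cmp_hom[OF h f]])
  next
    fix K f t t' assume f: "f \<in> Hom E K J" and t: "t \<in> Hom E K Rb" and t': "t' \<in> Hom E K Rb"
    have K: "K \<in> Ob E" using f hom_ob by blast
    interpret rational_lie_algebra "RR K" "gg K" "brac K" "rat_at E R K"
      using K by (rule rational_lie_algebra_at)
    interpret B: group "GG K" using K by (rule group_at_group)
    note tt = ring_closed(3)[OF K t t']
    note df = nilsq_cmp[OF d f] and zf = cmp_hom[OF f z] and sf = cmp_hom[OF f s] and wf = cmp_hom[OF f w]
    note ef = nilsq_cmp[OF e(1) f] nilsq_cmp[OF e(2) f] nilsq_cmp[OF e(3) f]
    have sfe: "s \<cdot> f = a \<cdot> f +[K] b \<cdot> f +[K] c \<cdot> f"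
      using eh J by (simp add: s_def ring_add_cmp[OF _ _ f])
    have s4: "s \<cdot> f *[K] (s \<cdot> f *[K] (s \<cdot> f *[K] s \<cdot> f)) = \<zero>[K]"
      unfolding sfe using ef nilsq_hom nilsq_square by (intro three_nilsquares(1)) simp_all
    have Ct: "C f t = ex \<cdot> smul K (t *[K] s \<cdot> f) (z \<cdot> f)"
      using smult_assoc1[unfolded lie_algebra_at_simps carrier_ring_at, OF t sf zf] tsmult_cmp[OF s z f]
      by (simp add: C_def dom[OF f])
    define V where "V = exp_ad_at K (s \<cdot> f) (z \<cdot> f) t (U f t')"
    have adjV: "adj K (C f t) (U f t') V"
      unfolding Ct V_def sfe by (rule adj_exp[OF ef zf U[OF f t'] t])
    note V = adjD(3)[OF adjV]
    have "U f (t +[K] t') = vadd K (U f t) V"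
      unfolding U_def V_def dom[OF f]
      by (rule int_exp_ad_add[unfolded lie_algebra_at_simps carrier_ring_at, OF sf s4 zf wf t t'])
    then have 1: "app (U f (t +[K] t')) (d \<cdot> f) = app (U f t) (d \<cdot> f) \<otimes>[K] app V (d \<cdot> f)"
      using tapp_tadd[OF U[OF f t] V df] by simp
    have 2: "C f (t +[K] t') = C f t \<otimes>[K] C f t'"
      unfolding C_def dom[OF f] by (rule ex_add[OF cmp_hom[OF f X1] t t'])
    have 3: "C f t \<otimes>[K] app (U f t') (d \<cdot> f) = app V (d \<cdot> f) \<otimes>[K] C f t"
      by (rule adj_tapp_commute[OF adjV df])
    have gc: "app (U f t) (d \<cdot> f) \<in> carrier (GG K)" "app (U f t') (d \<cdot> f) \<in> carrier (GG K)"
      "app V (d \<cdot> f) \<in> carrier (GG K)" "C f t \<in> carrier (GG K)" "C f t' \<in> carrier (GG K)"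
      using tapp_hom[OF _ df] U[OF f t] U[OF f t'] V C[OF f t] C[OF f t'] by simp_all
    \<comment> \<open>Writing \<open>C\<close> for \<open>exp (t s z)\<close>: by \<open>3\<close>,
      \<open>U(t)_d V_d C(t) C(t')\<close> equals \<open>U(t)_d C(t) U(t')_d C(t')\<close>.\<close>
    show "?\<Phi> f (t +[K] t') = ?\<Phi> f t \<otimes>[K] ?\<Phi> f t'"
      unfolding dom[OF f] 1 2 using gc 3 B.m_assoc B.m_closed by metis
  next
    fix K f d' assume f: "f \<in> Hom E K J" and d': "d' \<in> Nsq K"
    have K: "K \<in> Ob E" using f hom_ob by blast
    interpret rational_lie_algebra "RR K" "gg K" "brac K" "rat_at E R K"
      using K by (rule rational_lie_algebra_at)
    note df = nilsq_cmp[OF d f] and zf = cmp_hom[OF f z] and sf = cmp_hom[OF f s] and wf = cmp_hom[OF f w]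
    note dh' = nilsq_hom[OF d'] and dfh = nilsq_hom[OF df]
    have Ud: "U f d' = smul K d' (w \<cdot> f)"
      unfolding U_def dom[OF f]
      by (rule int_exp_ad_square_zero[unfolded lie_algebra_at_simps carrier_ring_at, OF sf zf wf dh' nilsq_square[OF d']])
    \<comment> \<open>Time and increment change places: \<open>(d' w)_d\<close> and
      \<open>(d w)_d'\<close> are both the value of \<open>w\<close> at \<open>d d'\<close>.\<close>
    have "app (U f d') (d \<cdot> f) = app (smul K (d \<cdot> f) (w \<cdot> f)) d'"
      unfolding Ud tapp_tsmult[OF dh' wf df] tapp_tsmult[OF dfh wf d']
      using R.m_comm[of d' "d \<cdot> f"] dh' dfh by simp
    moreover have "C f d' = app (smul J s z \<cdot> f) d'"
      unfolding C_def dom[OF f] by (rule ex_nilsq[OF cmp_hom[OF f X1] d'])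
    \<comment> \<open>The two factors come in the opposite order in the sum
      \<open>s z + d w\<close>; taken at the same \<open>d'\<close>, they commute.\<close>
    ultimately show "?\<Phi> f d' = app (vadd J (smul J s z) (smul J d w) \<cdot> f) d'"
      using tadd_spec(2)[OF X1 X2 f d'] tsmult_cmp[OF dh w f]
        tapp_commute[OF cmp_hom[OF f X1] cmp_hom[OF f X2] d' d' nilsq_square[OF d']] by (simp add: dom[OF f])
  qed (use J in auto)
  moreover have "smul J \<one>\<^sub>R[J] V = V" if "V \<in> Hom E J \<g>" for V
    using module.smult_one[OF lie_module[OF J]] that by (simp add: lie_algebra_at_simps)
  ultimately show ?thesis
    using idt_hom[OF J] idt_right[OF s] idt_right[OF z] idt_right[OF w] idt_right[OF dh] idt_right[OF X1] X1 X
    by (simp add: U_def C_def dom[OF idt_hom[OF J]])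
qed

section \<open>Induction on the number of nilsquare summands\<close>

abbreviation "bch_at J x y s \<equiv> smul J s (lie_algebra.horner (gg J) s (vadd J x y)
  (rational_lie_algebra.bch\<^sub>2 (gg J) (brac J) (rat_at E R J) x y)
  (rational_lie_algebra.bch\<^sub>3 (gg J) (brac J) (rat_at E R J) x y)
  (rational_lie_algebra.bch\<^sub>4 (gg J) (brac J) (rat_at E R J) x y))"

text \<open>On the left, \<open>exp ((s + d) x) exp ((s + d) y)\<close> is
  \<open>x_d exp (s x) y_d exp (s y)\<close>, and moving \<open>y_d\<close> past
  \<open>exp (s x)\<close> turns \<open>y\<close> into \<open>exp (s ad x) y\<close>. On the right,
  \<open>exp_derivative\<close> produces a factor that \<open>bch_velocity\<close> shows to be the
  same.\<close>

lemma bch_step: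
  assumes x: "x \<in> Hom E J \<g>" and y: "y \<in> Hom E J \<g>"
    and e: "a \<in> Nsq J" "b \<in> Nsq J" "c \<in> Nsq J" and d: "d \<in> Nsq J"
  defines "s \<equiv> a +[J] b +[J] c"
  assumes IH: "(ex \<cdot> smul J s x) \<otimes>[J] (ex \<cdot> smul J s y) = ex \<cdot> bch_at J x y s"
  shows "(ex \<cdot> smul J (s +[J] d) x) \<otimes>[J] (ex \<cdot> smul J (s +[J] d) y) =
    ex \<cdot> bch_at J x y (s +[J] d)"
proof -
  have J: "J \<in> Ob E" using x hom_ob by blast
  interpret rational_lie_algebra "RR J" "gg J" "brac J" "rat_at E R J"
    using J by (rule rational_lie_algebra_at)
  interpret B: group "GG J" using J by (rule group_at_group)
  have eh: "a \<in> Hom E J Rb" "b \<in> Hom E J Rb" "c \<in> Hom E J Rb" using e nilsq_hom by blast+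
  have s: "s \<in> Hom E J Rb" using J eh by (simp add: s_def)
  have s4: "s *[J] (s *[J] (s *[J] s)) = \<zero>[J]"
    unfolding s_def using e eh nilsq_square by (intro three_nilsquares(1)) simp_all
  note dh = nilsq_hom[OF d]
  have sc: "s \<in> carrier (RR J)" and dc: "d \<in> carrier (RR J)" using s dh by simp_all
  have xc: "x \<in> carrier (gg J)" and yc: "y \<in> carrier (gg J)" using x y lie_algebra_at_carrierI by blast+
  note bc = bch\<^sub>2_closed[OF xc yc] bch\<^sub>3_closed[OF xc yc] bch\<^sub>4_closed[OF xc yc]
  let ?z = "horner s (x \<oplus>\<^bsub>gg J\<^esub> y) (bch\<^sub>2 x y) (bch\<^sub>3 x y) (bch\<^sub>4 x y)"
  let ?w = "horner s (x \<oplus>\<^bsub>gg J\<^esub> y) (rat_at E R J 2 \<odot>\<^bsub>gg J\<^esub> bch\<^sub>2 x y) (rat_at E R J 3 \<odot>\<^bsub>gg J\<^esub> bch\<^sub>3 x y)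
      (rat_at E R J 4 \<odot>\<^bsub>gg J\<^esub> bch\<^sub>4 x y)"
  have zwc: "?z \<in> carrier (gg J)" "?w \<in> carrier (gg J)"
    using horner_closed[OF sc] bc xc yc smult_closed[OF q_closed] by simp_all
  then have zw: "?z \<in> Hom E J \<g>" "?w \<in> Hom E J \<g>" by (simp_all add: lie_algebra_at_simps)
  have 1: "bch_at J x y (s +[J] d) = vadd J (smul J s ?z) (smul J d ?w)"
    using smult_horner_add[OF sc dc nilsq_square[OF d] M.a_closed[OF xc yc] bc] by (simp add: lie_algebra_at_simps)
  have 2: "ex \<cdot> vadd J (smul J s ?z) (smul J d ?w) =
      app (int_exp_ad s ?z ?w \<one>\<^sub>R[J]) d \<otimes>[J] (ex \<cdot> smul J s ?z)"
    unfolding s_def by (rule exp_derivative[OF e zw[unfolded s_def] d])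
  have 3: "int_exp_ad s ?z ?w \<one>\<^sub>R[J] = x \<oplus>\<^bsub>gg J\<^esub> exp_ad s x \<one>\<^sub>R[J] y"
    by (rule bch_velocity[OF xc yc sc s4])
  have 4: "ex \<cdot> smul J s ?z = (ex \<cdot> smul J s x) \<otimes>[J] (ex \<cdot> smul J s y)"
    unfolding IH lie_algebra_at_simps by (rule refl)
  have Q: "ex \<cdot> bch_at J x y (s +[J] d) = app (x \<oplus>\<^bsub>gg J\<^esub> exp_ad s x \<one>\<^sub>R[J] y) d
      \<otimes>[J] ((ex \<cdot> smul J s x) \<otimes>[J] (ex \<cdot> smul J s y))"
    unfolding 1 2 3 4 by (rule refl)
  have A: "adj J (ex \<cdot> smul J s x) y (exp_ad s x \<one>\<^sub>R[J] y)"
    using adj_exp[OF e x y, of "\<one>\<^sub>R[J]"] J s by (simp add: s_def)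
  have "app (x \<oplus>\<^bsub>gg J\<^esub> exp_ad s x \<one>\<^sub>R[J] y) d = app x d \<otimes>[J] app (exp_ad s x \<one>\<^sub>R[J] y) d"
    using tapp_tadd[OF x adjD(3)[OF A] d] by (simp add: lie_algebra_at_simps)
  moreover have "(ex \<cdot> smul J s x) \<otimes>[J] app y d =
      app (exp_ad s x \<one>\<^sub>R[J] y) d \<otimes>[J] (ex \<cdot> smul J s x)"
    by (rule adj_tapp_commute[OF A d])
  moreover have "ex \<cdot> smul J (s +[J] d) v = app v d \<otimes>[J] (ex \<cdot> smul J s v)"
    if v: "v \<in> Hom E J \<g>" for v
    using ex_add[OF v dh s] ex_nilsq[OF v d] R.a_comm[OF sc dc] by simp
  moreover have "app x d \<in> carrier (GG J)" "app y d \<in> carrier (GG J)" "app (exp_ad s x \<one>\<^sub>R[J] y) d \<in> carrier (GG J)"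
    "ex \<cdot> smul J s x \<in> carrier (GG J)" "ex \<cdot> smul J s y \<in> carrier (GG J)"
    using tapp_hom[OF x d] tapp_hom[OF y d] tapp_hom[OF adjD(3)[OF A] d] ex_hom tsmult_hom[OF s x] tsmult_hom[OF s y] by simp_all
  ultimately show ?thesis
    unfolding Q using x y B.m_assoc B.m_closed by metis
qed

lemma bch_four:
  assumes x: "x \<in> Hom E J \<g>" and y: "y \<in> Hom E J \<g>"
    and e: "a \<in> Nsq J" "b \<in> Nsq J" "c \<in> Nsq J" and d: "d \<in> Nsq J"
  defines "s \<equiv> a +[J] b +[J] c +[J] d"
  shows "(ex \<cdot> smul J s x) \<otimes>[J] (ex \<cdot> smul J s y) = ex \<cdot> bch_at J x y s"
proof -
  have J: "J \<in> Ob E" using x hom_ob by blast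
  interpret rational_lie_algebra "RR J" "gg J" "brac J" "rat_at E R J"
    using J by (rule rational_lie_algebra_at)
  let ?P = "\<lambda>s. (ex \<cdot> smul J s x) \<otimes>[J] (ex \<cdot> smul J s y) = ex \<cdot> bch_at J x y s"
  note z = zero_nilsq[OF J] and eh = nilsq_hom[OF e(1)] nilsq_hom[OF e(2)] nilsq_hom[OF e(3)] nilsq_hom[OF d]
  have xc: "x \<in> carrier (gg J)" and yc: "y \<in> carrier (gg J)" using x y lie_algebra_at_carrierI by blast+
  note bc = bch\<^sub>2_closed[OF xc yc] bch\<^sub>3_closed[OF xc yc] bch\<^sub>4_closed[OF xc yc]
  have "lie_algebra.horner (gg J) \<zero>[J] (vadd J x y) (bch\<^sub>2 x y) (bch\<^sub>3 x y) (bch\<^sub>4 x y) \<in> Hom E J \<g>"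
    using horner_closed[OF R.zero_closed M.a_closed[OF xc yc] bc] by (simp add: lie_algebra_at_simps)
  \<comment> \<open>At \<open>s = 0\<close> every exponential is the value of a tangent vector at
    zero, hence the unit.\<close>
  then have "?P \<zero>[J]"
    using ex_nilsq[OF _ z] tapp_zero x y J by simp
  \<comment> \<open>\<open>bch_step\<close> expects three summands before the new one; shorter sums
    are padded with the nilsquare element zero.\<close>
  then have "?P a"
    using bch_step[OF x y z z z e(1)] J eh by simp
  then have "?P (a +[J] b)"
    using bch_step[OF x y e(1) z z e(2)] J eh by simp
  then have "?P (a +[J] b +[J] c)"
    using bch_step[OF x y e(1,2) z e(3)] J eh by simp
  then show ?thesis
    unfolding s_def by (rule bch_step[OF x y e d])
qed

end

theorem theorem5:
  fixes E :: "('o, 'm) cccat" and R :: "('o, 'm) ring_object" and G :: "('o, 'm) group_object"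
    and ex :: 'm and J :: 'o and X Y d\<^sub>1 d\<^sub>2 d\<^sub>3 d\<^sub>4 s :: 'm
    and K :: "'m ring" and \<GG> :: "'m monoid" and \<gg> :: "('m, 'm) module"
    and br :: "'m \<Rightarrow> 'm \<Rightarrow> 'm" (\<open>\<lbrakk>_, _\<rbrakk>\<close>) and q :: "rat \<Rightarrow> 'm"
  assumes "sdg_model E R"
    and "lie_group E R G"
    and "exponential_map E R G ex"
    and "J \<in> Ob E"
    and "X \<in> Hom E J (lie_ob E R G)" and "Y \<in> Hom E J (lie_ob E R G)"
    and "d\<^sub>1 \<in> nilsq E R J" and "d\<^sub>2 \<in> nilsq E R J" and "d\<^sub>3 \<in> nilsq E R J" and "d\<^sub>4 \<in> nilsq E R J"
  defines "K \<equiv> ring_at E R J" and "\<GG> \<equiv> group_at E G J" and "\<gg> \<equiv> lie_algebra_at E R G J"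
    and "br \<equiv> lie_bracket E R G J" and "q \<equiv> rat_at E R J"
    and "s \<equiv> d\<^sub>1 \<oplus>\<^bsub>K\<^esub> d\<^sub>2 \<oplus>\<^bsub>K\<^esub> d\<^sub>3 \<oplus>\<^bsub>K\<^esub> d\<^sub>4"
  shows "(ex \<cdot>\<^bsub>E\<^esub> (s \<odot>\<^bsub>\<gg>\<^esub> X)) \<otimes>\<^bsub>\<GG>\<^esub> (ex \<cdot>\<^bsub>E\<^esub> (s \<odot>\<^bsub>\<gg>\<^esub> Y)) =
    ex \<cdot>\<^bsub>E\<^esub>
      (s \<odot>\<^bsub>\<gg>\<^esub> (X \<oplus>\<^bsub>\<gg>\<^esub> Y)
       \<oplus>\<^bsub>\<gg>\<^esub> (q (1/2) \<otimes>\<^bsub>K\<^esub> s [^]\<^bsub>K\<^esub> (2::nat)) \<odot>\<^bsub>\<gg>\<^esub> \<lbrakk>X, Y\<rbrakk>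
       \<oplus>\<^bsub>\<gg>\<^esub> (q (1/12) \<otimes>\<^bsub>K\<^esub> s [^]\<^bsub>K\<^esub> (3::nat)) \<odot>\<^bsub>\<gg>\<^esub> \<lbrakk>\<lbrakk>X, Y\<rbrakk>, Y \<ominus>\<^bsub>\<gg>\<^esub> X\<rbrakk>
       \<oplus>\<^bsub>\<gg>\<^esub> (q (1/96) \<otimes>\<^bsub>K\<^esub> s [^]\<^bsub>K\<^esub> (4::nat)) \<odot>\<^bsub>\<gg>\<^esub>
            (\<lbrakk>X \<oplus>\<^bsub>\<gg>\<^esub> Y, \<lbrakk>\<lbrakk>X, Y\<rbrakk>, X \<oplus>\<^bsub>\<gg>\<^esub> Y\<rbrakk>\<rbrakk>
             \<oplus>\<^bsub>\<gg>\<^esub> \<lbrakk>\<lbrakk>\<lbrakk>X, Y\<rbrakk>, X \<ominus>\<^bsub>\<gg>\<^esub> Y\<rbrakk>, X \<ominus>\<^bsub>\<gg>\<^esub> Y\<rbrakk>))"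
proof -
  interpret exp_lie_group E R G ex
    using assms(1-3) by (simp add: exp_lie_group_def exp_lie_group_axioms_def sdg_model_def)
  interpret L: rational_lie_algebra K \<gg> br q
    unfolding K_def \<gg>_def br_def q_def using assms(4) by (rule rational_lie_algebra_at)
  have s: "s \<in> carrier K"
    unfolding s_def K_def using assms(4,7-10) nilsq_hom by simp
  have XY: "X \<in> carrier \<gg>" "Y \<in> carrier \<gg>"
    unfolding \<gg>_def using assms(5,6) by (simp_all add: lie_algebra_at_carrierI)
  have "(ex \<cdot>\<^bsub>E\<^esub> (s \<odot>\<^bsub>\<gg>\<^esub> X)) \<otimes>\<^bsub>\<GG>\<^esub> (ex \<cdot>\<^bsub>E\<^esub> (s \<odot>\<^bsub>\<gg>\<^esub> Y)) =
      ex \<cdot>\<^bsub>E\<^esub> (s \<odot>\<^bsub>\<gg>\<^esub> L.horner s (X \<oplus>\<^bsub>\<gg>\<^esub> Y) (L.bch\<^sub>2 X Y) (L.bch\<^sub>3 X Y) (L.bch\<^sub>4 X Y))"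
    using bch_four[OF assms(5-10)] unfolding s_def K_def \<GG>_def \<gg>_def br_def q_def lie_algebra_at_simps .
  then show ?thesis
    unfolding L.bch_powers[OF s XY] .
qed

end
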